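(* Let $R$ be a Noetherian superdomain. The following conditions are equivalent: (i) $R$ is regular with Krull superdimension $1\mid N$. (ii) $R_{\mathfrak p}$ is a discrete valuation superring for every prime ideal $\mathfrak p$ of $R$.
   Context: Here $N$ denotes a non-negative integer. A superring is a unitary $\mathbb Z_2$-graded ring $R=R_{\overline 0}\oplus R_{\overline 1}$ with $1\ne 0$, always assumed supercommutative: $R_{\overline 0}$ is contained in the center of $R$ and every element of $R_{\overline 1}$ squares to zero. A superideal is a $\mathbb Z_2$-graded ideal; $R$ is Noetherian if it satisfies the ascending chain condition on superideals. An ideal $\mathfrak p$ is prime (maximal) if $R/\mathfrak p$ is an integral domain (a field); such ideals have the form $\mathfrak p=\mathfrak p_{\overline 0}\oplus R_{\overline 1}$ with $\mathfrak p_{\overline 0}=\mathfrak p\cap R_{\overline 0}$. $\mathfrak J_R=R\cdot R_{\overline 1}$ and $\overline R=R/\mathfrak J_R$; $R$ is a superdomain if $\overline R$ is a domain. For a multiplicative set $S\subseteq R_{\overline 0}$, $S^{-1}R=S^{-1}R_{\overline 0}\oplus S^{-1}R_{\overline 1}$, and $R_{\mathfrak p}$ is the localization at $R_{\overline 0}\setminus\mathfrak p_{\overline 0}$, a local superring (one with a unique maximal ideal). Krull superdimension: let $R$ be a Noetherian superring with $\mathrm{Kdim}(R_{\overline 0})<\infty$ (usual Krull dimension). Odd elements $a_1,\dots,a_n\in R_{\overline 1}$ form a system of odd parameters of length $n$ if $\mathrm{Kdim}(R_{\overline 0})=\mathrm{Kdim}\big(R_{\overline 0}/\mathrm{Ann}_{R_{\overline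 0}}(a_1\cdots a_n)\big)$. $\mathrm{Ksdim}_{\overline 1}(R)$ is the greatest length of a system of odd parameters, $\mathrm{Ksdim}_{\overline 0}(R)=\mathrm{Kdim}(R_{\overline 0})$, and the Krull superdimension is $\mathrm{Ksdim}(R)=\mathrm{Ksdim}_{\overline 0}(R)\mid\mathrm{Ksdim}_{\overline 1}(R)$. A local Noetherian superring $(R,\mathfrak m)$ with residue field $\Bbbk=R/\mathfrak m$ is regular if $\mathrm{Ksdim}(R)=\dim_\Bbbk\big((\mathfrak m/\mathfrak m^2)_{\overline 0}\big)\mid\dim_\Bbbk\big((\mathfrak m/\mathfrak m^2)_{\overline 1}\big)$. A Noetherian superring is regular if $R_{\mathfrak p}$ is regular for every prime ideal $\mathfrak p$ (equivalently, for every maximal ideal). A discrete valuation superring is a regular local Noetherian superring of Krull superdimension $1\mid N$, where $N$ is a non-negative integer.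
   Formalization: In (ii) the prime J_R = R·R_1 is left out unless it is maximal: R_{J_R} always has even Krull superdimension 0, so (ii) as worded never holds, while (i) holds e.g. for the integers with zero odd part. *)

theory Defs
  imports
    "HOL-Library.Extended_Real"
    "HOL-Algebra.QuotRing"
    "HOL-Algebra.Ideal_Product"
    "Jordan_Normal_Form.Missing_VectorSpace"
begin

section \<open>Superrings\<close>

record 'a superring = "'a ring" +
  even_part :: "'a set"
  odd_part :: "'a set"

text \<open>Superrings are supercommutative by convention.  That \<open>\<one>\<close> is even, that the two
  parts are closed under negation, and that odd elements anticommute, follow from the axioms.\<close>

locale superring = ring R for R :: "('a, 'b) superring_scheme" (structure) +
  assumes one_neq_zero: "\<one> \<noteq> \<zero>"
    and even_additive_subgroup: "additive_subgroup (even_part R) R"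
    and odd_additive_subgroup: "additive_subgroup (odd_part R) R"
    and even_odd_sum: "even_part R <+> odd_part R = carrier R"
    and even_odd_inter: "even_part R \<inter> odd_part R = {\<zero>}"
    and even_even: "\<lbrakk>a \<in> even_part R; b \<in> even_part R\<rbrakk> \<Longrightarrow> a \<otimes> b \<in> even_part R"
    and even_odd: "\<lbrakk>a \<in> even_part R; b \<in> odd_part R\<rbrakk> \<Longrightarrow> a \<otimes> b \<in> odd_part R"
    and odd_even: "\<lbrakk>a \<in> odd_part R; b \<in> even_part R\<rbrakk> \<Longrightarrow> a \<otimes> b \<in> odd_part R"
    and odd_odd: "\<lbrakk>a \<in> odd_part R; b \<in> odd_part R\<rbrakk> \<Longrightarrow> a \<otimes> b \<in> even_part R"
    and even_central: "\<lbrakk>a \<in> even_part R; x \<in> carrier R\<rbrakk> \<Longrightarrow> a \<otimes> x = x \<otimes> a"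
    and odd_square: "a \<in> odd_part R \<Longrightarrow> a \<otimes> a = \<zero>"

definition even_ring :: "('a, 'b) superring_scheme \<Rightarrow> ('a, 'b) superring_scheme"
  where "even_ring R = R\<lparr>carrier := even_part R\<rparr>"

definition superideal :: "'a set \<Rightarrow> ('a, 'b) superring_scheme \<Rightarrow> bool"
  where "superideal I R \<longleftrightarrow>
    ideal I R \<and> I = (I \<inter> even_part R) <+>\<^bsub>R\<^esub> (I \<inter> odd_part R)"

definition noetherian_superring :: "('a, 'b) superring_scheme \<Rightarrow> bool"
  where "noetherian_superring R \<longleftrightarrow> superring R \<and>
    (\<forall>I :: nat \<Rightarrow> 'a set. (\<forall>n. superideal (I n) R \<and> I n \<subseteq> I (Suc n)) \<longrightarrow>
      (\<exists>n. \<forall>m\<ge>n. I m = I n))"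

text \<open>The library's \<^const>\<open>primeideal\<close> is restricted to commutative rings, hence the
  definition through the quotient.  Since odd elements square to zero, such ideals contain
  the odd part, so they are automatically graded.\<close>

definition super_prime :: "'a set \<Rightarrow> ('a, 'b) superring_scheme \<Rightarrow> bool"
  where "super_prime P R \<longleftrightarrow> ideal P R \<and> domain (R Quot P)"

definition super_maximal :: "'a set \<Rightarrow> ('a, 'b) superring_scheme \<Rightarrow> bool"
  where "super_maximal P R \<longleftrightarrow> ideal P R \<and> field (R Quot P)"

text \<open>The ideal \<open>R \<cdot> R\<^sub>1\<close>, the finite sums of products \<open>r \<otimes> a\<close> with \<open>a\<close> odd; as it is
  two-sided, it is the ideal generated by the odd part.\<close>

definition odd_ideal :: "('a, 'b) superring_scheme \<Rightarrow> 'a set"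
  where "odd_ideal R = Idl\<^bsub>R\<^esub> (odd_part R)"

definition superdomain :: "('a, 'b) superring_scheme \<Rightarrow> bool"
  where "superdomain R \<longleftrightarrow> superring R \<and> domain (R Quot odd_ideal R)"


section \<open>Localization\<close>

text \<open>\<open>S\<close> is meant to be a multiplicative set of even, hence central, elements.\<close>

definition fraction_rel :: "('a, 'b) superring_scheme \<Rightarrow> 'a set \<Rightarrow> (('a \<times> 'a) \<times> ('a \<times> 'a)) set"
  where "fraction_rel R S =
    {((r, s), (r', s')). r \<in> carrier R \<and> s \<in> S \<and> r' \<in> carrier R \<and> s' \<in> S \<and>
      (\<exists>u\<in>S. u \<otimes>\<^bsub>R\<^esub> (r \<otimes>\<^bsub>R\<^esub> s' \<ominus>\<^bsub>R\<^esub> r' \<otimes>\<^bsub>R\<^esub> s) = \<zero>\<^bsub>R\<^esub>)}"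

definition fraction :: "('a, 'b) superring_scheme \<Rightarrow> 'a set \<Rightarrow> 'a \<Rightarrow> 'a \<Rightarrow> ('a \<times> 'a) set"
  where "fraction R S r s = fraction_rel R S `` {(r, s)}"

text \<open>As with \<^const>\<open>rcoset_mult\<close>, the operations are unions over all representatives,
  which are unions of a single class with itself.\<close>

definition localization :: "('a, 'b) superring_scheme \<Rightarrow> 'a set \<Rightarrow> ('a \<times> 'a) set superring"
  where "localization R S =
    \<lparr>carrier = {fraction R S r s |r s. r \<in> carrier R \<and> s \<in> S},
     mult = (\<lambda>X Y. \<Union>(r, s)\<in>X. \<Union>(r', s')\<in>Y. fraction R S (r \<otimes>\<^bsub>R\<^esub> r') (s \<otimes>\<^bsub>R\<^esub> s')),
     one = fraction R S \<one>\<^bsub>R\<^esub> \<one>\<^bsub>R\<^esub>,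
     zero = fraction R S \<zero>\<^bsub>R\<^esub> \<one>\<^bsub>R\<^esub>,
     add = (\<lambda>X Y. \<Union>(r, s)\<in>X. \<Union>(r', s')\<in>Y.
        fraction R S (r \<otimes>\<^bsub>R\<^esub> s' \<oplus>\<^bsub>R\<^esub> r' \<otimes>\<^bsub>R\<^esub> s) (s \<otimes>\<^bsub>R\<^esub> s')),
     even_part = {fraction R S r s |r s. r \<in> even_part R \<and> s \<in> S},
     odd_part = {fraction R S r s |r s. r \<in> odd_part R \<and> s \<in> S}\<rparr>"

definition localization_at :: "('a, 'b) superring_scheme \<Rightarrow> 'a set \<Rightarrow> ('a \<times> 'a) set superring"
  where "localization_at R P = localization R (even_part R - P)"


section \<open>Krull superdimension\<close>

text \<open>The supremum is taken in \<^typ>\<open>ereal\<close> so that the zero ring, which has no prime ideal,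
  gets dimension \<open>-\<infinity>\<close>.  With value \<open>0\<close> there, odd elements with product zero
  would form a system of odd parameters over a zero-dimensional ring.\<close>

definition Kdim :: "('a, 'b) ring_scheme \<Rightarrow> ereal"
  where "Kdim A = Sup {ereal (real n) |n. \<exists>P :: nat \<Rightarrow> 'a set.
    (\<forall>i\<le>n. primeideal (P i) A) \<and> (\<forall>i<n. P i \<subset> P (Suc i))}"

definition even_annihilator :: "('a, 'b) superring_scheme \<Rightarrow> 'a \<Rightarrow> 'a set"
  where "even_annihilator R x = {r \<in> even_part R. r \<otimes>\<^bsub>R\<^esub> x = \<zero>\<^bsub>R\<^esub>}"

definition odd_parameters :: "('a, 'b) superring_scheme \<Rightarrow> 'a list \<Rightarrow> bool"
  where "odd_parameters R as \<longleftrightarrow> set as \<subseteq> odd_part R \<and>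
    Kdim (even_ring R) =
      Kdim (even_ring R Quot even_annihilator R (foldr (\<otimes>\<^bsub>R\<^esub>) as \<one>\<^bsub>R\<^esub>))"

text \<open>\<open>Ksdim R = (d, n)\<close> is the superdimension \<open>d | n\<close>.  It is meaningful for Noetherian
  superrings with \<open>Kdim (even_ring R) < \<infinity>\<close>; an equation whose left component is a natural
  number includes this finiteness.\<close>

definition Ksdim :: "('a, 'b) superring_scheme \<Rightarrow> ereal \<times> nat"
  where "Ksdim R =
    (Kdim (even_ring R), GREATEST n. \<exists>as. length as = n \<and> odd_parameters R as)"


section \<open>Regularity\<close>

text \<open>For a maximal ideal \<open>m\<close> and \<open>X\<close> the even or odd part of \<open>R\<close>, the corresponding graded
  piece of \<open>m/m\<^sup>2\<close>, namely the image of \<open>m \<inter> X\<close> in \<open>R/m\<^sup>2\<close>, as a vector space over \<open>R/m\<close>.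
  The scalar product of the cosets of \<open>r\<close> modulo \<open>m\<close> and of \<open>x\<close> modulo \<open>m\<^sup>2\<close>, for \<open>x \<in> m\<close>,
  is the coset of \<open>r \<otimes> x\<close> modulo \<open>m\<^sup>2\<close>.  The fields \<open>mult\<close> and \<open>one\<close> are irrelevant.\<close>

definition cotangent_part ::
    "('a, 'b) superring_scheme \<Rightarrow> 'a set \<Rightarrow> 'a set \<Rightarrow> ('a set, 'a set) module"
  where "cotangent_part R m X = (let m2 = ideal_prod R m m in
    \<lparr>carrier = (\<lambda>x. m2 +>\<^bsub>R\<^esub> x) ` (m \<inter> X),
     mult = rcoset_mult R m2,
     one = m2 +>\<^bsub>R\<^esub> \<one>\<^bsub>R\<^esub>,
     zero = m2,
     add = set_add R,
     smult = rcoset_mult R m2\<rparr>)"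

definition regular_local_superring :: "('a, 'b) superring_scheme \<Rightarrow> bool"
  where "regular_local_superring R \<longleftrightarrow> noetherian_superring R \<and>
    (\<exists>m. {I. super_maximal I R} = {m} \<and>
      Ksdim R =
        (ereal (real (vectorspace.dim (R Quot m) (cotangent_part R m (even_part R)))),
         vectorspace.dim (R Quot m) (cotangent_part R m (odd_part R))))"

definition regular_superring :: "('a, 'b) superring_scheme \<Rightarrow> bool"
  where "regular_superring R \<longleftrightarrow> noetherian_superring R \<and>
    (\<forall>P. super_prime P R \<longrightarrow> regular_local_superring (localization_at R P))"

definition discrete_valuation_superring :: "('a, 'b) superring_scheme \<Rightarrow> bool"
  where "discrete_valuation_superring R \<longleftrightarrow>
    regular_local_superring R \<and> (\<exists>N. Ksdim R = (1, N))"

end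

theory Submission
  imports Defs
begin

text \<open>
  Let \<open>J\<close> be the ideal generated by the odd part. Odd elements square to zero, so every prime of \<open>R\<close>
  contains them, and primes of \<open>R\<close> correspond to primes of the even ring. For a superdomain \<open>J\<close> is
  itself prime, hence the least prime, and it stays the least prime in every localization.

  This makes the odd dimension a generic invariant. For finite even dimension, odd elements are a
  system of odd parameters exactly if the annihilator of their product lies in \<open>J\<close>
  (\<open>odd_parameters_iff\<close>), a condition that is insensitive to clearing denominators. So \<open>R\<close> and all its
  localizations have the same odd dimension as soon as their even dimensions are finite
  (\<open>Ksdim_odd_localization_at\<close>). The even dimensions are lengths of chains of
  primes inside the given prime: if \<open>R\<close> has dimension one, so has the localization at each prime
  other than \<open>J\<close>, and conversely (\<open>Kdim_loc_one\<close>, \<open>Kdim_one_of_loc\<close>). This proves that (i) implies (ii).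

  For the converse a maximal ideal exists by the chain condition; it differs from \<open>J\<close>, where the
  localization has dimension zero. Hence \<open>R\<close> has superdimension \<open>1 | N\<close>, and it remains to see that the
  localization at \<open>J\<close> is regular (\<open>regular_at_J\<close>). Let \<open>P\<close> be another prime. Regularity at \<open>P\<close> says that the
  odd cotangent space there has dimension \<open>N\<close>, so by Nakayama's lemma the odd part of the localization at
  \<open>P\<close> has \<open>N\<close> generators (\<open>cotangent_odd_generators\<close>), and they also generate the odd part of the further
  localization at \<open>J\<close>. Fewer than \<open>N\<close> generators do not suffice at \<open>J\<close>: a product of more odd elements
  than there are generators is zero (\<open>mprod_vanishes\<close>), while there are \<open>N\<close> odd parameters. So the odd
  cotangent space at \<open>J\<close> has dimension \<open>N\<close>; the even one is zero because the maximal ideal is generated by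
  odd elements (\<open>cotangent_even_zero\<close>).
\<close>

section \<open>Graded pieces and graded ideals of a superring\<close>

lemma (in ring) ideal_of_closed:
  assumes "I \<subseteq> carrier R" and "\<zero> \<in> I"
    and "\<And>x y. \<lbrakk>x \<in> I; y \<in> I\<rbrakk> \<Longrightarrow> x \<oplus> y \<in> I"
    and "\<And>r x. \<lbrakk>r \<in> carrier R; x \<in> I\<rbrakk> \<Longrightarrow> r \<otimes> x \<in> I"
    and "\<And>r x. \<lbrakk>r \<in> carrier R; x \<in> I\<rbrakk> \<Longrightarrow> x \<otimes> r \<in> I"
  shows "ideal I R"
proof (rule idealI[OF ring_axioms])
  have "\<ominus> x \<in> I" if "x \<in> I" for x
  proof -
    have "x \<in> carrier R" using that assms(1) by blast
    then have "\<ominus> \<one> \<otimes> x = \<ominus> x" by (simp add: l_minus)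
    with assms(4)[of "\<ominus> \<one>" x] that show ?thesis by simp
  qed
  then show "subgroup I (add_monoid R)"
    using assms(1-3) by (auto intro!: add.subgroupI simp: a_inv_def)
qed (use assms in auto)

lemma (in ring) ideal_closed:
  assumes "ideal I R"
  shows "I \<subseteq> carrier R" and "\<zero> \<in> I"
    and "\<And>x y. \<lbrakk>x \<in> I; y \<in> I\<rbrakk> \<Longrightarrow> x \<oplus> y \<in> I"
    and "\<And>x y. \<lbrakk>x \<in> I; y \<in> I\<rbrakk> \<Longrightarrow> x \<ominus> y \<in> I"
    and "\<And>r x. \<lbrakk>r \<in> carrier R; x \<in> I\<rbrakk> \<Longrightarrow> r \<otimes> x \<in> I"
    and "\<And>r x. \<lbrakk>r \<in> carrier R; x \<in> I\<rbrakk> \<Longrightarrow> x \<otimes> r \<in> I"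
proof -
  interpret I: ideal I R by fact
  show "I \<subseteq> carrier R" by (rule I.a_subset)
qed (auto simp: a_minus_def ideal.I_l_closed[OF assms] ideal.I_r_closed[OF assms]
    additive_subgroup.zero_closed[OF ideal.axioms(1)[OF assms]]
    additive_subgroup.a_closed[OF ideal.axioms(1)[OF assms]]
    additive_subgroup.a_inv_closed[OF ideal.axioms(1)[OF assms]])

lemma (in ring) coset_eq_iff:
  assumes "ideal I R" "x \<in> carrier R" "y \<in> carrier R"
  shows "I +> x = I +> y \<longleftrightarrow> x \<ominus> y \<in> I"
  using quotient_eq_iff_same_a_r_cos[OF assms] by simp

lemma (in ring) coset_zero_iff:
  assumes "ideal I R" "x \<in> carrier R"
  shows "I +> x = I \<longleftrightarrow> x \<in> I"
proof -
  have "I +> \<zero> = I"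
    using ideal_closed(1)[OF assms(1)] by (rule a_coset_add_zero)
  with coset_eq_iff[OF assms zero_closed] assms(2) show ?thesis
    by (simp add: a_minus_def)
qed

lemma (in ring) quotient_ops:
  assumes "ideal I R"
  shows "carrier (R Quot I) = (+>) I ` carrier R" "\<zero>\<^bsub>R Quot I\<^esub> = I" "\<one>\<^bsub>R Quot I\<^esub> = I +> \<one>"
    "\<And>x y. \<lbrakk>x \<in> carrier R; y \<in> carrier R\<rbrakk> \<Longrightarrow> (I +> x) \<otimes>\<^bsub>R Quot I\<^esub> (I +> y) = I +> (x \<otimes> y)"
    "\<And>x y. \<lbrakk>x \<in> carrier R; y \<in> carrier R\<rbrakk> \<Longrightarrow> (I +> x) \<oplus>\<^bsub>R Quot I\<^esub> (I +> y) = I +> (x \<oplus> y)"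
proof -
  interpret I: ideal I R by fact
  show "carrier (R Quot I) = (+>) I ` carrier R" "\<zero>\<^bsub>R Quot I\<^esub> = I" "\<one>\<^bsub>R Quot I\<^esub> = I +> \<one>"
    by (auto simp: FactRing_def A_RCOSETS_def')
qed (simp_all add: FactRing_def ideal.rcoset_mult_add[OF assms]
    abelian_subgroup.a_rcos_sum[OF abelian_subgroupI3[OF ideal.axioms(1)[OF assms] is_abelian_group]])

context superring
begin

lemma even_carr [intro]: "a \<in> even_part R \<Longrightarrow> a \<in> carrier R"
  using additive_subgroup.a_subset[OF even_additive_subgroup] by blast

lemma odd_carr [intro]: "a \<in> odd_part R \<Longrightarrow> a \<in> carrier R"
  using additive_subgroup.a_subset[OF odd_additive_subgroup] by blast

lemma even_closed [simp, intro]: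
  "\<zero> \<in> even_part R"
  "\<lbrakk>a \<in> even_part R; b \<in> even_part R\<rbrakk> \<Longrightarrow> a \<oplus> b \<in> even_part R"
  "a \<in> even_part R \<Longrightarrow> \<ominus> a \<in> even_part R"
  "\<lbrakk>a \<in> even_part R; b \<in> even_part R\<rbrakk> \<Longrightarrow> a \<ominus> b \<in> even_part R"
proof -
  interpret H: additive_subgroup "even_part R" R by (rule even_additive_subgroup)
  show
    "\<zero> \<in> even_part R"
    "\<lbrakk>a \<in> even_part R; b \<in> even_part R\<rbrakk> \<Longrightarrow> a \<oplus> b \<in> even_part R"
    "a \<in> even_part R \<Longrightarrow> \<ominus> a \<in> even_part R"
    "\<lbrakk>a \<in> even_part R; b \<in> even_part R\<rbrakk> \<Longrightarrow> a \<ominus> b \<in> even_part R"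
    using H.a_inv_closed by (auto simp: a_minus_def)
qed

lemma odd_closed [simp, intro]:
  "\<zero> \<in> odd_part R"
  "\<lbrakk>a \<in> odd_part R; b \<in> odd_part R\<rbrakk> \<Longrightarrow> a \<oplus> b \<in> odd_part R"
  "a \<in> odd_part R \<Longrightarrow> \<ominus> a \<in> odd_part R"
  "\<lbrakk>a \<in> odd_part R; b \<in> odd_part R\<rbrakk> \<Longrightarrow> a \<ominus> b \<in> odd_part R"
proof -
  interpret H: additive_subgroup "odd_part R" R by (rule odd_additive_subgroup)
  show
    "\<zero> \<in> odd_part R"
    "\<lbrakk>a \<in> odd_part R; b \<in> odd_part R\<rbrakk> \<Longrightarrow> a \<oplus> b \<in> odd_part R"
    "a \<in> odd_part R \<Longrightarrow> \<ominus> a \<in> odd_part R"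
    "\<lbrakk>a \<in> odd_part R; b \<in> odd_part R\<rbrakk> \<Longrightarrow> a \<ominus> b \<in> odd_part R"
    using H.a_inv_closed by (auto simp: a_minus_def)
qed

lemma graded_decomposition:
  assumes "x \<in> carrier R"
  obtains a b where "a \<in> even_part R" "b \<in> odd_part R" "x = a \<oplus> b"
  using assms even_odd_sum unfolding set_add_def' by blast

lemma even_and_odd: "\<lbrakk>a \<in> even_part R; a \<in> odd_part R\<rbrakk> \<Longrightarrow> a = \<zero>"
  using even_odd_inter by blast

lemma graded_decomposition_unique:
  assumes "a \<in> even_part R" "a' \<in> even_part R" "b \<in> odd_part R" "b' \<in> odd_part R"
    and "a \<oplus> b = a' \<oplus> b'"
  shows "a = a'" and "b = b'"
proof -
  have carr: "a \<in> carrier R" "a' \<in> carrier R" "b \<in> carrier R" "b' \<in> carrier R"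
    using assms by auto
  have "a \<ominus> a' = b' \<ominus> b"
  proof -
    have "a \<ominus> a' = (a \<oplus> b) \<ominus> (a' \<oplus> b)" using carr by algebra
    also have "\<dots> = (a' \<oplus> b') \<ominus> (a' \<oplus> b)" using assms(5) by simp
    also have "\<dots> = b' \<ominus> b" using carr by algebra
    finally show ?thesis .
  qed
  then have "a \<ominus> a' = \<zero>" "b' \<ominus> b = \<zero>"
    using even_and_odd[of "a \<ominus> a'"] even_and_odd[of "b' \<ominus> b"] assms by (metis even_closed(4) odd_closed(4))+
  then show "a = a'" "b = b'" using carr by auto
qed

text \<open>Write \<open>\<one> = a \<oplus> b\<close>. Multiplying by \<open>a\<close> and comparing odd components gives \<open>a \<otimes> b = \<zero>\<close>, and then
  \<open>b = \<one> \<otimes> b = b \<otimes> b = \<zero>\<close>.\<close>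

lemma one_even [simp, intro]: "\<one> \<in> even_part R"
proof -
  obtain a b where ab: "a \<in> even_part R" "b \<in> odd_part R" "\<one> = a \<oplus> b"
    using graded_decomposition[of \<one>] by auto
  have carr: "a \<in> carrier R" "b \<in> carrier R" using ab by auto
  have "a \<oplus> \<zero> = a \<otimes> a \<oplus> a \<otimes> b"
    using ab(3) carr by (metis r_distr r_one r_zero)
  from graded_decomposition_unique(2)[OF _ _ _ _ this] ab
  have "a \<otimes> b = \<zero>" by (simp add: even_even even_odd)
  moreover have "b = a \<otimes> b \<oplus> b \<otimes> b"
    using ab(3) carr by (metis l_distr l_one)
  ultimately have "b = \<zero>" using odd_square[OF ab(2)] carr by simp
  then show ?thesis using ab carr by simp
qed

lemma odd_anticommute:
  assumes "a \<in> odd_part R" "b \<in> odd_part R"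
  shows "a \<otimes> b = \<ominus> (b \<otimes> a)"
proof -
  have carr: "a \<in> carrier R" "b \<in> carrier R" using assms by auto
  have "\<zero> = (a \<oplus> b) \<otimes> (a \<oplus> b)" using assms by (simp add: odd_square)
  also have "\<dots> = (a \<otimes> a \<oplus> a \<otimes> b) \<oplus> (b \<otimes> a \<oplus> b \<otimes> b)" using carr by algebra
  also have "\<dots> = a \<otimes> b \<oplus> b \<otimes> a" using assms carr by (simp add: odd_square)
  finally show ?thesis using carr by (metis m_closed minus_equality)
qed

lemma even_ring_simps [simp]:
  "carrier (even_ring R) = even_part R" "mult (even_ring R) = mult R"
  "one (even_ring R) = \<one>" "zero (even_ring R) = \<zero>" "add (even_ring R) = add R"
  by (simp_all add: even_ring_def)

lemma even_ring_cring: "cring (even_ring R)"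
proof (rule cringI)
  show "abelian_group (even_ring R)"
  proof (rule abelian_groupI)
    fix x assume "x \<in> carrier (even_ring R)"
    then show "\<exists>y\<in>carrier (even_ring R). y \<oplus>\<^bsub>even_ring R\<^esub> x = \<zero>\<^bsub>even_ring R\<^esub>"
      by (intro bexI[of _ "\<ominus> x"]) (auto intro!: l_neg)
  qed (auto intro: a_assoc a_comm l_zero)
  show "comm_monoid (even_ring R)"
    by (rule comm_monoidI) (auto simp: even_even intro: m_assoc even_central l_one)
qed (auto intro: l_distr)

lemma minus_even_ring: "x \<in> even_part R \<Longrightarrow> \<ominus>\<^bsub>even_ring R\<^esub> x = \<ominus> x"
proof -
  assume x: "x \<in> even_part R"
  interpret A: cring "even_ring R" by (rule even_ring_cring)
  show ?thesis using A.minus_equality[of "\<ominus> x" x] x by (simp add: even_carr l_neg)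
qed

text \<open>Even elements are central, so only odd elements are tested on both sides.\<close>

lemma ideal_of_graded_closed:
  assumes "I \<subseteq> carrier R" and "\<zero> \<in> I"
    and add: "\<And>x y. \<lbrakk>x \<in> I; y \<in> I\<rbrakk> \<Longrightarrow> x \<oplus> y \<in> I"
    and ev: "\<And>r x. \<lbrakk>r \<in> even_part R; x \<in> I\<rbrakk> \<Longrightarrow> r \<otimes> x \<in> I"
    and ol: "\<And>r x. \<lbrakk>r \<in> odd_part R; x \<in> I\<rbrakk> \<Longrightarrow> r \<otimes> x \<in> I"
    and orr: "\<And>r x. \<lbrakk>r \<in> odd_part R; x \<in> I\<rbrakk> \<Longrightarrow> x \<otimes> r \<in> I"
  shows "ideal I R"
proof (rule ideal_of_closed[OF assms(1-3)])
  fix r x assume r: "r \<in> carrier R" and x: "x \<in> I"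
  obtain a b where ab: "a \<in> even_part R" "b \<in> odd_part R" "r = a \<oplus> b"
    using graded_decomposition[OF r] by blast
  have carr: "a \<in> carrier R" "b \<in> carrier R" "x \<in> carrier R" using ab x assms(1) by auto
  show "r \<otimes> x \<in> I"
    using ab(3) carr add[OF ev[OF ab(1) x] ol[OF ab(2) x]] by (simp add: l_distr)
  have "x \<otimes> a = a \<otimes> x" using even_central[OF ab(1) carr(3)] by simp
  then show "x \<otimes> r \<in> I"
    using ab(3) carr add[OF ev[OF ab(1) x] orr[OF ab(2) x]] by (simp add: r_distr)
qed

text \<open>It is enough to test the even component: the odd one is then a difference of two elements of the
  ideal.\<close>

lemma superideal_iff:
  "superideal I R \<longleftrightarrow> ideal I R \<and>
    (\<forall>a\<in>even_part R. \<forall>b\<in>odd_part R. a \<oplus> b \<in> I \<longrightarrow> a \<in> I)"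
proof (cases "ideal I R")
  case True
  note I = ideal_closed[OF True]
  have "I = (I \<inter> even_part R) <+> (I \<inter> odd_part R) \<longleftrightarrow>
    (\<forall>a\<in>even_part R. \<forall>b\<in>odd_part R. a \<oplus> b \<in> I \<longrightarrow> a \<in> I)" (is "?L \<longleftrightarrow> ?R")
  proof
    assume ?L
    show ?R
    proof (intro ballI impI)
      fix a b assume ab: "a \<in> even_part R" "b \<in> odd_part R" "a \<oplus> b \<in> I"
      with \<open>?L\<close> obtain a' b' where "a' \<in> I \<inter> even_part R" "b' \<in> I \<inter> odd_part R" "a \<oplus> b = a' \<oplus> b'"
        unfolding set_add_def' by blast
      then show "a \<in> I" using graded_decomposition_unique(1)[of a a' b b'] ab by auto
    qed
  next
    assume R: ?R
    show ?L
    proof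
      show "I \<subseteq> (I \<inter> even_part R) <+> (I \<inter> odd_part R)"
      proof
        fix x assume x: "x \<in> I"
        obtain a b where ab: "a \<in> even_part R" "b \<in> odd_part R" "x = a \<oplus> b"
          using graded_decomposition I(1) x by blast
        then have a: "a \<in> I" using R x by blast
        have "x \<ominus> a = b" using ab even_carr odd_carr by algebra
        then have "b \<in> I" using I(4)[OF x a] by simp
        then show "x \<in> (I \<inter> even_part R) <+> (I \<inter> odd_part R)"
          using a ab unfolding set_add_def' by blast
      qed
      show "(I \<inter> even_part R) <+> (I \<inter> odd_part R) \<subseteq> I"
        using I(3) unfolding set_add_def' by blast
    qed
  qed
  then show ?thesis by (simp add: superideal_def True)
next
  case False
  then show ?thesis by (simp add: superideal_def)
qed

section \<open>Prime and maximal ideals\<close>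

text \<open>An element of square zero lies in every ideal with the prime property. Odd elements are of this
  kind, and commutators in \<open>R\<close> involve odd elements only, so the quotient by such an ideal is
  commutative although \<open>R\<close> is not.\<close>

lemma super_prime_iff:
  "super_prime P R \<longleftrightarrow> ideal P R \<and> \<one> \<notin> P \<and>
    (\<forall>x\<in>carrier R. \<forall>y\<in>carrier R. x \<otimes> y \<in> P \<longrightarrow> x \<in> P \<or> y \<in> P)"
  (is "_ \<longleftrightarrow> ?R")
proof (cases "ideal P R")
  case True
  note P = ideal_closed[OF True]
  interpret P: ideal P R by fact
  interpret Q: ring "R Quot P" by (rule P.quotient_is_ring)
  note carr = quotient_ops(1)[OF True] and ops = quotient_ops(2,3)[OF True]
    and mult = quotient_ops(4)[OF True]
  show ?thesis
  proof
    assume "super_prime P R"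
    then interpret D: domain "R Quot P" by (simp add: super_prime_def)
    show ?R
    proof (intro conjI ballI impI)
      show "\<one> \<notin> P" using D.one_not_zero ops coset_zero_iff[OF True one_closed] by auto
      fix x y assume xy: "x \<in> carrier R" "y \<in> carrier R" "x \<otimes> y \<in> P"
      then have "(P +> x) \<otimes>\<^bsub>R Quot P\<^esub> (P +> y) = \<zero>\<^bsub>R Quot P\<^esub>"
        using mult ops coset_zero_iff[OF True m_closed] by auto
      then have "P +> x = P \<or> P +> y = P"
        using D.integral[of "P +> x" "P +> y"] carr ops xy by auto
      then show "x \<in> P \<or> y \<in> P" using coset_zero_iff[OF True] xy by blast
    qed (fact True)
  next
    assume R: ?R
    have odd: "a \<in> P" if "a \<in> odd_part R" for a
      using R odd_square[OF that] P(2) that by (metis odd_carr)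
    have comm: "(x \<otimes> y) \<ominus> (y \<otimes> x) \<in> P" if xy: "x \<in> carrier R" "y \<in> carrier R" for x y
    proof -
      obtain a b where ab: "a \<in> even_part R" "b \<in> odd_part R" "x = a \<oplus> b"
        using graded_decomposition[OF xy(1)] by blast
      have carr: "a \<in> carrier R" "b \<in> carrier R" using ab by auto
      have "(x \<otimes> y) \<ominus> (y \<otimes> x) = (a \<otimes> y \<ominus> y \<otimes> a) \<oplus> (b \<otimes> y \<ominus> y \<otimes> b)"
        unfolding ab(3) using carr xy(2) by algebra
      also have "a \<otimes> y \<ominus> y \<otimes> a = \<zero>"
        using even_central[OF ab(1) xy(2)] carr xy by simp
      finally show ?thesis
        using P(4)[OF P(6)[OF xy(2) odd[OF ab(2)]] P(5)[OF xy(2) odd[OF ab(2)]]] carr xy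
        by simp
    qed
    have "domain (R Quot P)"
    proof (rule domain.intro)
      show "cring (R Quot P)"
      proof (intro cring.intro comm_monoid.intro comm_monoid_axioms.intro)
        fix X Y assume "X \<in> carrier (R Quot P)" "Y \<in> carrier (R Quot P)"
        then obtain x y where xy: "x \<in> carrier R" "y \<in> carrier R" "X = P +> x" "Y = P +> y"
          unfolding carr by blast
        then show "X \<otimes>\<^bsub>R Quot P\<^esub> Y = Y \<otimes>\<^bsub>R Quot P\<^esub> X"
          using mult comm coset_eq_iff[OF True] by simp
      qed (rule Q.ring_axioms Q.monoid_axioms)+
      show "domain_axioms (R Quot P)"
      proof
        show "\<one>\<^bsub>R Quot P\<^esub> \<noteq> \<zero>\<^bsub>R Quot P\<^esub>"
          using R ops coset_zero_iff[OF True one_closed] by auto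
        fix X Y assume XY: "X \<otimes>\<^bsub>R Quot P\<^esub> Y = \<zero>\<^bsub>R Quot P\<^esub>"
          "X \<in> carrier (R Quot P)" "Y \<in> carrier (R Quot P)"
        then obtain x y where xy: "x \<in> carrier R" "y \<in> carrier R" "X = P +> x" "Y = P +> y"
          unfolding carr by blast
        then have "x \<otimes> y \<in> P" using XY(1) mult ops coset_zero_iff[OF True m_closed] by auto
        then have "x \<in> P \<or> y \<in> P" using R xy by blast
        then show "X = \<zero>\<^bsub>R Quot P\<^esub> \<or> Y = \<zero>\<^bsub>R Quot P\<^esub>"
          using xy ops coset_zero_iff[OF True] by auto
      qed
    qed
    then show "super_prime P R" by (simp add: super_prime_def True)
  qed
next
  case False
  then show ?thesis by (simp add: super_prime_def)
qed

lemma super_primeD: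
  assumes "super_prime P R"
  shows "ideal P R" "\<one> \<notin> P" "odd_part R \<subseteq> P"
    and "\<And>x y. \<lbrakk>x \<in> carrier R; y \<in> carrier R; x \<otimes> y \<in> P\<rbrakk> \<Longrightarrow> x \<in> P \<or> y \<in> P"
proof -
  show P: "ideal P R" "\<one> \<notin> P"
    and prime: "\<And>x y. \<lbrakk>x \<in> carrier R; y \<in> carrier R; x \<otimes> y \<in> P\<rbrakk> \<Longrightarrow> x \<in> P \<or> y \<in> P"
    using assms super_prime_iff by blast+
  show "odd_part R \<subseteq> P"
    using prime odd_square ideal_closed(2)[OF P(1)] odd_carr by (metis subsetI)
qed

lemma super_maximal_iff:
  "super_maximal P R \<longleftrightarrow>
    super_prime P R \<and> (\<forall>x\<in>carrier R - P. \<exists>y\<in>carrier R. x \<otimes> y \<ominus> \<one> \<in> P)"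
proof (cases "super_prime P R")
  case True
  then interpret D: domain "R Quot P" by (simp add: super_prime_def)
  note P = super_primeD[OF True]
  note carr = quotient_ops(1)[OF P(1)] and ops = quotient_ops(2,3)[OF P(1)]
    and mult = quotient_ops(4)[OF P(1)]
  have "field (R Quot P) \<longleftrightarrow> (\<forall>x\<in>carrier R - P. \<exists>y\<in>carrier R. x \<otimes> y \<ominus> \<one> \<in> P)" (is "_ \<longleftrightarrow> ?R")
  proof
    assume "field (R Quot P)"
    then interpret F: field "R Quot P" .
    show ?R
    proof
      fix x assume x: "x \<in> carrier R - P"
      then have "P +> x \<in> carrier (R Quot P) - {\<zero>\<^bsub>R Quot P\<^esub>}"
        using carr ops coset_zero_iff[OF P(1)] by auto
      then obtain Y where Y: "Y \<in> carrier (R Quot P)" "(P +> x) \<otimes>\<^bsub>R Quot P\<^esub> Y = \<one>\<^bsub>R Quot P\<^esub>"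
        using F.field_Units D.Units_r_inv_ex by blast
      then obtain y where "y \<in> carrier R" "Y = P +> y" unfolding carr by blast
      then show "\<exists>y\<in>carrier R. x \<otimes> y \<ominus> \<one> \<in> P"
        using Y x mult ops coset_eq_iff[OF P(1)] by auto
    qed
  next
    assume R: ?R
    show "field (R Quot P)"
    proof (rule D.cring_fieldI2)
      show "\<zero>\<^bsub>R Quot P\<^esub> \<noteq> \<one>\<^bsub>R Quot P\<^esub>" using D.one_not_zero by simp
      fix X assume X: "X \<in> carrier (R Quot P)" "X \<noteq> \<zero>\<^bsub>R Quot P\<^esub>"
      then obtain x where x: "x \<in> carrier R" "X = P +> x" unfolding carr by blast
      then have "x \<notin> P" using X ops coset_zero_iff[OF P(1)] by auto
      with R x obtain y where "y \<in> carrier R" "x \<otimes> y \<ominus> \<one> \<in> P" by blast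
      then show "\<exists>Y\<in>carrier (R Quot P). X \<otimes>\<^bsub>R Quot P\<^esub> Y = \<one>\<^bsub>R Quot P\<^esub>"
        using x mult ops coset_eq_iff[OF P(1)] unfolding carr by auto
    qed
  qed
  then show ?thesis by (simp add: super_maximal_def True P(1))
next
  case False
  moreover have "\<not> super_maximal P R"
    using False by (auto simp: super_maximal_def super_prime_def field_def)
  ultimately show ?thesis by simp
qed

end

section \<open>Krull dimension and chains of primes\<close>

text \<open>The Krull dimension depends only on the ordered set of primes. Measuring chains in an arbitrary
  family of sets lets the dimensions of the even part, of its quotients and of its localizations all
  be read off from the primes of one superring.\<close>

definition has_chain :: "'a set set \<Rightarrow> nat \<Rightarrow> bool"
  where "has_chain X n \<longleftrightarrow>
    (\<exists>P :: nat \<Rightarrow> 'a set. (\<forall>i\<le>n. P i \<in> X) \<and> (\<forall>i<n. P i \<subset> P (Suc i)))"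

definition chain_dim :: "'a set set \<Rightarrow> ereal"
  where "chain_dim X = Sup {ereal (real n) |n. has_chain X n}"

lemma Kdim_eq_chain_dim: "Kdim A = chain_dim {p. primeideal p A}"
  by (simp add: Kdim_def chain_dim_def has_chain_def)

lemma has_chain_image:
  assumes "has_chain X n" and "\<And>p. p \<in> X \<Longrightarrow> f p \<in> Y"
    and "\<And>p q. \<lbrakk>p \<in> X; q \<in> X; p \<subset> q\<rbrakk> \<Longrightarrow> f p \<subset> f q"
  shows "has_chain Y n"
proof -
  obtain P where P: "\<forall>i\<le>n. P i \<in> X" "\<forall>i<n. P i \<subset> P (Suc i)"
    using assms(1) unfolding has_chain_def by blast
  have "\<forall>i\<le>n. f (P i) \<in> Y" "\<forall>i<n. f (P i) \<subset> f (P (Suc i))"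
    using assms(2,3) P by auto
  then show ?thesis unfolding has_chain_def by (intro exI[of _ "\<lambda>i. f (P i)"]) blast
qed

lemma chain_dim_eqI:
  assumes "\<And>p. p \<in> X \<Longrightarrow> f p \<in> Y" "\<And>p q. \<lbrakk>p \<in> X; q \<in> X; p \<subset> q\<rbrakk> \<Longrightarrow> f p \<subset> f q"
    and "\<And>p. p \<in> Y \<Longrightarrow> g p \<in> X" "\<And>p q. \<lbrakk>p \<in> Y; q \<in> Y; p \<subset> q\<rbrakk> \<Longrightarrow> g p \<subset> g q"
  shows "chain_dim X = chain_dim Y"
proof -
  have "has_chain X = has_chain Y"
  proof
    fix n show "has_chain X n = has_chain Y n"
      using has_chain_image[of X n f Y] has_chain_image[of Y n g X] assms by blast
  qed
  then show ?thesis by (simp add: chain_dim_def)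
qed

lemma has_chain_le: "has_chain X n \<Longrightarrow> m \<le> n \<Longrightarrow> has_chain X m"
  unfolding has_chain_def by (meson dual_order.trans less_le_trans)

text \<open>A supremum of naturals that is finite is attained, and chains can be truncated.\<close>

lemma chain_dim_eq_iff:
  "chain_dim X = ereal (real d) \<longleftrightarrow> has_chain X d \<and> \<not> has_chain X (Suc d)"
proof
  assume d: "chain_dim X = ereal (real d)"
  have "has_chain X d"
  proof (rule ccontr)
    assume "\<not> has_chain X d"
    then have "n < d" if "has_chain X n" for n
      using has_chain_le[OF that, of d] by (meson not_le)
    then have "chain_dim X \<le> ereal (real d - 1)"
      unfolding chain_dim_def by (intro Sup_least) fastforce
    with d show False by simp
  qed
  moreover have "\<not> has_chain X (Suc d)"
  proof
    assume "has_chain X (Suc d)"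
    then have "ereal (real (Suc d)) \<le> chain_dim X"
      unfolding chain_dim_def by (intro Sup_upper) blast
    with d show False by simp
  qed
  ultimately show "has_chain X d \<and> \<not> has_chain X (Suc d)" ..
next
  assume d: "has_chain X d \<and> \<not> has_chain X (Suc d)"
  have "n \<le> d" if "has_chain X n" for n
    using has_chain_le[OF that, of "Suc d"] d by (meson not_less_eq_eq)
  then have "chain_dim X \<le> ereal (real d)"
    unfolding chain_dim_def by (intro Sup_least) fastforce
  moreover have "ereal (real d) \<le> chain_dim X"
    unfolding chain_dim_def using d by (intro Sup_upper) blast
  ultimately show "chain_dim X = ereal (real d)" by simp
qed

text \<open>A chain above a set that is not inside the least member \<open>L\<close> cannot start at \<open>L\<close>, so putting \<open>L\<close> in
  front makes it longer.\<close>

lemma chain_dim_above_iff: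
  assumes "chain_dim X = ereal (real d)" and L: "L \<in> X" "\<And>p. p \<in> X \<Longrightarrow> L \<subseteq> p"
  shows "chain_dim X = chain_dim {p \<in> X. I \<subseteq> p} \<longleftrightarrow> I \<subseteq> L"
proof
  assume "I \<subseteq> L"
  with L(2) have "{p \<in> X. I \<subseteq> p} = X" by blast
  then show "chain_dim X = chain_dim {p \<in> X. I \<subseteq> p}" by simp
next
  assume eq: "chain_dim X = chain_dim {p \<in> X. I \<subseteq> p}"
  then have "has_chain {p \<in> X. I \<subseteq> p} d" using assms(1) chain_dim_eq_iff by metis
  then obtain P where P: "\<forall>i\<le>d. P i \<in> X \<and> I \<subseteq> P i" "\<forall>i<d. P i \<subset> P (Suc i)"
    unfolding has_chain_def by blast
  show "I \<subseteq> L"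
  proof (rule ccontr)
    assume "\<not> I \<subseteq> L"
    then have "L \<subset> P 0" using P(1) L(2) by blast
    moreover define Q where "Q i = (case i of 0 \<Rightarrow> L | Suc j \<Rightarrow> P j)" for i
    ultimately have "\<forall>i\<le>Suc d. Q i \<in> X" "\<forall>i<Suc d. Q i \<subset> Q (Suc i)"
      using P L(1) by (auto split: nat.split)
    then have "has_chain X (Suc d)" unfolding has_chain_def by blast
    with assms(1) show False by (simp add: chain_dim_eq_iff)
  qed
qed

lemma (in cring) Kdim_quotient:
  assumes I: "ideal I R"
  shows "Kdim (R Quot I) = chain_dim {p. primeideal p R \<and> I \<subseteq> p}"
  unfolding Kdim_eq_chain_dim
proof (rule chain_dim_eqI[where f = "\<lambda>Q. {r \<in> carrier R. I +> r \<in> Q}" and g = "\<lambda>p. (+>) I ` p"])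
  interpret I: ideal I R by fact
  fix Q assume "Q \<in> {p. primeideal p (R Quot I)}"
  then interpret Q: primeideal Q "R Quot I" by simp
  have "I \<subseteq> {r \<in> carrier R. I +> r \<in> Q}"
  proof
    fix x assume x: "x \<in> I"
    then have "x \<in> carrier R" using I.a_subset by blast
    with x have "I +> x = \<zero>\<^bsub>R Quot I\<^esub>" by (simp add: coset_zero_iff[OF I] FactRing_def)
    with Q.zero_closed \<open>x \<in> carrier R\<close> show "x \<in> {r \<in> carrier R. I +> r \<in> Q}" by simp
  qed
  with ring_hom_ring.primeideal_vimage[OF I.rcos_ring_hom_ring is_cring Q.primeideal_axioms]
  show "{r \<in> carrier R. I +> r \<in> Q} \<in> {p. primeideal p R \<and> I \<subseteq> p}" by simp
next
  note carr = quotient_ops(1)[OF I]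
  fix P Q assume "P \<in> {p. primeideal p (R Quot I)}" "Q \<in> {p. primeideal p (R Quot I)}" "P \<subset> Q"
  moreover then have "Q \<subseteq> carrier (R Quot I)"
    using additive_subgroup.a_subset ideal.axioms(1) primeideal.axioms(1) by blast
  ultimately show "{r \<in> carrier R. I +> r \<in> P} \<subset> {r \<in> carrier R. I +> r \<in> Q}"
    unfolding carr by blast
next
  have coset_mem: "I +> x \<in> (+>) I ` p \<longleftrightarrow> x \<in> p"
    if "ideal p R" "I \<subseteq> p" "x \<in> carrier R" for p x
  proof
    note p = ideal_closed[OF that(1)]
    assume "I +> x \<in> (+>) I ` p"
    then obtain y where y: "y \<in> p" "I +> x = I +> y" by blast
    then have yc: "y \<in> carrier R" using p(1) by blast
    then have "x \<ominus> y \<in> p" using coset_eq_iff[OF I that(3)] y(2) that(2) by blast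
    from p(3)[OF this y(1)] show "x \<in> p"
      using that(3) yc by (simp add: a_minus_def a_assoc l_neg)
  qed simp
  note carr = quotient_ops(1)[OF I]
  interpret I: ideal I R by fact
  {
    fix p assume "p \<in> {p. primeideal p R \<and> I \<subseteq> p}"
    then have Ip: "I \<subseteq> p" and "primeideal p R" by auto
    then interpret p: primeideal p R by simp
    have "primeideal ((+>) I ` p) (R Quot I)"
    proof (rule primeidealI)
      show "ideal ((+>) I ` p) (R Quot I)"
        by (rule ring_ideal_imp_quot_ideal[OF I p.is_ideal])
      show "cring (R Quot I)" by (rule I.quotient_is_cring[OF is_cring])
      show "carrier (R Quot I) \<noteq> (+>) I ` p"
      proof
        assume "carrier (R Quot I) = (+>) I ` p"
        then have "I +> \<one> \<in> (+>) I ` p" unfolding carr by blast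
        then have "\<one> \<in> p" using coset_mem[OF p.is_ideal Ip one_closed] by blast
        then show False using p.one_imp_carrier p.I_notcarr by simp
      qed
      fix X Y assume "X \<in> carrier (R Quot I)" "Y \<in> carrier (R Quot I)"
        and XY: "X \<otimes>\<^bsub>R Quot I\<^esub> Y \<in> (+>) I ` p"
      then obtain x y where xy: "x \<in> carrier R" "y \<in> carrier R" "X = I +> x" "Y = I +> y"
        unfolding carr by blast
      then have "I +> (x \<otimes> y) \<in> (+>) I ` p"
        using XY I.rcoset_mult_add by (simp add: FactRing_def)
      then have "x \<in> p \<or> y \<in> p" using coset_mem[OF p.is_ideal Ip] p.I_prime xy by simp
      then show "X \<in> (+>) I ` p \<or> Y \<in> (+>) I ` p" using xy by blast
    qed
    then show "(+>) I ` p \<in> {p. primeideal p (R Quot I)}" by simp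
  }
  fix p q assume pq: "p \<in> {p. primeideal p R \<and> I \<subseteq> p}" "q \<in> {p. primeideal p R \<and> I \<subseteq> p}" "p \<subset> q"
  then have "ideal p R" "ideal q R" using primeideal.axioms(1) by auto
  obtain x where x: "x \<in> q" "x \<notin> p" using pq(3) by blast
  then have "x \<in> carrier R" using ideal_closed(1)[OF \<open>ideal q R\<close>] by blast
  then have "I +> x \<notin> (+>) I ` p" using coset_mem[OF \<open>ideal p R\<close>] pq(1) x(2) by simp
  moreover have "I +> x \<in> (+>) I ` q" "(+>) I ` p \<subseteq> (+>) I ` q" using x(1) pq(3) by auto
  ultimately show "(+>) I ` p \<subset> (+>) I ` q" by blast
qed

context superring
begin

lemma even_of_super_prime:
  assumes "super_prime P R"
  shows "primeideal (P \<inter> even_part R) (even_ring R)"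
proof (rule primeidealI)
  note P = super_primeD[OF assms]
  note I = ideal_closed[OF P(1)]
  interpret A: cring "even_ring R" by (rule even_ring_cring)
  show "ideal (P \<inter> even_part R) (even_ring R)"
    by (rule A.ideal_of_closed) (use I even_even even_carr in auto)
  show "cring (even_ring R)" by (rule even_ring_cring)
  show "carrier (even_ring R) \<noteq> P \<inter> even_part R" using P(2) by auto
  show "a \<in> P \<inter> even_part R \<or> b \<in> P \<inter> even_part R"
    if "a \<in> carrier (even_ring R)" "b \<in> carrier (even_ring R)"
      "a \<otimes>\<^bsub>even_ring R\<^esub> b \<in> P \<inter> even_part R" for a b
    using P(4) that even_carr by auto
qed

text \<open>Together with intersection with the even part, adding the odd part is an order isomorphism between
  the primes of the even ring and those of the superring.\<close>

lemma super_prime_of_even: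
  assumes "primeideal p (even_ring R)"
  shows "super_prime (p <+>\<^bsub>R\<^esub> odd_part R) R"
proof -
  interpret A: cring "even_ring R" by (rule even_ring_cring)
  interpret p: primeideal p "even_ring R" by fact
  note I = A.ideal_closed[OF p.is_ideal, simplified]
  have even: "a \<in> even_part R" if "a \<in> p" for a using that I(1) by blast
  have mem: "x \<in> p <+>\<^bsub>R\<^esub> odd_part R \<longleftrightarrow> (\<exists>a\<in>p. \<exists>b\<in>odd_part R. x = a \<oplus> b)" for x
    unfolding set_add_def' by blast
  \<comment> \<open>A product of two odd elements squares to zero, hence lies in every prime.\<close>
  have odd_odd_mem: "a \<otimes> b \<in> p" if "a \<in> odd_part R" "b \<in> odd_part R" for a b
  proof -
    have carr: "a \<in> carrier R" "b \<in> carrier R" using that by auto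
    have "(a \<otimes> b) \<otimes> (a \<otimes> b) = (a \<otimes> (b \<otimes> a)) \<otimes> b" using carr by (simp add: m_assoc)
    also have "\<dots> = \<ominus> ((a \<otimes> a) \<otimes> (b \<otimes> b))"
      using carr odd_anticommute[OF that(2,1)] by (simp add: m_assoc l_minus r_minus)
    finally have "(a \<otimes> b) \<otimes> (a \<otimes> b) = \<zero>" using odd_square that carr by simp
    then show ?thesis
      using p.I_prime[of "a \<otimes> b" "a \<otimes> b"] odd_odd[OF that] I(2) by simp
  qed
  have "ideal (p <+>\<^bsub>R\<^esub> odd_part R) R"
  proof (rule ideal_of_graded_closed)
    show "p <+>\<^bsub>R\<^esub> odd_part R \<subseteq> carrier R" using even even_carr odd_carr a_closed by (auto simp: mem)
    show "\<zero> \<in> p <+>\<^bsub>R\<^esub> odd_part R" unfolding mem by (intro bexI[of _ \<zero>]) (auto simp: I(2))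
    fix x y assume "x \<in> p <+>\<^bsub>R\<^esub> odd_part R" "y \<in> p <+>\<^bsub>R\<^esub> odd_part R"
    then obtain a b c d where x: "a \<in> p" "b \<in> odd_part R" "x = a \<oplus> b"
      and y: "c \<in> p" "d \<in> odd_part R" "y = c \<oplus> d" unfolding mem by blast
    then have "x \<oplus> y = (a \<oplus> c) \<oplus> (b \<oplus> d)"
      using even_carr[OF even] odd_carr by (simp add: a_ac)
    then show "x \<oplus> y \<in> p <+>\<^bsub>R\<^esub> odd_part R" unfolding mem using x y I(3) by blast
  next
    fix r x assume "x \<in> p <+>\<^bsub>R\<^esub> odd_part R"
    then obtain a b where x: "a \<in> p" "b \<in> odd_part R" "x = a \<oplus> b" unfolding mem by blast
    note carr = even_carr[OF even[OF x(1)]] odd_carr[OF x(2)]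
    {
      assume r: "r \<in> even_part R"
      then have "r \<otimes> x = r \<otimes> a \<oplus> r \<otimes> b" using x carr even_carr by (simp add: r_distr)
      then show "r \<otimes> x \<in> p <+>\<^bsub>R\<^esub> odd_part R"
        unfolding mem using I(5)[OF r x(1)] even_odd[OF r x(2)] by blast
    next
      assume r: "r \<in> odd_part R"
      then have "r \<otimes> x = r \<otimes> b \<oplus> r \<otimes> a" "x \<otimes> r = b \<otimes> r \<oplus> a \<otimes> r"
        using x carr odd_carr by (simp_all add: r_distr l_distr a_comm)
      then show "r \<otimes> x \<in> p <+>\<^bsub>R\<^esub> odd_part R" "x \<otimes> r \<in> p <+>\<^bsub>R\<^esub> odd_part R"
        unfolding mem
        using odd_odd_mem[OF r x(2)] odd_odd_mem[OF x(2) r] odd_even[OF r even[OF x(1)]]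
          even_odd[OF even[OF x(1)] r] by blast+
    }
  qed
  moreover have even_mem: "a \<in> p" if "a \<in> even_part R" "b \<in> odd_part R" "a \<oplus> b \<in> p <+>\<^bsub>R\<^esub> odd_part R" for a b
    using that graded_decomposition_unique(1) even unfolding mem by metis
  moreover have "\<one> \<notin> p <+>\<^bsub>R\<^esub> odd_part R"
  proof
    assume "\<one> \<in> p <+>\<^bsub>R\<^esub> odd_part R"
    then have "\<one> \<in> p" using even_mem[of \<one> \<zero>] by simp
    then have "p = carrier (even_ring R)" using p.one_imp_carrier by simp
    then show False using p.I_notcarr by simp
  qed
  moreover have "x \<in> p <+>\<^bsub>R\<^esub> odd_part R \<or> y \<in> p <+>\<^bsub>R\<^esub> odd_part R"
    if xy: "x \<in> carrier R" "y \<in> carrier R" "x \<otimes> y \<in> p <+>\<^bsub>R\<^esub> odd_part R" for x y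
  proof -
    obtain a b where x: "a \<in> even_part R" "b \<in> odd_part R" "x = a \<oplus> b"
      using graded_decomposition[OF xy(1)] by blast
    obtain c d where y: "c \<in> even_part R" "d \<in> odd_part R" "y = c \<oplus> d"
      using graded_decomposition[OF xy(2)] by blast
    have carr: "a \<in> carrier R" "b \<in> carrier R" "c \<in> carrier R" "d \<in> carrier R" using x y by auto
    have "x \<otimes> y = (a \<otimes> c \<oplus> b \<otimes> d) \<oplus> (a \<otimes> d \<oplus> b \<otimes> c)"
      unfolding x(3) y(3) using carr by algebra
    then have "a \<otimes> c \<oplus> b \<otimes> d \<in> p"
      using even_mem[of "a \<otimes> c \<oplus> b \<otimes> d" "a \<otimes> d \<oplus> b \<otimes> c"] xy(3) x y
      by (simp add: even_even odd_odd even_odd odd_even)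
    from A.ideal_closed(4)[OF p.is_ideal this odd_odd_mem[OF x(2) y(2)]]
    have "(a \<otimes> c \<oplus> b \<otimes> d) \<ominus> b \<otimes> d \<in> p"
      using minus_even_ring odd_odd[OF x(2) y(2)] by (simp add: a_minus_def)
    then have "a \<otimes> c \<in> p" using carr by (simp add: a_minus_def a_assoc r_neg)
    then have "a \<in> p \<or> c \<in> p" using p.I_prime[of a c] x y by simp
    then show ?thesis unfolding mem using x y by blast
  qed
  ultimately show ?thesis unfolding super_prime_iff by blast
qed

lemma even_super_prime_strict:
  assumes "super_prime P R" "super_prime Q R" "P \<subset> Q"
  shows "P \<inter> even_part R \<subset> Q \<inter> even_part R"
proof -
  note P = super_primeD[OF assms(1)] and Q = super_primeD[OF assms(2)]
  obtain x where x: "x \<in> Q" "x \<notin> P" using assms(3) by blast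
  then obtain a b where ab: "a \<in> even_part R" "b \<in> odd_part R" "x = a \<oplus> b"
    using graded_decomposition ideal_closed(1)[OF Q(1)] by blast
  have "x \<ominus> b = a" using ab even_carr odd_carr by algebra
  then have "a \<in> Q" using ideal_closed(4)[OF Q(1) x(1)] ab Q(3) by blast
  moreover have "a \<notin> P" using ideal_closed(3)[OF P(1)] ab x(2) P(3) by blast
  ultimately show ?thesis using ab assms(3) by blast
qed

lemma super_prime_of_even_mono:
  assumes "p \<subset> q" "primeideal p (even_ring R)" "primeideal q (even_ring R)"
  shows "p <+>\<^bsub>R\<^esub> odd_part R \<subset> q <+>\<^bsub>R\<^esub> odd_part R"
proof -
  interpret A: cring "even_ring R" by (rule even_ring_cring)
  have sub: "p \<subseteq> even_part R" "q \<subseteq> even_part R"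
    using A.ideal_closed(1)[OF primeideal.axioms(1)] assms(2,3) by auto
  have "p <+>\<^bsub>R\<^esub> odd_part R \<subseteq> q <+>\<^bsub>R\<^esub> odd_part R" using assms unfolding set_add_def' by blast
  moreover obtain x where x: "x \<in> q" "x \<notin> p" using assms by blast
  then have "x \<in> carrier R" using sub even_carr by blast
  then have "x = x \<oplus> \<zero>" by simp
  then have "x \<in> q <+>\<^bsub>R\<^esub> odd_part R" using x(1) odd_closed(1) unfolding set_add_def' by blast
  moreover have "x \<notin> p <+>\<^bsub>R\<^esub> odd_part R"
  proof
    assume "x \<in> p <+>\<^bsub>R\<^esub> odd_part R"
    then obtain a b where "a \<in> p" "b \<in> odd_part R" "x = a \<oplus> b" unfolding set_add_def' by blast
    moreover with \<open>x = x \<oplus> \<zero>\<close> have "x \<oplus> \<zero> = a \<oplus> b" by simp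
    ultimately have "x = a"
      using graded_decomposition_unique(1)[of x a \<zero> b] sub x by auto
    with x \<open>a \<in> p\<close> show False by simp
  qed
  ultimately show ?thesis by blast
qed

lemma Kdim_even_quotient:
  assumes I: "ideal I (even_ring R)"
  shows "Kdim (even_ring R Quot I) = chain_dim {P. super_prime P R \<and> I \<subseteq> P}"
proof -
  interpret A: cring "even_ring R" by (rule even_ring_cring)
  have Isub: "I \<subseteq> even_part R" using A.ideal_closed(1)[OF I] by simp
  show ?thesis unfolding A.Kdim_quotient[OF I]
  proof (rule chain_dim_eqI[where f = "\<lambda>p. p <+>\<^bsub>R\<^esub> odd_part R" and g = "\<lambda>P. P \<inter> even_part R"])
    fix p assume p: "p \<in> {p. primeideal p (even_ring R) \<and> I \<subseteq> p}"
    have "x \<in> p <+>\<^bsub>R\<^esub> odd_part R" if "x \<in> I" for x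
    proof -
      have "x \<in> carrier R" "x \<in> p" using that Isub p even_carr by auto
      then have "x = x \<oplus> \<zero>" "x \<in> p" by simp_all
      then show ?thesis unfolding set_add_def' using odd_closed(1) by blast
    qed
    then show "p <+>\<^bsub>R\<^esub> odd_part R \<in> {P. super_prime P R \<and> I \<subseteq> P}"
      using super_prime_of_even p by blast
  next
    fix P assume "P \<in> {P. super_prime P R \<and> I \<subseteq> P}"
    then show "P \<inter> even_part R \<in> {p. primeideal p (even_ring R) \<and> I \<subseteq> p}"
      using even_of_super_prime Isub by blast
  qed (simp_all add: super_prime_of_even_mono even_super_prime_strict)
qed

lemma Kdim_even_ring: "Kdim (even_ring R) = chain_dim {P. super_prime P R}"
  unfolding Kdim_eq_chain_dim
  by (rule chain_dim_eqI[where f = "\<lambda>p. p <+>\<^bsub>R\<^esub> odd_part R" and g = "\<lambda>P. P \<inter> even_part R"])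
    (simp_all add: super_prime_of_even even_of_super_prime super_prime_of_even_mono
      even_super_prime_strict)

lemma foldr_mult_closed: "set as \<subseteq> carrier R \<Longrightarrow> foldr (\<otimes>) as \<one> \<in> carrier R"
  by (induction as) auto

lemma even_annihilator_ideal:
  assumes "x \<in> carrier R"
  shows "ideal (even_annihilator R x) (even_ring R)"
proof -
  interpret A: cring "even_ring R" by (rule even_ring_cring)
  have l: "r \<otimes> s \<otimes> x = \<zero>" if "r \<in> even_part R" "s \<in> even_part R" "s \<otimes> x = \<zero>" for r s
    using that assms even_carr by (simp add: m_assoc)
  have r: "s \<otimes> r \<otimes> x = \<zero>" if "r \<in> even_part R" "s \<in> even_part R" "s \<otimes> x = \<zero>" for r s
    using l[OF that] even_central[OF that(1) even_carr[OF that(2)]] by simp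
  show ?thesis
    by (rule A.ideal_of_closed)
      (auto simp: even_annihilator_def l_distr l r assms even_carr even_even)
qed

text \<open>With a least prime \<open>L\<close>, passing to the quotient by the annihilator keeps the dimension exactly
  when the annihilator lies in \<open>L\<close>. Dimensions disappear from the definition of odd parameters, and
  what remains can be compared with localizations.\<close>

lemma odd_parameters_iff:
  assumes dim: "Kdim (even_ring R) = ereal (real d)"
    and L: "super_prime L R" "\<And>P. super_prime P R \<Longrightarrow> L \<subseteq> P"
  shows "odd_parameters R as \<longleftrightarrow> set as \<subseteq> odd_part R \<and>
    (\<forall>r\<in>even_part R. r \<otimes> foldr (\<otimes>) as \<one> = \<zero> \<longrightarrow> r \<in> L)"
proof (cases "set as \<subseteq> odd_part R")
  case True
  then have carr: "foldr (\<otimes>) as \<one> \<in> carrier R" using foldr_mult_closed odd_carr by blast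
  show ?thesis
    using chain_dim_above_iff[OF dim[unfolded Kdim_even_ring], of L
      "even_annihilator R (foldr (\<otimes>) as \<one>)"] L
    unfolding odd_parameters_def Kdim_even_ring Kdim_even_quotient[OF even_annihilator_ideal[OF carr]]
    by (auto simp: True even_annihilator_def)
qed (simp add: odd_parameters_def)

end

lemma superdomain_least_prime:
  assumes "superdomain R"
  shows "super_prime (odd_ideal R) R" and "super_prime P R \<Longrightarrow> odd_ideal R \<subseteq> P"
proof -
  interpret superring R using assms by (simp add: superdomain_def)
  have sub: "odd_part R \<subseteq> carrier R" by blast
  show "super_prime (odd_ideal R) R"
    using assms genideal_ideal[OF sub] by (simp add: super_prime_def superdomain_def odd_ideal_def)
  show "super_prime P R \<Longrightarrow> odd_ideal R \<subseteq> P"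
    unfolding odd_ideal_def using genideal_minimal super_primeD(1,3) by blast
qed

section \<open>Localization of superrings\<close>

locale even_multiplicative_set = superring R for R :: "('a, 'b) superring_scheme" (structure) +
  fixes S :: "'a set"
  assumes S_even: "S \<subseteq> even_part R"
    and one_S: "\<one> \<in> S"
    and mult_S: "\<lbrakk>s \<in> S; t \<in> S\<rbrakk> \<Longrightarrow> s \<otimes> t \<in> S"
    and zero_notin_S: "\<zero> \<notin> S"
begin

abbreviation frac where "frac \<equiv> fraction R S"
abbreviation L where "L \<equiv> localization R S"

text \<open>A copy of the multiplication for central left factors: rewriting every product with a
  denominator into this form, the denominators gather in front and commute there, while the order
  of the remaining factors is kept.\<close>

definition act :: "'a \<Rightarrow> 'a \<Rightarrow> 'a"
  where "act a x = a \<otimes> x"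

lemma S_carr [simp]: "s \<in> S \<Longrightarrow> s \<in> carrier R"
  using S_even by blast

lemma S_evenD: "s \<in> S \<Longrightarrow> s \<in> even_part R"
  using S_even by blast

lemma act_closed [simp]: "\<lbrakk>s \<in> S; x \<in> carrier R\<rbrakk> \<Longrightarrow> act s x \<in> carrier R"
  by (simp add: act_def)

lemma act_S [simp]: "\<lbrakk>s \<in> S; t \<in> S\<rbrakk> \<Longrightarrow> act s t \<in> S"
  by (simp add: act_def mult_S)

lemma act_even [simp]: "\<lbrakk>s \<in> S; x \<in> even_part R\<rbrakk> \<Longrightarrow> act s x \<in> even_part R"
  by (simp add: act_def even_even S_evenD)

lemma act_odd [simp]: "\<lbrakk>s \<in> S; x \<in> odd_part R\<rbrakk> \<Longrightarrow> act s x \<in> odd_part R"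
  by (simp add: act_def even_odd S_evenD)

lemma mult_to_act:
  "\<lbrakk>s \<in> S; x \<in> carrier R\<rbrakk> \<Longrightarrow> s \<otimes> x = act s x"
  "\<lbrakk>s \<in> S; x \<in> carrier R\<rbrakk> \<Longrightarrow> x \<otimes> s = act s x"
  using even_central[OF S_evenD, of s x] by (simp_all add: act_def)

lemma act_act: "\<lbrakk>s \<in> S; t \<in> S; x \<in> carrier R\<rbrakk> \<Longrightarrow> act (act s t) x = act s (act t x)"
  by (simp add: act_def m_assoc)

lemma act_commute: "\<lbrakk>s \<in> S; t \<in> S\<rbrakk> \<Longrightarrow> act s t = act t s"
  using mult_to_act by (metis S_carr act_def)

lemma act_left_commute:
  "\<lbrakk>s \<in> S; t \<in> S; x \<in> carrier R\<rbrakk> \<Longrightarrow> act s (act t x) = act t (act s x)"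
  using act_act act_commute by metis

lemma act_mult:
  assumes "s \<in> S" "x \<in> carrier R" "y \<in> carrier R"
  shows "act s x \<otimes> y = act s (x \<otimes> y)" and "x \<otimes> act s y = act s (x \<otimes> y)"
proof -
  show "act s x \<otimes> y = act s (x \<otimes> y)" using assms by (simp add: act_def m_assoc)
  have "x \<otimes> (s \<otimes> y) = (x \<otimes> s) \<otimes> y" using assms by (simp add: m_assoc)
  also have "\<dots> = s \<otimes> (x \<otimes> y)"
    using assms mult_to_act[of s x] by (simp add: act_def m_assoc)
  finally show "x \<otimes> act s y = act s (x \<otimes> y)" by (simp add: act_def)
qed

lemma act_distr:
  "\<lbrakk>s \<in> S; x \<in> carrier R; y \<in> carrier R\<rbrakk> \<Longrightarrow> act s (x \<oplus> y) = act s x \<oplus> act s y"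
  "\<lbrakk>s \<in> S; x \<in> carrier R; y \<in> carrier R\<rbrakk> \<Longrightarrow> act s (x \<ominus> y) = act s x \<ominus> act s y"
  "\<lbrakk>s \<in> S; x \<in> carrier R\<rbrakk> \<Longrightarrow> act s (\<ominus> x) = \<ominus> act s x"
  "s \<in> S \<Longrightarrow> act s \<zero> = \<zero>"
  by (simp_all add: act_def r_distr r_minus a_minus_def)

lemma act_one [simp]: "x \<in> carrier R \<Longrightarrow> act \<one> x = x" "s \<in> S \<Longrightarrow> act s \<one> = s"
  by (simp_all add: act_def)

lemmas act_simps = mult_to_act act_act act_commute act_left_commute act_mult act_distr

lemma fraction_rel_iff:
  "((r, s), (r', s')) \<in> fraction_rel R S \<longleftrightarrow>
    r \<in> carrier R \<and> s \<in> S \<and> r' \<in> carrier R \<and> s' \<in> S \<and>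
    (\<exists>u\<in>S. act u (act s' r) = act u (act s r'))"
proof -
  have "u \<otimes> (r \<otimes> s' \<ominus> r' \<otimes> s) = act u (act s' r) \<ominus> act u (act s r')"
    if "u \<in> S" "r \<in> carrier R" "s \<in> S" "r' \<in> carrier R" "s' \<in> S" for u
    using that by (simp add: act_simps)
  then show ?thesis
    by (auto simp: fraction_rel_def)
qed

lemma fraction_rel_equiv: "equiv (carrier R \<times> S) (fraction_rel R S)"
proof (rule equivI)
  show "fraction_rel R S \<subseteq> (carrier R \<times> S) \<times> (carrier R \<times> S)"
    by (auto simp: fraction_rel_def)
  show "refl_on (carrier R \<times> S) (fraction_rel R S)"
    using one_S by (auto simp: refl_on_def fraction_rel_iff)
  show "sym (fraction_rel R S)"
    by (rule symI) (auto simp: fraction_rel_iff intro: sym; metis)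
  show "trans (fraction_rel R S)"
  proof (rule transI)
    fix x y z assume "(x, y) \<in> fraction_rel R S" "(y, z) \<in> fraction_rel R S"
    moreover obtain r s r' s' r'' s'' where xyz: "x = (r, s)" "y = (r', s')" "z = (r'', s'')"
      by (metis surj_pair)
    ultimately obtain u v where carr: "r \<in> carrier R" "s \<in> S" "r' \<in> carrier R" "s' \<in> S"
        "r'' \<in> carrier R" "s'' \<in> S"
      and u: "u \<in> S" "act u (act s' r) = act u (act s r')"
      and v: "v \<in> S" "act v (act s'' r') = act v (act s' r'')"
      by (auto simp: fraction_rel_iff)
    have "act (act u (act v s')) (act s'' r) = act v (act s'' (act u (act s' r)))"
      using carr u(1) v(1) by (simp add: act_simps)
    also have "\<dots> = act s (act u (act v (act s'' r')))"
      unfolding u(2) using carr u(1) v(1) by (simp add: act_simps)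
    also have "\<dots> = act (act u (act v s')) (act s r'')"
      unfolding v(2) using carr u(1) v(1) by (simp add: act_simps)
    finally show "(x, z) \<in> fraction_rel R S"
      unfolding xyz fraction_rel_iff using carr u(1) v(1) by (blast intro: act_S)
  qed
qed

lemma frac_eq_iff:
  assumes "r \<in> carrier R" "s \<in> S" "r' \<in> carrier R" "s' \<in> S"
  shows "frac r s = frac r' s' \<longleftrightarrow> (\<exists>u\<in>S. act u (act s' r) = act u (act s r'))"
  unfolding fraction_def using assms
  by (subst eq_equiv_class_iff[OF fraction_rel_equiv]) (auto simp: fraction_rel_iff)

lemma mem_frac_iff:
  assumes "r \<in> carrier R" "s \<in> S"
  shows "(a, b) \<in> frac r s \<longleftrightarrow> a \<in> carrier R \<and> b \<in> S \<and> frac a b = frac r s"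
proof (cases "a \<in> carrier R \<and> b \<in> S")
  case True
  then show ?thesis
    using assms frac_eq_iff[of r s a b] by (auto simp: fraction_def[of R S r s] fraction_rel_iff)
qed (auto simp: fraction_def fraction_rel_def)

lemma frac_eqI:
  "\<lbrakk>r \<in> carrier R; s \<in> S; r' \<in> carrier R; s' \<in> S; act s' r = act s r'\<rbrakk> \<Longrightarrow> frac r s = frac r' s'"
  using one_S by (auto simp: frac_eq_iff)

lemma frac_cancel:
  "\<lbrakk>r \<in> carrier R; s \<in> S; t \<in> S\<rbrakk> \<Longrightarrow> frac (act t r) (act t s) = frac r s"
  by (rule frac_eqI) (simp_all add: act_simps)

lemma frac_closed [simp]: "\<lbrakk>r \<in> carrier R; s \<in> S\<rbrakk> \<Longrightarrow> frac r s \<in> carrier L"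
  by (auto simp: localization_def)

lemma frac_mult:
  assumes "r \<in> carrier R" "s \<in> S" "r' \<in> carrier R" "s' \<in> S"
  shows "frac r s \<otimes>\<^bsub>L\<^esub> frac r' s' = frac (r \<otimes> r') (act s s')"
proof -
  have eq: "frac (a \<otimes> c) (b \<otimes> d) = frac (r \<otimes> r') (act s s')"
    if ab: "(a, b) \<in> frac r s" and cd: "(c, d) \<in> frac r' s'" for a b c d
  proof -
    have carr: "a \<in> carrier R" "b \<in> S" "c \<in> carrier R" "d \<in> S"
      using ab cd assms mem_frac_iff by blast+
    obtain u where u: "u \<in> S" "act u (act s a) = act u (act b r)"
      using ab assms mem_frac_iff frac_eq_iff carr by metis
    obtain v where v: "v \<in> S" "act v (act s' c) = act v (act d r')"
      using cd assms mem_frac_iff frac_eq_iff carr by metis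
    have "act (act u v) (act (act s s') (a \<otimes> c)) = act u (act s a) \<otimes> act v (act s' c)"
      using carr assms u(1) v(1) by (simp add: act_simps)
    also have "\<dots> = act (act u v) (act (b \<otimes> d) (r \<otimes> r'))"
      unfolding u(2) v(2) using carr assms u(1) v(1) by (simp add: act_simps)
    finally show ?thesis
      using carr assms u(1) v(1) by (subst frac_eq_iff) (auto intro: mult_S)
  qed
  have mem: "(r, s) \<in> frac r s" "(r', s') \<in> frac r' s'" using assms mem_frac_iff by auto
  have "frac r s \<otimes>\<^bsub>L\<^esub> frac r' s' =
    (\<Union>(a, b)\<in>frac r s. \<Union>(c, d)\<in>frac r' s'. frac (a \<otimes> c) (b \<otimes> d))"
    by (simp add: localization_def)
  also have "\<dots> = (\<Union>p\<in>frac r s. \<Union>q\<in>frac r' s'. frac (r \<otimes> r') (act s s'))"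
    using eq by (intro SUP_cong refl) (auto intro!: SUP_cong)
  also have "\<dots> = frac (r \<otimes> r') (act s s')" using mem by blast
  finally show ?thesis .
qed

lemma frac_add:
  assumes "r \<in> carrier R" "s \<in> S" "r' \<in> carrier R" "s' \<in> S"
  shows "frac r s \<oplus>\<^bsub>L\<^esub> frac r' s' = frac (act s' r \<oplus> act s r') (act s s')"
proof -
  have eq: "frac (a \<otimes> d \<oplus> c \<otimes> b) (b \<otimes> d) = frac (act s' r \<oplus> act s r') (act s s')"
    if ab: "(a, b) \<in> frac r s" and cd: "(c, d) \<in> frac r' s'" for a b c d
  proof -
    have carr: "a \<in> carrier R" "b \<in> S" "c \<in> carrier R" "d \<in> S"
      using ab cd assms mem_frac_iff by blast+
    obtain u where u: "u \<in> S" "act u (act s a) = act u (act b r)"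
      using ab assms mem_frac_iff frac_eq_iff carr by metis
    obtain v where v: "v \<in> S" "act v (act s' c) = act v (act d r')"
      using cd assms mem_frac_iff frac_eq_iff carr by metis
    have "act (act u v) (act (act s s') (a \<otimes> d \<oplus> c \<otimes> b)) =
        act v (act s' (act d (act u (act s a)))) \<oplus> act u (act s (act b (act v (act s' c))))"
      using carr assms u(1) v(1) by (simp add: act_simps)
    also have "\<dots> = act (act u v) (act (b \<otimes> d) (act s' r \<oplus> act s r'))"
      unfolding u(2) v(2) using carr assms u(1) v(1) by (simp add: act_simps)
    finally show ?thesis
      using carr assms u(1) v(1) by (subst frac_eq_iff) (auto intro: mult_S)
  qed
  have mem: "(r, s) \<in> frac r s" "(r', s') \<in> frac r' s'" using assms mem_frac_iff by auto
  have "frac r s \<oplus>\<^bsub>L\<^esub> frac r' s' =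
    (\<Union>(a, b)\<in>frac r s. \<Union>(c, d)\<in>frac r' s'. frac (a \<otimes> d \<oplus> c \<otimes> b) (b \<otimes> d))"
    by (simp add: localization_def)
  also have "\<dots> = (\<Union>p\<in>frac r s. \<Union>q\<in>frac r' s'. frac (act s' r \<oplus> act s r') (act s s'))"
    using eq by (intro SUP_cong refl) (auto intro!: SUP_cong)
  also have "\<dots> = frac (act s' r \<oplus> act s r') (act s s')" using mem by blast
  finally show ?thesis .
qed

lemma L_one: "\<one>\<^bsub>L\<^esub> = frac \<one> \<one>" and L_zero: "\<zero>\<^bsub>L\<^esub> = frac \<zero> \<one>"
  and L_carrier: "x \<in> carrier L \<longleftrightarrow> (\<exists>r\<in>carrier R. \<exists>s\<in>S. x = frac r s)"
  and L_even: "x \<in> even_part L \<longleftrightarrow> (\<exists>r\<in>even_part R. \<exists>s\<in>S. x = frac r s)"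
  and L_odd: "x \<in> odd_part L \<longleftrightarrow> (\<exists>r\<in>odd_part R. \<exists>s\<in>S. x = frac r s)"
  by (auto simp: localization_def)

lemma frac_add_same:
  assumes "a \<in> carrier R" "b \<in> carrier R" "s \<in> S"
  shows "frac a s \<oplus>\<^bsub>L\<^esub> frac b s = frac (a \<oplus> b) s"
proof -
  have "frac a s \<oplus>\<^bsub>L\<^esub> frac b s = frac (act s (a \<oplus> b)) (act s s)"
    using assms by (simp add: frac_add act_distr)
  then show ?thesis using assms by (simp add: frac_cancel)
qed

lemma frac_zero: "s \<in> S \<Longrightarrow> frac \<zero> s = \<zero>\<^bsub>L\<^esub>"
  unfolding L_zero by (rule frac_eqI) (simp_all add: one_S act_distr)

lemma frac_self: "s \<in> S \<Longrightarrow> frac s s = \<one>\<^bsub>L\<^esub>"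
  unfolding L_one by (rule frac_eqI) (simp_all add: one_S act_distr)

lemma common_denominator:
  assumes "r \<in> carrier R" "s \<in> S" "t \<in> S"
  shows "frac r s = frac (act t r) (act s t)"
  using frac_cancel[OF assms] assms by (simp add: act_commute)

lemma common_denominator2:
  assumes "x \<in> carrier L" "y \<in> carrier L"
  obtains a b s where "a \<in> carrier R" "b \<in> carrier R" "s \<in> S" "x = frac a s" "y = frac b s"
proof -
  obtain a s b t where "a \<in> carrier R" "s \<in> S" "x = frac a s" "b \<in> carrier R" "t \<in> S" "y = frac b t"
    using assms L_carrier by auto
  then have "x = frac (act t a) (act s t)" "y = frac (act s b) (act s t)"
    using common_denominator[of a s t] common_denominator[of b t s] by (simp_all add: act_commute)
  then show thesis using that[of "act t a" "act s b" "act s t"]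
      \<open>a \<in> carrier R\<close> \<open>b \<in> carrier R\<close> \<open>s \<in> S\<close> \<open>t \<in> S\<close> by simp
qed

lemma common_denominator3:
  assumes "x \<in> carrier L" "y \<in> carrier L" "z \<in> carrier L"
  obtains a b c s where "a \<in> carrier R" "b \<in> carrier R" "c \<in> carrier R" "s \<in> S"
    "x = frac a s" "y = frac b s" "z = frac c s"
proof -
  obtain a b s where ab: "a \<in> carrier R" "b \<in> carrier R" "s \<in> S" "x = frac a s" "y = frac b s"
    using common_denominator2 assms by blast
  obtain c t where c: "c \<in> carrier R" "t \<in> S" "z = frac c t"
    using assms L_carrier by auto
  then have "x = frac (act t a) (act s t)" "y = frac (act t b) (act s t)" "z = frac (act s c) (act s t)"
    using common_denominator[of a s t] common_denominator[of b s t] common_denominator[of c t s] ab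
    by (simp_all add: act_commute)
  then show thesis using that[of "act t a" "act t b" "act s c" "act s t"] ab c by simp
qed

text \<open>The ring laws are inherited from \<open>R\<close> once all fractions are brought to a common
  denominator.\<close>

lemma localization_ring: "ring L"
proof (rule ringI)
  show "abelian_group L"
  proof (rule abelian_groupI)
    fix x y assume xy: "x \<in> carrier L" "y \<in> carrier L"
    obtain a b s where c: "a \<in> carrier R" "b \<in> carrier R" "s \<in> S" "x = frac a s" "y = frac b s"
      using common_denominator2[OF xy] .
    then show "x \<oplus>\<^bsub>L\<^esub> y \<in> carrier L" by (simp add: frac_add_same)
    show "x \<oplus>\<^bsub>L\<^esub> y = y \<oplus>\<^bsub>L\<^esub> x" using c by (simp add: frac_add_same a_comm)
  next
    fix x y z assume xyz: "x \<in> carrier L" "y \<in> carrier L" "z \<in> carrier L"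
    obtain a b c s where c: "a \<in> carrier R" "b \<in> carrier R" "c \<in> carrier R" "s \<in> S"
      "x = frac a s" "y = frac b s" "z = frac c s"
      using common_denominator3[OF xyz] .
    then show "x \<oplus>\<^bsub>L\<^esub> y \<oplus>\<^bsub>L\<^esub> z = x \<oplus>\<^bsub>L\<^esub> (y \<oplus>\<^bsub>L\<^esub> z)"
      by (simp add: frac_add_same a_assoc)
  next
    show "\<zero>\<^bsub>L\<^esub> \<in> carrier L" by (simp add: L_zero one_S)
    fix x assume "x \<in> carrier L"
    then obtain a s where a: "a \<in> carrier R" "s \<in> S" "x = frac a s" using L_carrier by blast
    show "\<zero>\<^bsub>L\<^esub> \<oplus>\<^bsub>L\<^esub> x = x"
      using a frac_zero[OF a(2), symmetric] by (simp add: frac_add_same)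
    have "frac (\<ominus> a) s \<oplus>\<^bsub>L\<^esub> x = \<zero>\<^bsub>L\<^esub>" using a by (simp add: frac_add_same l_neg frac_zero)
    then show "\<exists>y\<in>carrier L. y \<oplus>\<^bsub>L\<^esub> x = \<zero>\<^bsub>L\<^esub>" using a by (metis a_inv_closed frac_closed)
  qed
  show "Group.monoid L"
  proof (rule monoidI)
    show "\<one>\<^bsub>L\<^esub> \<in> carrier L" by (simp add: L_one one_S)
    fix x assume "x \<in> carrier L"
    then obtain a s where a: "a \<in> carrier R" "s \<in> S" "x = frac a s" using L_carrier by blast
    show "\<one>\<^bsub>L\<^esub> \<otimes>\<^bsub>L\<^esub> x = x" "x \<otimes>\<^bsub>L\<^esub> \<one>\<^bsub>L\<^esub> = x"
      using a by (simp_all add: L_one one_S frac_mult)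
  next
    fix x y assume xy: "x \<in> carrier L" "y \<in> carrier L"
    then show "x \<otimes>\<^bsub>L\<^esub> y \<in> carrier L" by (auto simp: L_carrier[of x] L_carrier[of y] frac_mult)
  next
    fix x y z assume xyz: "x \<in> carrier L" "y \<in> carrier L" "z \<in> carrier L"
    obtain a b c s where c: "a \<in> carrier R" "b \<in> carrier R" "c \<in> carrier R" "s \<in> S"
      "x = frac a s" "y = frac b s" "z = frac c s"
      using common_denominator3[OF xyz] .
    then show "x \<otimes>\<^bsub>L\<^esub> y \<otimes>\<^bsub>L\<^esub> z = x \<otimes>\<^bsub>L\<^esub> (y \<otimes>\<^bsub>L\<^esub> z)"
      by (simp add: frac_mult act_act m_assoc)
  qed
next
  fix x y z assume xyz: "x \<in> carrier L" "y \<in> carrier L" "z \<in> carrier L"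
  obtain a b c s where c: "a \<in> carrier R" "b \<in> carrier R" "c \<in> carrier R" "s \<in> S"
    "x = frac a s" "y = frac b s" "z = frac c s"
    using common_denominator3[OF xyz] .
  then show "(x \<oplus>\<^bsub>L\<^esub> y) \<otimes>\<^bsub>L\<^esub> z = x \<otimes>\<^bsub>L\<^esub> z \<oplus>\<^bsub>L\<^esub> y \<otimes>\<^bsub>L\<^esub> z"
    "z \<otimes>\<^bsub>L\<^esub> (x \<oplus>\<^bsub>L\<^esub> y) = z \<otimes>\<^bsub>L\<^esub> x \<oplus>\<^bsub>L\<^esub> z \<otimes>\<^bsub>L\<^esub> y"
    by (simp_all add: frac_mult frac_add_same l_distr r_distr)
qed

lemma frac_minus:
  assumes "a \<in> carrier R" "s \<in> S"
  shows "\<ominus>\<^bsub>L\<^esub> frac a s = frac (\<ominus> a) s"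
proof -
  interpret L: ring L by (rule localization_ring)
  have "frac (\<ominus> a) s \<oplus>\<^bsub>L\<^esub> frac a s = \<zero>\<^bsub>L\<^esub>"
    using assms by (simp add: frac_add_same l_neg frac_zero)
  then show ?thesis using assms L.minus_equality by simp
qed

lemma frac_eq_zero_iff:
  assumes "r \<in> carrier R" "s \<in> S"
  shows "frac r s = \<zero>\<^bsub>L\<^esub> \<longleftrightarrow> (\<exists>u\<in>S. u \<otimes> r = \<zero>)"
  unfolding L_zero using assms one_S
  by (subst frac_eq_iff) (auto simp: act_distr, auto simp: act_def)

lemma fractions_subgroup:
  assumes X: "additive_subgroup X R" and act: "\<And>s x. \<lbrakk>s \<in> S; x \<in> X\<rbrakk> \<Longrightarrow> act s x \<in> X"
    and Y: "\<And>x. x \<in> Y \<longleftrightarrow> (\<exists>r\<in>X. \<exists>s\<in>S. x = frac r s)"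
  shows "additive_subgroup Y L"
proof (rule additive_subgroupI)
  interpret L: ring L by (rule localization_ring)
  interpret X: additive_subgroup X R by (rule X)
  show "subgroup Y (add_monoid L)"
  proof (rule L.add.subgroupI)
    show "Y \<subseteq> carrier L" using X.a_Hcarr Y L_carrier by blast
    show "Y \<noteq> {}" using Y one_S X.zero_closed by blast
    show "\<ominus>\<^bsub>L\<^esub> x \<in> Y" if "x \<in> Y" for x
      using that frac_minus X.a_Hcarr X.a_inv_closed unfolding Y by metis
    show "x \<oplus>\<^bsub>L\<^esub> y \<in> Y" if xy: "x \<in> Y" "y \<in> Y" for x y
    proof -
      obtain a s b t where "a \<in> X" "s \<in> S" "x = frac a s" "b \<in> X" "t \<in> S" "y = frac b t"
        using xy Y by auto
      then have "x \<oplus>\<^bsub>L\<^esub> y = frac (act t a \<oplus> act s b) (act s t)"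
          "act t a \<oplus> act s b \<in> X" "act s t \<in> S"
        using act X.a_Hcarr by (simp_all add: frac_add)
      then show ?thesis unfolding Y by blast
    qed
  qed
qed

text \<open>Denominators are even, so bringing fractions to a common denominator keeps the parity of the
  numerators. A fraction that is both even and odd vanishes because clearing denominators gives an
  element of \<open>R\<close> that is both.\<close>

lemma localization_superring: "superring L"
proof -
  interpret L: ring L by (rule localization_ring)
  have even_sub: "x \<in> carrier L" if "x \<in> even_part L" for x
    using that even_carr unfolding L_even L_carrier by blast
  have odd_sub: "x \<in> carrier L" if "x \<in> odd_part L" for x
    using that odd_carr unfolding L_odd L_carrier by blast
  have mult_S': "act s t \<in> S" if "s \<in> S" "t \<in> S" for s t using that by simp
  show ?thesis
  proof (rule superring.intro[OF localization_ring], rule superring_axioms.intro)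
    show "\<one>\<^bsub>L\<^esub> \<noteq> \<zero>\<^bsub>L\<^esub>"
      unfolding L_one using one_S zero_notin_S by (auto simp: frac_eq_zero_iff)
    show "additive_subgroup (even_part L) L"
      by (rule fractions_subgroup[OF even_additive_subgroup act_even L_even])
    show "additive_subgroup (odd_part L) L"
      by (rule fractions_subgroup[OF odd_additive_subgroup act_odd L_odd])
    show "even_part L <+>\<^bsub>L\<^esub> odd_part L = carrier L"
    proof
      show "even_part L <+>\<^bsub>L\<^esub> odd_part L \<subseteq> carrier L"
        using even_sub odd_sub unfolding set_add_def' by auto
      show "carrier L \<subseteq> even_part L <+>\<^bsub>L\<^esub> odd_part L"
      proof
        fix x assume "x \<in> carrier L"
        then obtain r s where r: "r \<in> carrier R" "s \<in> S" "x = frac r s" using L_carrier by blast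
        obtain a b where ab: "a \<in> even_part R" "b \<in> odd_part R" "r = a \<oplus> b"
          using graded_decomposition[OF r(1)] .
        then have "x = frac a s \<oplus>\<^bsub>L\<^esub> frac b s"
          using r even_carr odd_carr by (simp add: frac_add_same)
        moreover have "frac a s \<in> even_part L" "frac b s \<in> odd_part L"
          using ab r(2) unfolding L_even L_odd by auto
        ultimately show "x \<in> even_part L <+>\<^bsub>L\<^esub> odd_part L"
          unfolding set_add_def' by blast
      qed
    qed
    show "even_part L \<inter> odd_part L = {\<zero>\<^bsub>L\<^esub>}"
    proof
      show "{\<zero>\<^bsub>L\<^esub>} \<subseteq> even_part L \<inter> odd_part L"
        using L_zero L_even L_odd one_S even_closed(1) odd_closed(1) by blast
      show "even_part L \<inter> odd_part L \<subseteq> {\<zero>\<^bsub>L\<^esub>}"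
      proof
        fix x assume "x \<in> even_part L \<inter> odd_part L"
        then obtain a s b t where a: "a \<in> even_part R" "s \<in> S" "x = frac a s"
          and b: "b \<in> odd_part R" "t \<in> S" "x = frac b t"
          using L_even L_odd by auto
        have eq: "frac a s = frac b t" using a(3) b(3) by simp
        then obtain u where u: "u \<in> S" "act u (act t a) = act u (act s b)"
          using frac_eq_iff[OF even_carr[OF a(1)] a(2) odd_carr[OF b(1)] b(2)] by blast
        have "act u (act t a) \<in> even_part R" using u(1) a b by simp
        moreover have "act u (act t a) \<in> odd_part R" using u a b by simp
        ultimately have "act u (act t a) = \<zero>" using even_and_odd by blast
        then have "act u t \<otimes> a = \<zero>" using u(1) a b even_carr by (simp add: act_simps)
        then show "x \<in> {\<zero>\<^bsub>L\<^esub>}"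
          using frac_eq_zero_iff[OF even_carr[OF a(1)] a(2)] u(1) b(2) a(3) act_S by blast
      qed
    qed
    have prod: "\<exists>r\<in>Z. \<exists>s\<in>S. x \<otimes>\<^bsub>L\<^esub> y = frac r s"
      if x: "\<exists>a\<in>X. \<exists>s\<in>S. x = frac a s" and y: "\<exists>b\<in>Y. \<exists>t\<in>S. y = frac b t"
        and XY: "X \<subseteq> carrier R" "Y \<subseteq> carrier R" "\<And>a b. \<lbrakk>a \<in> X; b \<in> Y\<rbrakk> \<Longrightarrow> a \<otimes> b \<in> Z"
      for X Y Z x y
    proof -
      obtain a s b t where c: "a \<in> X" "s \<in> S" "x = frac a s" "b \<in> Y" "t \<in> S" "y = frac b t"
        using x y by blast
      have "a \<in> carrier R" "b \<in> carrier R" using c XY by blast+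
      then have "x \<otimes>\<^bsub>L\<^esub> y = frac (a \<otimes> b) (act s t)" using c by (simp add: frac_mult)
      then show ?thesis using XY(3)[OF c(1,4)] mult_S'[OF c(2,5)] by blast
    qed
    have parts: "even_part R \<subseteq> carrier R" "odd_part R \<subseteq> carrier R" by blast+
    fix x y
    show "x \<otimes>\<^bsub>L\<^esub> y \<in> even_part L" if "x \<in> even_part L" "y \<in> even_part L"
      using prod[OF that[unfolded L_even] parts(1,1) even_even] unfolding L_even .
    show "x \<otimes>\<^bsub>L\<^esub> y \<in> odd_part L" if "x \<in> even_part L" "y \<in> odd_part L"
      using prod[OF that[unfolded L_even L_odd] parts(1,2) even_odd] unfolding L_odd .
    show "x \<otimes>\<^bsub>L\<^esub> y \<in> odd_part L" if "x \<in> odd_part L" "y \<in> even_part L"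
      using prod[OF that[unfolded L_even L_odd] parts(2,1) odd_even] unfolding L_odd .
    show "x \<otimes>\<^bsub>L\<^esub> y \<in> even_part L" if "x \<in> odd_part L" "y \<in> odd_part L"
      using prod[OF that[unfolded L_odd] parts(2,2) odd_odd] unfolding L_even .
    show "x \<otimes>\<^bsub>L\<^esub> y = y \<otimes>\<^bsub>L\<^esub> x" if x: "x \<in> even_part L" and y: "y \<in> carrier L"
    proof -
      obtain a s where a: "a \<in> even_part R" "s \<in> S" "x = frac a s" using x L_even by blast
      obtain b t where b: "b \<in> carrier R" "t \<in> S" "y = frac b t" using y L_carrier by blast
      show ?thesis using a b even_carr[OF a(1)] even_central[OF a(1) b(1)]
        by (simp add: frac_mult act_commute)
    qed
  next
    fix x assume "x \<in> odd_part L"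
    then obtain a s where a: "a \<in> odd_part R" "s \<in> S" "x = frac a s" using L_odd by blast
    show "x \<otimes>\<^bsub>L\<^esub> x = \<zero>\<^bsub>L\<^esub>"
      using a odd_carr by (simp add: frac_mult odd_square frac_zero)
  qed
qed

end

section \<open>Ideals and primes of a localization\<close>

context even_multiplicative_set
begin

definition contraction :: "('a \<times> 'a) set set \<Rightarrow> 'a set"
  where "contraction Q = {r \<in> carrier R. frac r \<one> \<in> Q}"

definition extension :: "'a set \<Rightarrow> ('a \<times> 'a) set set"
  where "extension I = {frac r s |r s. r \<in> I \<and> s \<in> S}"

lemma frac_split:
  assumes "r \<in> carrier R" "s \<in> S"
  shows "frac r s = frac \<one> s \<otimes>\<^bsub>L\<^esub> frac r \<one>" and "frac r \<one> = frac s \<one> \<otimes>\<^bsub>L\<^esub> frac r s"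
proof -
  show "frac r s = frac \<one> s \<otimes>\<^bsub>L\<^esub> frac r \<one>" using assms one_S by (simp add: frac_mult)
  have "frac s \<one> \<otimes>\<^bsub>L\<^esub> frac r s = frac (act s r) (act s \<one>)"
    using assms one_S by (simp add: frac_mult mult_to_act)
  also have "\<dots> = frac r \<one>" using assms one_S by (intro frac_cancel) simp_all
  finally show "frac r \<one> = frac s \<one> \<otimes>\<^bsub>L\<^esub> frac r s" by simp
qed

lemma frac_in_ideal_iff:
  assumes "ideal Q L" "r \<in> carrier R" "s \<in> S"
  shows "frac r s \<in> Q \<longleftrightarrow> r \<in> contraction Q"
proof -
  interpret L: ring L by (rule localization_ring)
  have "frac r s \<in> Q \<longleftrightarrow> frac r \<one> \<in> Q"
    using frac_split[OF assms(2,3)] L.ideal_closed(5)[OF assms(1)] assms(3) one_S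
    by (metis frac_closed S_carr one_closed)
  then show ?thesis using assms by (simp add: contraction_def)
qed

lemma extension_contraction:
  assumes "ideal Q L"
  shows "extension (contraction Q) = Q"
proof -
  interpret L: ring L by (rule localization_ring)
  have "r \<in> carrier R" if "r \<in> contraction Q" for r using that by (simp add: contraction_def)
  moreover have "\<exists>r\<in>carrier R. \<exists>s\<in>S. x = frac r s" if "x \<in> Q" for x
    using L.ideal_closed(1)[OF assms] that L_carrier by blast
  ultimately show ?thesis
    using frac_in_ideal_iff[OF assms] unfolding extension_def by blast
qed

lemma contraction_ideal:
  assumes "ideal Q L"
  shows "ideal (contraction Q) R"
proof -
  interpret L: ring L by (rule localization_ring)
  note Q = L.ideal_closed[OF assms]
  show ?thesis
  proof (rule ideal_of_closed)
    show "contraction Q \<subseteq> carrier R" by (auto simp: contraction_def)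
    show "\<zero> \<in> contraction Q" using Q(2) by (simp add: contraction_def L_zero)
    show "x \<oplus> y \<in> contraction Q" if "x \<in> contraction Q" "y \<in> contraction Q" for x y
      using that Q(3)[of "frac x \<one>" "frac y \<one>"] one_S by (simp add: contraction_def frac_add_same)
    show "r \<otimes> x \<in> contraction Q" "x \<otimes> r \<in> contraction Q"
      if "r \<in> carrier R" "x \<in> contraction Q" for r x
      using that Q(5,6)[of "frac r \<one>" "frac x \<one>"] one_S by (simp_all add: contraction_def frac_mult)
  qed
qed

lemma contraction_superideal:
  assumes "superideal Q L"
  shows "superideal (contraction Q) R"
proof -
  interpret L: superring L by (rule localization_superring)
  have Q: "ideal Q L" "\<And>a b. \<lbrakk>a \<in> even_part L; b \<in> odd_part L; a \<oplus>\<^bsub>L\<^esub> b \<in> Q\<rbrakk> \<Longrightarrow> a \<in> Q"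
    using assms L.superideal_iff by blast+
  have "a \<in> contraction Q" if "a \<in> even_part R" "b \<in> odd_part R" "a \<oplus> b \<in> contraction Q" for a b
  proof -
    have carr: "a \<in> carrier R" "b \<in> carrier R" using that by auto
    have "frac a \<one> \<in> even_part L" "frac b \<one> \<in> odd_part L"
      using that one_S unfolding L_even L_odd by blast+
    moreover have "frac a \<one> \<oplus>\<^bsub>L\<^esub> frac b \<one> \<in> Q"
      using that(3) carr one_S by (simp add: frac_add_same contraction_def)
    ultimately show ?thesis using Q(2) carr by (simp add: contraction_def)
  qed
  then show ?thesis using contraction_ideal[OF Q(1)] by (simp add: superideal_iff)
qed

text \<open>An ideal of the localization is the extension of its contraction, so a chain of ideals stops growing
  as soon as the chain of contractions does.\<close>

lemma localization_noetherian:
  assumes "noetherian_superring R"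
  shows "noetherian_superring L"
  unfolding noetherian_superring_def
proof (intro conjI allI impI)
  show "superring L" by (rule localization_superring)
  fix I :: "nat \<Rightarrow> ('a \<times> 'a) set set"
  assume I: "\<forall>n. superideal (I n) L \<and> I n \<subseteq> I (Suc n)"
  have "superideal (contraction (I n)) R \<and> contraction (I n) \<subseteq> contraction (I (Suc n))" for n
    using I contraction_superideal unfolding contraction_def by blast
  then obtain n where n: "\<forall>m\<ge>n. contraction (I m) = contraction (I n)"
    using assms unfolding noetherian_superring_def
    by (elim conjE allE[of _ "\<lambda>n. contraction (I n)"]) auto
  have "I m = extension (contraction (I m))" for m
    using I extension_contraction by (simp add: superideal_def)
  with n show "\<exists>n. \<forall>m\<ge>n. I m = I n" by metis
qed

lemma contraction_super_prime:
  assumes "super_prime Q L"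
  shows "super_prime (contraction Q) R" and "contraction Q \<inter> S = {}"
proof -
  interpret L: superring L by (rule localization_superring)
  note Q = L.super_primeD[OF assms]
  show "super_prime (contraction Q) R" unfolding super_prime_iff
  proof (intro conjI ballI impI)
    show "ideal (contraction Q) R" by (rule contraction_ideal[OF Q(1)])
    show "\<one> \<notin> contraction Q" using Q(2) by (simp add: contraction_def L_one)
    fix x y assume xy: "x \<in> carrier R" "y \<in> carrier R" "x \<otimes> y \<in> contraction Q"
    then have "frac x \<one> \<otimes>\<^bsub>L\<^esub> frac y \<one> \<in> Q" using one_S by (simp add: frac_mult contraction_def)
    then show "x \<in> contraction Q \<or> y \<in> contraction Q"
      using Q(4)[of "frac x \<one>" "frac y \<one>"] xy one_S by (simp add: contraction_def)
  qed
  have False if "s \<in> contraction Q" "s \<in> S" for s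
    using frac_in_ideal_iff[OF Q(1), of s s] that Q(2) by (simp add: frac_self)
  then show "contraction Q \<inter> S = {}" by blast
qed

lemma frac_in_extension_iff:
  assumes P: "super_prime P R" "P \<inter> S = {}" and r: "r \<in> carrier R" "s \<in> S"
  shows "frac r s \<in> extension P \<longleftrightarrow> r \<in> P"
proof
  note P' = super_primeD[OF P(1)]
  assume "frac r s \<in> extension P"
  then obtain r' s' where r': "r' \<in> P" "s' \<in> S" "frac r s = frac r' s'"
    unfolding extension_def by blast
  then have carr: "r' \<in> carrier R" using ideal_closed(1)[OF P'(1)] by blast
  then obtain u where u: "u \<in> S" "act u (act s' r) = act u (act s r')"
    using r' r frac_eq_iff by blast
  then have "act u s' \<otimes> r = (act u s) \<otimes> r'" using carr r r' by (simp add: act_simps)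
  also have "\<dots> \<in> P" using ideal_closed(5)[OF P'(1) _ r'(1)] u r by simp
  finally have "act u s' \<in> P \<or> r \<in> P" using P'(4) u r' r by simp
  moreover have "act u s' \<in> S" using u r' by simp
  ultimately show "r \<in> P" using P(2) by blast
qed (use r in \<open>auto simp: extension_def\<close>)

lemma extension_super_prime:
  assumes P: "super_prime P R" "P \<inter> S = {}"
  shows "super_prime (extension P) L" and "contraction (extension P) = P"
proof -
  interpret L: superring L by (rule localization_superring)
  note P' = super_primeD[OF P(1)]
  note I = ideal_closed[OF P'(1)]
  note mem = frac_in_extension_iff[OF P]
  show "contraction (extension P) = P"
    using mem one_S I(1) unfolding contraction_def by blast
  have sub: "\<exists>r s. r \<in> P \<and> r \<in> carrier R \<and> s \<in> S \<and> x = frac r s" if "x \<in> extension P" for x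
    using that I(1) unfolding extension_def by blast
  show "super_prime (extension P) L" unfolding L.super_prime_iff
  proof (intro conjI ballI impI)
    show "ideal (extension P) L"
    proof (rule L.ideal_of_closed)
      show "extension P \<subseteq> carrier L" using sub by force
      show "\<zero>\<^bsub>L\<^esub> \<in> extension P" unfolding L_zero using mem one_S I(2) by simp
      fix x y assume "x \<in> extension P" "y \<in> extension P"
      then obtain a s b t where "a \<in> P" "a \<in> carrier R" "s \<in> S" "x = frac a s"
        and "b \<in> P" "b \<in> carrier R" "t \<in> S" "y = frac b t"
        using sub by blast
      then show "x \<oplus>\<^bsub>L\<^esub> y \<in> extension P"
        using I(3)[OF I(5)[of t a] I(5)[of s b]] by (simp add: frac_add mem act_def mult_S)
    next
      fix x y assume "x \<in> carrier L" "y \<in> extension P"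
      moreover from \<open>y \<in> extension P\<close> obtain b t
        where "b \<in> P" "b \<in> carrier R" "t \<in> S" "y = frac b t" using sub by blast
      moreover from \<open>x \<in> carrier L\<close> obtain a s where "a \<in> carrier R" "s \<in> S" "x = frac a s"
        using L_carrier by blast
      ultimately show "x \<otimes>\<^bsub>L\<^esub> y \<in> extension P" "y \<otimes>\<^bsub>L\<^esub> x \<in> extension P"
        using I(5)[of a b] I(6)[of a b] by (simp_all add: frac_mult mem)
    qed
    show "\<one>\<^bsub>L\<^esub> \<notin> extension P" unfolding L_one using mem one_S P'(2) by simp
    fix x y assume xy: "x \<in> carrier L" "y \<in> carrier L" "x \<otimes>\<^bsub>L\<^esub> y \<in> extension P"
    obtain a b s where c: "a \<in> carrier R" "b \<in> carrier R" "s \<in> S" "x = frac a s" "y = frac b s"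
      using common_denominator2[OF xy(1,2)] .
    then have "a \<otimes> b \<in> P" using xy(3) by (simp add: frac_mult mem)
    then show "x \<in> extension P \<or> y \<in> extension P" using P'(4) c mem by blast
  qed
qed

lemma extension_mono: "P \<subseteq> Q \<Longrightarrow> extension P \<subseteq> extension Q"
  unfolding extension_def by blast

lemma Kdim_localization:
  "Kdim (even_ring L) = chain_dim {P. super_prime P R \<and> P \<inter> S = {}}"
proof -
  interpret L: superring L by (rule localization_superring)
  show ?thesis unfolding L.Kdim_even_ring
  proof (rule chain_dim_eqI[where f = contraction and g = extension])
    fix P Q assume "P \<in> {Q. super_prime Q L}" "Q \<in> {Q. super_prime Q L}" "P \<subset> Q"
    moreover then have "extension (contraction P) = P" "extension (contraction Q) = Q"
      using extension_contraction L.super_primeD(1) by blast+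
    moreover have "contraction P \<subseteq> contraction Q"
      using \<open>P \<subset> Q\<close> unfolding contraction_def by blast
    ultimately show "contraction P \<subset> contraction Q" by (metis psubset_eq)
  next
    fix P Q assume "P \<in> {P. super_prime P R \<and> P \<inter> S = {}}" "Q \<in> {P. super_prime P R \<and> P \<inter> S = {}}"
      and "P \<subset> Q"
    moreover then have "contraction (extension P) = P" "contraction (extension Q) = Q"
      using extension_super_prime(2) by blast+
    moreover have "extension P \<subseteq> extension Q" using extension_mono \<open>P \<subset> Q\<close> by blast
    ultimately show "extension P \<subset> extension Q" by (metis psubset_eq)
  qed (use contraction_super_prime extension_super_prime(1) in auto)
qed

lemma extension_least_prime:
  assumes "super_prime J R" "J \<inter> S = {}" "\<And>P. super_prime P R \<Longrightarrow> J \<subseteq> P"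
  shows "super_prime Q L \<Longrightarrow> extension J \<subseteq> Q"
proof -
  assume Q: "super_prime Q L"
  interpret L: superring L by (rule localization_superring)
  have "extension J \<subseteq> extension (contraction Q)"
    using extension_mono assms(3) contraction_super_prime(1)[OF Q] by blast
  then show "extension J \<subseteq> Q" using extension_contraction L.super_primeD(1)[OF Q] by simp
qed

lemma foldr_frac:
  assumes "set as \<subseteq> carrier R"
  shows "foldr (\<otimes>\<^bsub>L\<^esub>) (map (\<lambda>a. frac a \<one>) as) \<one>\<^bsub>L\<^esub> = frac (foldr (\<otimes>) as \<one>) \<one>"
  using assms
proof (induction as)
  case Nil
  then show ?case by (simp add: L_one)
next
  case (Cons a as)
  then show ?case using foldr_mult_closed[of as] one_S by (simp add: frac_mult)
qed

text \<open>Denominators are central, hence they can be collected in front of a product.\<close>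

lemma odd_list_numerators:
  assumes "set bs \<subseteq> odd_part L"
  shows "\<exists>as. \<exists>s\<in>S. length as = length bs \<and> set as \<subseteq> odd_part R \<and>
    foldr (\<otimes>\<^bsub>L\<^esub>) bs \<one>\<^bsub>L\<^esub> = frac (foldr (\<otimes>) as \<one>) s"
  using assms
proof (induction bs)
  case Nil
  then show ?case using one_S by (auto simp: L_one)
next
  case (Cons b bs)
  then obtain as s where as: "s \<in> S" "length as = length bs" "set as \<subseteq> odd_part R"
    "foldr (\<otimes>\<^bsub>L\<^esub>) bs \<one>\<^bsub>L\<^esub> = frac (foldr (\<otimes>) as \<one>) s" by auto
  from Cons.prems have "b \<in> odd_part L" by simp
  then obtain a t where a: "a \<in> odd_part R" "t \<in> S" "b = frac a t"
    unfolding L_odd by blast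
  have "set as \<subseteq> carrier R" using as(3) odd_carr by blast
  then have "foldr (\<otimes>\<^bsub>L\<^esub>) (b # bs) \<one>\<^bsub>L\<^esub> = frac (foldr (\<otimes>) (a # as) \<one>) (act t s)"
    using as a foldr_mult_closed odd_carr by (simp add: frac_mult)
  moreover have "length (a # as) = length (b # bs)" "set (a # as) \<subseteq> odd_part R" "act t s \<in> S"
    using as a by simp_all
  ultimately show ?case by blast
qed

text \<open>Being a system of odd parameters only depends on whether the product of the elements has an
  annihilator inside the least prime, and neither clearing denominators nor passing to fractions
  changes that.\<close>

lemma odd_parameters_length_localization:
  assumes J: "super_prime J R" "J \<inter> S = {}" "\<And>P. super_prime P R \<Longrightarrow> J \<subseteq> P"
    and d: "Kdim (even_ring R) = ereal (real d)" and e: "Kdim (even_ring L) = ereal (real e)"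
  shows "(\<exists>as. length as = n \<and> odd_parameters R as) \<longleftrightarrow>
    (\<exists>bs. length bs = n \<and> odd_parameters L bs)"
proof -
  interpret L: superring L by (rule localization_superring)
  note params = odd_parameters_iff[OF d J(1,3)]
  note paramsL = L.odd_parameters_iff[OF e extension_super_prime(1)[OF J(1,2)]
      extension_least_prime[OF J]]
  note J' = super_primeD[OF J(1)]
  show ?thesis
  proof
    assume "\<exists>as. length as = n \<and> odd_parameters R as"
    then obtain as where as: "length as = n" "set as \<subseteq> odd_part R"
      "\<And>r. \<lbrakk>r \<in> even_part R; r \<otimes> foldr (\<otimes>) as \<one> = \<zero>\<rbrakk> \<Longrightarrow> r \<in> J"
      by (auto simp: params)
    define bs where "bs = map (\<lambda>a. frac a \<one>) as"
    have asc: "set as \<subseteq> carrier R" using as(2) odd_carr by blast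
    note prodc = foldr_mult_closed[OF asc]
    have "frac a \<one> \<in> odd_part L" if "a \<in> odd_part R" for a using that one_S L_odd by blast
    then have "set bs \<subseteq> odd_part L" using as(2) by (auto simp: bs_def)
    moreover have "x \<in> extension J"
      if x: "x \<in> even_part L" "x \<otimes>\<^bsub>L\<^esub> foldr (\<otimes>\<^bsub>L\<^esub>) bs \<one>\<^bsub>L\<^esub> = \<zero>\<^bsub>L\<^esub>" for x
    proof -
      obtain r s where r: "r \<in> even_part R" "s \<in> S" "x = frac r s" using x(1) L_even by blast
      then have "frac (r \<otimes> foldr (\<otimes>) as \<one>) s = \<zero>\<^bsub>L\<^esub>"
        using x(2) one_S prodc even_carr by (simp add: bs_def foldr_frac[OF asc] frac_mult)
      then obtain u where u: "u \<in> S" "u \<otimes> (r \<otimes> foldr (\<otimes>) as \<one>) = \<zero>"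
        using frac_eq_zero_iff r prodc even_carr by auto
      then have "(u \<otimes> r) \<otimes> foldr (\<otimes>) as \<one> = \<zero>"
        using r even_carr prodc by (simp add: m_assoc)
      then have "u \<otimes> r \<in> J" using as(3) r u even_even S_evenD by blast
      then have "r \<in> J" using J'(4) r u J(2) even_carr S_carr by blast
      then show ?thesis using r by (auto simp: extension_def)
    qed
    ultimately have "odd_parameters L bs" by (simp add: paramsL)
    moreover have "length bs = n" using as(1) by (simp add: bs_def)
    ultimately show "\<exists>bs. length bs = n \<and> odd_parameters L bs" by blast
  next
    assume "\<exists>bs. length bs = n \<and> odd_parameters L bs"
    then obtain bs where bs: "length bs = n" "set bs \<subseteq> odd_part L"
      "\<And>x. \<lbrakk>x \<in> even_part L; x \<otimes>\<^bsub>L\<^esub> foldr (\<otimes>\<^bsub>L\<^esub>) bs \<one>\<^bsub>L\<^esub> = \<zero>\<^bsub>L\<^esub>\<rbrakk> \<Longrightarrow> x \<in> extension J"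
      by (auto simp: paramsL)
    obtain as s where as: "s \<in> S" "length as = length bs" "set as \<subseteq> odd_part R"
      "foldr (\<otimes>\<^bsub>L\<^esub>) bs \<one>\<^bsub>L\<^esub> = frac (foldr (\<otimes>) as \<one>) s"
      using odd_list_numerators[OF bs(2)] by blast
    have asc: "set as \<subseteq> carrier R" using as(3) odd_carr by blast
    note prodc = foldr_mult_closed[OF asc]
    have "r \<in> J" if r: "r \<in> even_part R" "r \<otimes> foldr (\<otimes>) as \<one> = \<zero>" for r
    proof -
      have "frac r \<one> \<otimes>\<^bsub>L\<^esub> foldr (\<otimes>\<^bsub>L\<^esub>) bs \<one>\<^bsub>L\<^esub> = \<zero>\<^bsub>L\<^esub>"
        using as r one_S prodc even_carr by (simp add: frac_mult frac_zero)
      moreover have "frac r \<one> \<in> even_part L" using r one_S L_even by blast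
      ultimately have "frac r \<one> \<in> extension J" using bs(3) by blast
      then show ?thesis using frac_in_extension_iff[OF J(1,2)] r(1) one_S even_carr by blast
    qed
    then have "odd_parameters R as" by (simp add: params as(3))
    then show "\<exists>as. length as = n \<and> odd_parameters R as" using as(2) bs(1) by auto
  qed
qed

end

section \<open>Localization at a prime\<close>

context superring
begin

lemma multiplicative_set_of_prime:
  assumes "super_prime P R"
  shows "even_multiplicative_set R (even_part R - P)"
proof
  note P = super_primeD[OF assms]
  show "even_part R - P \<subseteq> even_part R" by blast
  show "\<one> \<in> even_part R - P" using P(2) by simp
  show "\<zero> \<notin> even_part R - P" using ideal_closed(2)[OF P(1)] by simp
  show "s \<otimes> t \<in> even_part R - P" if "s \<in> even_part R - P" "t \<in> even_part R - P" for s t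
    using that P(4) even_even even_carr by blast
qed

lemma prime_inside_iff:
  assumes P: "super_prime P R" and Q: "super_prime Q R"
  shows "Q \<inter> (even_part R - P) = {} \<longleftrightarrow> Q \<subseteq> P"
proof
  note P' = super_primeD[OF P] and Q' = super_primeD[OF Q]
  assume disj: "Q \<inter> (even_part R - P) = {}"
  show "Q \<subseteq> P"
  proof
    fix x assume x: "x \<in> Q"
    obtain a b where ab: "a \<in> even_part R" "b \<in> odd_part R" "x = a \<oplus> b"
      using graded_decomposition ideal_closed(1)[OF Q'(1)] x by blast
    have "x \<ominus> b = a" using ab even_carr odd_carr by algebra
    then have "a \<in> Q" using ideal_closed(4)[OF Q'(1) x] ab Q'(3) by blast
    then have "a \<in> P" using disj ab(1) by blast
    then show "x \<in> P" using ideal_closed(3)[OF P'(1)] ab P'(3) by blast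
  qed
qed blast

text \<open>A numerator outside \<open>P\<close> has its even component \<open>a\<close> outside \<open>P\<close>, because odd elements lie in \<open>P\<close>.
  Multiplication by the fraction with denominator \<open>a\<close> then gives \<open>\<one>\<close> up to an odd fraction.\<close>

lemma localization_at_maximal:
  assumes P: "super_prime P R"
  defines "E \<equiv> even_multiplicative_set.extension R (even_part R - P)"
  shows "super_maximal (E P) (localization_at R P)"
    and "{I. super_maximal I (localization_at R P)} = {E P}"
proof -
  interpret E: even_multiplicative_set R "even_part R - P"
    by (rule multiplicative_set_of_prime[OF P])
  interpret L: superring E.L by (rule E.localization_superring)
  note P' = super_primeD[OF P]
  have disj: "P \<inter> (even_part R - P) = {}" by blast
  note prime = E.extension_super_prime[OF P disj]
  note I = L.ideal_closed[OF L.super_primeD(1)[OF prime(1)]]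
  show max: "super_maximal (E P) (localization_at R P)"
    unfolding E_def localization_at_def L.super_maximal_iff
  proof (intro conjI ballI)
    show "super_prime (E.extension P) E.L" by (rule prime(1))
    fix x assume x: "x \<in> carrier E.L - E.extension P"
    then have "x \<in> carrier E.L" by simp
    then obtain r s where r': "r \<in> carrier R" "s \<in> even_part R - P" "x = E.frac r s"
      unfolding E.L_carrier by blast
    moreover have "r \<notin> P" using x E.frac_in_extension_iff[OF P disj r'(1,2)] r'(3) by simp
    ultimately have r: "r \<in> carrier R" "s \<in> even_part R - P" "x = E.frac r s" "r \<notin> P" by auto
    obtain a b where ab: "a \<in> even_part R" "b \<in> odd_part R" "r = a \<oplus> b"
      using graded_decomposition[OF r(1)] .
    have carr: "a \<in> carrier R" "b \<in> carrier R" using ab by auto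
    have "a \<notin> P" using ideal_closed(3)[OF P'(1)] ab r(4) P'(3) by blast
    then have a: "a \<in> even_part R - P" using ab by blast
    have "x \<otimes>\<^bsub>E.L\<^esub> E.frac s a = E.frac (E.act s r) (E.act s a)"
      using r a by (simp add: E.frac_mult E.mult_to_act)
    also have "\<dots> = E.frac r a" using r a by (simp add: E.frac_cancel)
    also have "\<dots> = \<one>\<^bsub>E.L\<^esub> \<oplus>\<^bsub>E.L\<^esub> E.frac b a"
      using ab(3) a carr by (simp add: E.frac_self[OF a, symmetric] E.frac_add_same)
    finally have "x \<otimes>\<^bsub>E.L\<^esub> E.frac s a \<ominus>\<^bsub>E.L\<^esub> \<one>\<^bsub>E.L\<^esub> = E.frac b a"
      using E.frac_closed[OF carr(2) a] by (simp only:) algebra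
    also have "\<dots> \<in> E.extension P"
      using E.frac_in_extension_iff[OF P disj carr(2) a] P'(3) ab(2) by blast
    finally have "x \<otimes>\<^bsub>E.L\<^esub> E.frac s a \<ominus>\<^bsub>E.L\<^esub> \<one>\<^bsub>E.L\<^esub> \<in> E.extension P" .
    moreover have "E.frac s a \<in> carrier E.L" using a r(2) by simp
    ultimately show "\<exists>y\<in>carrier E.L. x \<otimes>\<^bsub>E.L\<^esub> y \<ominus>\<^bsub>E.L\<^esub> \<one>\<^bsub>E.L\<^esub> \<in> E.extension P" by blast
  qed
  have "Q = E.extension P" if "super_maximal Q E.L" for Q
  proof -
    have Q: "super_prime Q E.L"
      and inv: "\<And>x. x \<in> carrier E.L - Q \<Longrightarrow> \<exists>y\<in>carrier E.L. x \<otimes>\<^bsub>E.L\<^esub> y \<ominus>\<^bsub>E.L\<^esub> \<one>\<^bsub>E.L\<^esub> \<in> Q"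
      using that L.super_maximal_iff by blast+
    note Q' = L.super_primeD[OF Q]
    note QI = L.ideal_closed[OF Q'(1)]
    have "E.contraction Q \<subseteq> P"
      using E.contraction_super_prime[OF Q] prime_inside_iff[OF P] by blast
    then have sub: "Q \<subseteq> E.extension P"
      using E.extension_mono E.extension_contraction[OF Q'(1)] by blast
    have "x \<in> Q" if x: "x \<in> E.extension P" for x
    proof (rule ccontr)
      assume "x \<notin> Q"
      have xc: "x \<in> carrier E.L" using x I(1) by blast
      then obtain y where y: "y \<in> carrier E.L" "x \<otimes>\<^bsub>E.L\<^esub> y \<ominus>\<^bsub>E.L\<^esub> \<one>\<^bsub>E.L\<^esub> \<in> Q"
        using inv \<open>x \<notin> Q\<close> by blast
      have "x \<otimes>\<^bsub>E.L\<^esub> y \<ominus>\<^bsub>E.L\<^esub> (x \<otimes>\<^bsub>E.L\<^esub> y \<ominus>\<^bsub>E.L\<^esub> \<one>\<^bsub>E.L\<^esub>) \<in> E.extension P"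
        using I(4)[OF I(6)[OF y(1) x]] y(2) sub by blast
      moreover have "x \<otimes>\<^bsub>E.L\<^esub> y \<ominus>\<^bsub>E.L\<^esub> (x \<otimes>\<^bsub>E.L\<^esub> y \<ominus>\<^bsub>E.L\<^esub> \<one>\<^bsub>E.L\<^esub>) = \<one>\<^bsub>E.L\<^esub>"
        using xc y(1) by algebra
      ultimately show False using L.super_primeD(2)[OF prime(1)] by simp
    qed
    with sub show ?thesis by blast
  qed
  with max show "{I. super_maximal I (localization_at R P)} = {E P}"
    unfolding E_def localization_at_def by blast
qed

end

section \<open>The odd part as a module over the even part\<close>

lemma maximal_element_of_acc:
  assumes acc: "\<And>I :: nat \<Rightarrow> 'a set. (\<And>n. I n \<in> X \<and> I n \<subseteq> I (Suc n)) \<Longrightarrow> \<exists>n. \<forall>m\<ge>n. I m = I n"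
    and "A \<in> X"
  obtains M where "M \<in> X" "\<And>V. \<lbrakk>V \<in> X; M \<subseteq> V\<rbrakk> \<Longrightarrow> V = M"
proof -
  have "wf {(V, W). V \<in> X \<and> W \<in> X \<and> W \<subset> V}"
    unfolding wf_iff_no_infinite_down_chain
  proof
    assume "\<exists>f. \<forall>i. (f (Suc i), f i) \<in> {(V, W). V \<in> X \<and> W \<in> X \<and> W \<subset> V}"
    then obtain f where f: "\<And>i. f i \<in> X \<and> f i \<subset> f (Suc i)" by blast
    then obtain n where "\<forall>m\<ge>n. f m = f n" using acc[of f] by blast
    then have "f (Suc n) = f n" by (metis le_SucI order_refl)
    with f[of n] show False by blast
  qed
  then have "\<exists>M\<in>X. \<forall>V. (V, M) \<in> {(V, W). V \<in> X \<and> W \<in> X \<and> W \<subset> V} \<longrightarrow> V \<notin> X"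
    using \<open>A \<in> X\<close> unfolding wf_eq_minimal by blast
  then show thesis using that by blast
qed

context superring
begin

definition odd_submodule :: "'a set \<Rightarrow> bool"
  where "odd_submodule W \<longleftrightarrow> W \<subseteq> odd_part R \<and> \<zero> \<in> W \<and> (\<forall>x\<in>W. \<forall>y\<in>W. x \<oplus> y \<in> W) \<and>
    (\<forall>r\<in>even_part R. \<forall>x\<in>W. r \<otimes> x \<in> W)"

lemma odd_submoduleI:
  assumes "W \<subseteq> odd_part R" "\<zero> \<in> W" "\<And>x y. \<lbrakk>x \<in> W; y \<in> W\<rbrakk> \<Longrightarrow> x \<oplus> y \<in> W"
    "\<And>r x. \<lbrakk>r \<in> even_part R; x \<in> W\<rbrakk> \<Longrightarrow> r \<otimes> x \<in> W"
  shows "odd_submodule W"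
  using assms by (simp add: odd_submodule_def)

lemma odd_submoduleD:
  assumes "odd_submodule W"
  shows "W \<subseteq> odd_part R" "\<zero> \<in> W" "\<And>x y. \<lbrakk>x \<in> W; y \<in> W\<rbrakk> \<Longrightarrow> x \<oplus> y \<in> W"
    "\<And>r x. \<lbrakk>r \<in> even_part R; x \<in> W\<rbrakk> \<Longrightarrow> r \<otimes> x \<in> W"
    "\<And>x. x \<in> W \<Longrightarrow> \<ominus> x \<in> W"
    "\<And>x y. \<lbrakk>x \<in> W; y \<in> W\<rbrakk> \<Longrightarrow> x \<ominus> y \<in> W"
proof -
  show sub: "W \<subseteq> odd_part R" and "\<zero> \<in> W" and add: "\<And>x y. \<lbrakk>x \<in> W; y \<in> W\<rbrakk> \<Longrightarrow> x \<oplus> y \<in> W"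
    and smult: "\<And>r x. \<lbrakk>r \<in> even_part R; x \<in> W\<rbrakk> \<Longrightarrow> r \<otimes> x \<in> W"
    using assms by (auto simp: odd_submodule_def)
  show neg: "\<ominus> x \<in> W" if "x \<in> W" for x
  proof -
    have "x \<in> carrier R" using that sub odd_carr by blast
    then have "\<ominus> \<one> \<otimes> x = \<ominus> x" by (simp add: l_minus)
    with smult[of "\<ominus> \<one>" x] that show ?thesis by simp
  qed
  show "\<And>x y. \<lbrakk>x \<in> W; y \<in> W\<rbrakk> \<Longrightarrow> x \<ominus> y \<in> W" using add neg by (simp add: a_minus_def)
qed

text \<open>Linear combinations with even coefficients, built up one term at a time.\<close>

inductive_set odd_span :: "'a set \<Rightarrow> 'a set" for B where
  zero: "\<zero> \<in> odd_span B"
| add: "\<lbrakk>b \<in> B; r \<in> even_part R; w \<in> odd_span B\<rbrakk> \<Longrightarrow> r \<otimes> b \<oplus> w \<in> odd_span B"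

lemma odd_span_minimal:
  assumes "odd_submodule W" "B \<subseteq> W"
  shows "odd_span B \<subseteq> W"
proof
  fix x assume "x \<in> odd_span B"
  then show "x \<in> W"
    by induction (use assms odd_submoduleD[OF assms(1)] in auto)
qed

lemma odd_submodule_odd_part: "odd_submodule (odd_part R)"
  by (rule odd_submoduleI) (auto intro: even_odd)

lemma odd_span_odd: "B \<subseteq> odd_part R \<Longrightarrow> odd_span B \<subseteq> odd_part R"
  by (rule odd_span_minimal[OF odd_submodule_odd_part])

lemma odd_span_submodule:
  assumes B: "B \<subseteq> odd_part R"
  shows "odd_submodule (odd_span B)"
proof (rule odd_submoduleI)
  note sub = odd_span_odd[OF B]
  show "odd_span B \<subseteq> odd_part R" by (rule sub)
  show "\<zero> \<in> odd_span B" by (rule odd_span.zero)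
  show "x \<oplus> y \<in> odd_span B" if "x \<in> odd_span B" and y: "y \<in> odd_span B" for x y
    using that(1)
  proof induction
    case zero
    then show ?case using y sub odd_carr by auto
  next
    case (add b r w)
    have "b \<in> carrier R" "r \<in> carrier R" "w \<in> carrier R" "y \<in> carrier R"
      using add.hyps y sub B odd_carr even_carr by blast+
    then have "(r \<otimes> b \<oplus> w) \<oplus> y = r \<otimes> b \<oplus> (w \<oplus> y)" by (simp add: a_assoc)
    then show ?case using odd_span.add[OF add.hyps(1,2) add.IH] by simp
  qed
  show "s \<otimes> x \<in> odd_span B" if s: "s \<in> even_part R" and "x \<in> odd_span B" for s x
    using that(2)
  proof induction
    case zero
    then show ?case using s even_carr odd_span.zero by simp
  next
    case (add b r w)
    have "b \<in> carrier R" "r \<in> carrier R" "w \<in> carrier R" "s \<in> carrier R"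
      using add.hyps s sub B odd_carr even_carr by blast+
    then have "s \<otimes> (r \<otimes> b \<oplus> w) = (s \<otimes> r) \<otimes> b \<oplus> s \<otimes> w" by (simp add: r_distr m_assoc)
    then show ?case using odd_span.add[OF add.hyps(1) even_even[OF s add.hyps(2)] add.IH] by simp
  qed
qed

lemma odd_span_base:
  assumes "B \<subseteq> odd_part R"
  shows "B \<subseteq> odd_span B"
proof
  fix b assume b: "b \<in> B"
  then have "b \<in> carrier R" using assms odd_carr by blast
  then show "b \<in> odd_span B" using odd_span.add[OF b one_even odd_span.zero] by simp
qed

lemma odd_span_mono: "\<lbrakk>A \<subseteq> B; B \<subseteq> odd_part R\<rbrakk> \<Longrightarrow> odd_span A \<subseteq> odd_span B"
  by (rule odd_span_minimal[OF odd_span_submodule]) (use odd_span_base in auto)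

lemma odd_submodule_insert:
  assumes W: "odd_submodule W" and x: "x \<in> odd_part R"
    and C: "C \<subseteq> even_part R" "\<zero> \<in> C" "\<And>c d. \<lbrakk>c \<in> C; d \<in> C\<rbrakk> \<Longrightarrow> c \<oplus> d \<in> C"
      "\<And>r c. \<lbrakk>r \<in> even_part R; c \<in> C\<rbrakk> \<Longrightarrow> r \<otimes> c \<in> C"
  shows "odd_submodule {w \<oplus> c \<otimes> x |w c. w \<in> W \<and> c \<in> C}" (is "odd_submodule ?V")
proof (rule odd_submoduleI)
  note W' = odd_submoduleD[OF W]
  show "?V \<subseteq> odd_part R" using W'(1) x C(1) even_odd by blast
  have "\<zero> = \<zero> \<oplus> \<zero> \<otimes> x" using x odd_carr by simp
  then show "\<zero> \<in> ?V" using W'(2) C(2) by blast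
  fix y assume "y \<in> ?V"
  then obtain w c where y: "w \<in> W" "c \<in> C" "y = w \<oplus> c \<otimes> x" by blast
  have yc: "w \<in> carrier R" "c \<in> carrier R" "x \<in> carrier R"
    using y W'(1) C(1) x by blast+
  {
    fix z assume "z \<in> ?V"
    then obtain v d where z: "v \<in> W" "d \<in> C" "z = v \<oplus> d \<otimes> x" by blast
    then have "v \<in> carrier R" "d \<in> carrier R" using W'(1) C(1) by blast+
    then have "y \<oplus> z = (w \<oplus> v) \<oplus> (c \<oplus> d) \<otimes> x"
      using yc y(3) z(3) by (simp add: l_distr a_ac)
    then show "y \<oplus> z \<in> ?V" using W'(3) C(3) y z by blast
  next
    fix r assume r: "r \<in> even_part R"
    then have "r \<otimes> y = r \<otimes> w \<oplus> (r \<otimes> c) \<otimes> x"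
      using yc y(3) even_carr by (simp add: r_distr m_assoc)
    then show "r \<otimes> y \<in> ?V" using W'(4) C(4) y r by blast
  }
qed

definition adjoin :: "'a set \<Rightarrow> 'a \<Rightarrow> 'a set"
  where "adjoin W x = {w \<oplus> r \<otimes> x |w r. w \<in> W \<and> r \<in> even_part R}"

lemma adjoin_submodule:
  assumes W: "odd_submodule W" and x: "x \<in> odd_part R"
  shows "odd_submodule (adjoin W x)" and "W \<subseteq> adjoin W x" and "x \<in> adjoin W x"
proof -
  note W' = odd_submoduleD[OF W]
  have xc: "x \<in> carrier R" using x by blast
  show "odd_submodule (adjoin W x)" unfolding adjoin_def
    by (rule odd_submodule_insert[OF W x]) (auto intro: even_even)
  show "W \<subseteq> adjoin W x"
  proof
    fix v assume v: "v \<in> W"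
    then have "v = v \<oplus> \<zero> \<otimes> x" using W'(1) odd_carr xc by auto
    then show "v \<in> adjoin W x" unfolding adjoin_def using v even_closed(1) by blast
  qed
  have "x = \<zero> \<oplus> \<one> \<otimes> x" using xc by simp
  then show "x \<in> adjoin W x" unfolding adjoin_def using W'(2) one_even by blast
qed

text \<open>An odd submodule is the odd part of a graded ideal: the even elements that multiply the odd
  part into the submodule form a suitable even part.\<close>

definition superideal_of_submodule :: "'a set \<Rightarrow> 'a set"
  where "superideal_of_submodule W =
    {e \<oplus> w |e w. e \<in> even_part R \<and> (\<forall>y\<in>odd_part R. e \<otimes> y \<in> W) \<and> w \<in> W}"

lemma superideal_of_submodule_superideal:
  assumes W: "odd_submodule W"
  shows "superideal (superideal_of_submodule W) R"
    and "superideal_of_submodule W \<inter> odd_part R = W"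
proof -
  note W' = odd_submoduleD[OF W]
  define E where "E = {e \<in> even_part R. \<forall>y\<in>odd_part R. e \<otimes> y \<in> W}"
  have I: "x \<in> superideal_of_submodule W \<longleftrightarrow> (\<exists>e\<in>E. \<exists>w\<in>W. x = e \<oplus> w)" for x
    by (auto simp: superideal_of_submodule_def E_def)
  have Esub: "e \<in> even_part R" if "e \<in> E" for e using that by (simp add: E_def)
  have Wsub: "w \<in> odd_part R" if "w \<in> W" for w using that W'(1) by blast
  have Eadd: "e \<oplus> f \<in> E" if "e \<in> E" "f \<in> E" for e f
    using that W'(3) by (simp add: E_def l_distr even_carr odd_carr)
  have Emult: "r \<otimes> e \<in> E" if "r \<in> even_part R" "e \<in> E" for r e
    using that W'(4) by (simp add: E_def m_assoc even_carr odd_carr even_even)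
  have EW: "r \<otimes> e \<in> W" "e \<otimes> r \<in> W" if "r \<in> odd_part R" "e \<in> E" for r e
  proof -
    show "e \<otimes> r \<in> W" using that by (simp add: E_def)
    then show "r \<otimes> e \<in> W" using even_central[OF Esub[OF that(2)] odd_carr[OF that(1)]] by simp
  qed
  have WE: "r \<otimes> w \<in> E" "w \<otimes> r \<in> E" if r: "r \<in> odd_part R" and w: "w \<in> W" for r w
  proof -
    have "(r \<otimes> w) \<otimes> y \<in> W" if y: "y \<in> odd_part R" for y
    proof -
      have c: "r \<in> carrier R" "w \<in> carrier R" "y \<in> carrier R" using r w y Wsub by blast+
      have "(r \<otimes> w) \<otimes> y = \<ominus> ((r \<otimes> y) \<otimes> w)"
        using c odd_anticommute[OF Wsub[OF w] y] by (simp add: m_assoc r_minus)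
      then show ?thesis using W'(4,5) odd_odd[OF r y] w by simp
    qed
    then show 1: "r \<otimes> w \<in> E" using r w Wsub odd_odd by (simp add: E_def)
    have c: "r \<in> carrier R" "w \<in> carrier R" using r w Wsub by blast+
    have "w \<otimes> r = \<ominus> \<one> \<otimes> (r \<otimes> w)"
      using odd_anticommute[OF Wsub[OF w] r] c by (simp add: l_minus)
    then show "w \<otimes> r \<in> E" using Emult[OF _ 1, of "\<ominus> \<one>"] by simp
  qed
  have ideal: "ideal (superideal_of_submodule W) R"
  proof (rule ideal_of_graded_closed)
    show "superideal_of_submodule W \<subseteq> carrier R" using Esub Wsub even_carr odd_carr a_closed by (auto simp: I)
    have "\<zero> \<in> E" using W'(2) odd_carr by (simp add: E_def)
    then show "\<zero> \<in> superideal_of_submodule W" unfolding I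
      by (intro bexI[of _ \<zero>]) (simp_all add: W'(2))
    fix x assume "x \<in> superideal_of_submodule W"
    then obtain e w where x: "e \<in> E" "w \<in> W" "x = e \<oplus> w" unfolding I by blast
    note c = even_carr[OF Esub[OF x(1)]] odd_carr[OF Wsub[OF x(2)]]
    {
      fix y assume "y \<in> superideal_of_submodule W"
      then obtain f v where y: "f \<in> E" "v \<in> W" "y = f \<oplus> v" unfolding I by blast
      note d = even_carr[OF Esub[OF y(1)]] odd_carr[OF Wsub[OF y(2)]]
      have "x \<oplus> y = (e \<oplus> f) \<oplus> (w \<oplus> v)" unfolding x(3) y(3) using c d by (simp add: a_ac)
      then show "x \<oplus> y \<in> superideal_of_submodule W" unfolding I
        using Eadd[OF x(1) y(1)] W'(3)[OF x(2) y(2)] by blast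
    next
      fix r assume r: "r \<in> even_part R"
      have "r \<otimes> x = r \<otimes> e \<oplus> r \<otimes> w" unfolding x(3) using c even_carr[OF r] by (simp add: r_distr)
      then show "r \<otimes> x \<in> superideal_of_submodule W" unfolding I
        using Emult[OF r x(1)] W'(4)[OF r x(2)] by blast
    next
      fix r assume r: "r \<in> odd_part R"
      have "r \<otimes> x = r \<otimes> w \<oplus> r \<otimes> e" "x \<otimes> r = w \<otimes> r \<oplus> e \<otimes> r"
        unfolding x(3) using c odd_carr[OF r] by (simp_all add: r_distr l_distr a_comm)
      then show "r \<otimes> x \<in> superideal_of_submodule W" "x \<otimes> r \<in> superideal_of_submodule W"
        unfolding I using EW[OF r x(1)] WE[OF r x(2)] by blast+
    }
  qed
  have part: "a \<in> E" "b \<in> W" if ab: "a \<in> even_part R" "b \<in> odd_part R" "a \<oplus> b \<in> superideal_of_submodule W" for a b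
  proof -
    obtain e w where "e \<in> E" "w \<in> W" "a \<oplus> b = e \<oplus> w" using ab(3) unfolding I by blast
    then show "a \<in> E" "b \<in> W" using graded_decomposition_unique[of a e b w] ab Esub Wsub by auto
  qed
  have "a \<in> superideal_of_submodule W" if "a \<in> E" for a
    unfolding I using that W'(2) even_carr[OF Esub[OF that]] by (intro bexI[of _ a] bexI[of _ \<zero>]) auto
  then show "superideal (superideal_of_submodule W) R"
    unfolding superideal_iff using ideal part(1) by blast
  show "superideal_of_submodule W \<inter> odd_part R = W"
  proof
    show "superideal_of_submodule W \<inter> odd_part R \<subseteq> W"
    proof
      fix b assume b: "b \<in> superideal_of_submodule W \<inter> odd_part R"
      then have "\<zero> \<oplus> b \<in> superideal_of_submodule W" using odd_carr by simp
      then show "b \<in> W" using part(2)[of \<zero> b] b by simp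
    qed
    show "W \<subseteq> superideal_of_submodule W \<inter> odd_part R"
    proof
      fix w assume w: "w \<in> W"
      have "\<zero> \<in> E" using W'(2) odd_carr by (simp add: E_def)
      moreover have "w = \<zero> \<oplus> w" using odd_carr[OF Wsub[OF w]] by simp
      ultimately show "w \<in> superideal_of_submodule W \<inter> odd_part R" unfolding Int_iff I
        using w Wsub by blast
    qed
  qed
qed

lemma odd_submodule_acc:
  assumes "noetherian_superring R" "\<And>n. odd_submodule (W n) \<and> W n \<subseteq> W (Suc n)"
  shows "\<exists>n. \<forall>m\<ge>n. W m = W n"
proof -
  have "superideal_of_submodule (W n) \<subseteq> superideal_of_submodule (W (Suc n))" for n
    using assms(2)[of n] unfolding superideal_of_submodule_def by blast
  moreover have "superideal (superideal_of_submodule (W n)) R" for n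
    using superideal_of_submodule_superideal(1) assms(2) by blast
  ultimately obtain n where "\<forall>m\<ge>n. superideal_of_submodule (W m) = superideal_of_submodule (W n)"
    using assms(1) unfolding noetherian_superring_def
    by (elim conjE allE[of _ "\<lambda>n. superideal_of_submodule (W n)"]) auto
  then show ?thesis
    using superideal_of_submodule_superideal(2) assms(2) by metis
qed

lemma odd_submodule_maximal:
  assumes "noetherian_superring R" "X \<subseteq> Collect odd_submodule" "A \<in> X"
  obtains M where "M \<in> X" "\<And>V. \<lbrakk>V \<in> X; M \<subseteq> V\<rbrakk> \<Longrightarrow> V = M"
proof -
  have "\<exists>n. \<forall>m\<ge>n. W m = W n" if "\<And>n. W n \<in> X \<and> W n \<subseteq> W (Suc n)" for W :: "nat \<Rightarrow> 'a set"
    using odd_submodule_acc[OF assms(1), of W] that assms(2) by blast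
  from maximal_element_of_acc[OF this assms(3)] show thesis using that by metis
qed

text \<open>A maximal finitely generated submodule absorbs every odd element.\<close>

lemma odd_part_finitely_generated:
  assumes "noetherian_superring R"
  obtains B where "finite B" "B \<subseteq> odd_part R" "odd_span B = odd_part R"
proof -
  define X where "X = odd_span ` {B. finite B \<and> B \<subseteq> odd_part R}"
  have "X \<subseteq> Collect odd_submodule" using odd_span_submodule by (auto simp: X_def)
  moreover have "odd_span {} \<in> X" by (auto simp: X_def)
  ultimately obtain M where M: "M \<in> X" "\<And>V. \<lbrakk>V \<in> X; M \<subseteq> V\<rbrakk> \<Longrightarrow> V = M"
    using odd_submodule_maximal[OF assms] by metis
  obtain B where B: "finite B" "B \<subseteq> odd_part R" "M = odd_span B" using M(1) by (auto simp: X_def)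
  have "x \<in> odd_span B" if x: "x \<in> odd_part R" for x
  proof -
    have sub: "insert x B \<subseteq> odd_part R" using x B by simp
    have "odd_span (insert x B) \<in> X" using sub B(1) unfolding X_def by blast
    moreover have "M \<subseteq> odd_span (insert x B)"
      using odd_span_mono[of B "insert x B"] sub B(3) by blast
    ultimately have "odd_span (insert x B) = M" by (rule M(2))
    then show ?thesis using odd_span_base[OF sub] B(3) by blast
  qed
  then show thesis using that B odd_span_odd by blast
qed

text \<open>Nakayama's lemma for the odd part, proved from the chain condition: modulo a maximal proper
  submodule containing \<open>W\<close> the odd part is generated by one element \<open>x\<close>, and then
  \<open>x = c x\<close> there, with \<open>\<one> \<ominus> c\<close> invertible.\<close>

lemma odd_nakayama:
  assumes "noetherian_superring R" and W: "odd_submodule W"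
    and C: "C \<subseteq> even_part R" "\<zero> \<in> C" "\<And>c d. \<lbrakk>c \<in> C; d \<in> C\<rbrakk> \<Longrightarrow> c \<oplus> d \<in> C"
      "\<And>r c. \<lbrakk>r \<in> even_part R; c \<in> C\<rbrakk> \<Longrightarrow> r \<otimes> c \<in> C"
    and unit: "\<And>c. c \<in> C \<Longrightarrow> \<exists>u\<in>even_part R. u \<otimes> (\<one> \<ominus> c) = \<one>"
    and gen: "\<And>x. x \<in> odd_part R \<Longrightarrow>
      \<exists>w\<in>W. x \<ominus> w \<in> odd_span {c \<otimes> y |c y. c \<in> C \<and> y \<in> odd_part R}"
  shows "W = odd_part R"
proof (rule ccontr)
  assume "W \<noteq> odd_part R"
  define X where "X = {V. odd_submodule V \<and> W \<subseteq> V \<and> V \<noteq> odd_part R}"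
  have "W \<in> X" "X \<subseteq> Collect odd_submodule"
    using W \<open>W \<noteq> odd_part R\<close> by (auto simp: X_def)
  then obtain V where "V \<in> X" and max: "\<And>U. \<lbrakk>U \<in> X; V \<subseteq> U\<rbrakk> \<Longrightarrow> U = V"
    using odd_submodule_maximal[OF assms(1)] by metis
  then have V: "odd_submodule V" "W \<subseteq> V" "V \<noteq> odd_part R" by (auto simp: X_def)
  note V' = odd_submoduleD[OF V(1)]
  obtain x where x: "x \<in> odd_part R" "x \<notin> V" using V V'(1) by blast
  have xc: "x \<in> carrier R" using x by blast
  note U = adjoin_submodule[OF V(1) x(1)]
  then have U_all: "adjoin V x = odd_part R"
    using max[of "adjoin V x"] V(2) x(2) unfolding X_def by blast
  define T where "T = {w \<oplus> c \<otimes> x |w c. w \<in> V \<and> c \<in> C}"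
  have T: "odd_submodule T" unfolding T_def
    by (rule odd_submodule_insert[OF V(1) x(1) C])
  have "{c \<otimes> y |c y. c \<in> C \<and> y \<in> odd_part R} \<subseteq> T"
  proof
    fix z assume "z \<in> {c \<otimes> y |c y. c \<in> C \<and> y \<in> odd_part R}"
    then obtain c y where z: "c \<in> C" "y \<in> odd_part R" "z = c \<otimes> y" by blast
    then obtain v r where y: "v \<in> V" "r \<in> even_part R" "y = v \<oplus> r \<otimes> x"
      using U_all unfolding adjoin_def by blast
    have ce: "c \<in> even_part R" using z C(1) by blast
    have carr: "c \<in> carrier R" "v \<in> carrier R" "r \<in> carrier R" using ce y V'(1) by blast+
    have "z = c \<otimes> v \<oplus> (r \<otimes> c) \<otimes> x"
      unfolding z(3) y(3) using carr xc even_central[OF y(2) carr(1)] by (simp add: r_distr m_assoc)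
    then show "z \<in> T" unfolding T_def using V'(4)[OF ce y(1)] C(4)[OF y(2) z(1)] by blast
  qed
  from odd_span_minimal[OF T this] gen[OF x(1)]
  obtain w where w: "w \<in> W" "x \<ominus> w \<in> T" by blast
  then obtain v c where v: "v \<in> V" "c \<in> C" "x \<ominus> w = v \<oplus> c \<otimes> x" unfolding T_def by blast
  have wV: "w \<in> V" using w(1) V(2) by blast
  have carr: "v \<in> carrier R" "c \<in> carrier R" "w \<in> carrier R" using v wV C(1) V'(1) by blast+
  have "x = (x \<ominus> w) \<oplus> w" using xc carr by algebra
  then have "x \<ominus> c \<otimes> x = ((v \<oplus> c \<otimes> x) \<oplus> w) \<ominus> c \<otimes> x" using v(3) by simp
  also have "\<dots> = v \<oplus> w" using xc carr by algebra
  finally have "(\<one> \<ominus> c) \<otimes> x \<in> V" using V'(3)[OF v(1) wV] xc carr by (simp add: l_distr a_minus_def l_minus)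
  moreover obtain u where u: "u \<in> even_part R" "u \<otimes> (\<one> \<ominus> c) = \<one>" using unit[OF v(2)] by blast
  ultimately have "u \<otimes> ((\<one> \<ominus> c) \<otimes> x) \<in> V" using V'(4) by blast
  then have "x \<in> V" using u xc carr even_carr[OF u(1)] m_assoc[of u "\<one> \<ominus> c" x] by simp
  with x(2) show False by simp
qed

section \<open>Products of many odd elements vanish\<close>

abbreviation mprod :: "'a list \<Rightarrow> 'a"
  where "mprod as \<equiv> foldr (\<otimes>) as \<one>"

lemma mprod_append:
  "\<lbrakk>set as \<subseteq> carrier R; set bs \<subseteq> carrier R\<rbrakk> \<Longrightarrow> mprod (as @ bs) = mprod as \<otimes> mprod bs"
  by (induction as) (auto simp: foldr_mult_closed m_assoc)

text \<open>Only the vanishing of products matters below, so the sign is left undetermined.\<close>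

lemma mprod_odd_swap:
  assumes "b \<in> odd_part R" "set as \<subseteq> odd_part R" "y \<in> carrier R"
  shows "mprod as \<otimes> (b \<otimes> y) \<in> {b \<otimes> (mprod as \<otimes> y), \<ominus> (b \<otimes> (mprod as \<otimes> y))}"
  using assms(2)
proof (induction as)
  case Nil
  then show ?case using assms odd_carr by simp
next
  case (Cons a as)
  have a: "a \<in> odd_part R" "set as \<subseteq> odd_part R" using Cons.prems by auto
  have "set as \<subseteq> carrier R" using a odd_carr by blast
  then have carr: "a \<in> carrier R" "mprod as \<in> carrier R" "b \<in> carrier R" "y \<in> carrier R"
    using a assms odd_carr foldr_mult_closed by auto
  have "a \<otimes> (b \<otimes> (mprod as \<otimes> y)) = \<ominus> (b \<otimes> (a \<otimes> (mprod as \<otimes> y)))"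
  proof -
    have "a \<otimes> (b \<otimes> (mprod as \<otimes> y)) = (a \<otimes> b) \<otimes> (mprod as \<otimes> y)" using carr by (simp add: m_assoc)
    also have "\<dots> = \<ominus> (b \<otimes> (a \<otimes> (mprod as \<otimes> y)))"
      unfolding odd_anticommute[OF a(1) assms(1)] using carr by (simp add: l_minus m_assoc)
    finally show ?thesis .
  qed
  moreover have "mprod as \<otimes> (b \<otimes> y) = b \<otimes> (mprod as \<otimes> y) \<or>
    mprod as \<otimes> (b \<otimes> y) = \<ominus> (b \<otimes> (mprod as \<otimes> y))"
    using Cons.IH[OF a(2)] by simp
  ultimately show ?case using carr by (auto simp: m_assoc r_minus)
qed

text \<open>Adjoining a generator \<open>b\<close> raises the length from which on all products vanish by at most one:
  expanding a product of multiples of \<open>b\<close> plus elements of \<open>W\<close>, every term has two factors \<open>b\<close>, or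
  at least \<open>k + 1\<close> factors from \<open>W\<close>.\<close>

lemma mprod_add_generator:
  assumes W: "odd_submodule W" and b: "b \<in> odd_part R"
    and vanish: "\<And>ws. \<lbrakk>set ws \<subseteq> W; k < length ws\<rbrakk> \<Longrightarrow> mprod ws = \<zero>"
    and as: "set as \<subseteq> adjoin W b" "Suc k < length as"
  shows "mprod as = \<zero>"
proof -
  note W' = odd_submoduleD[OF W]
  let ?V = "adjoin W b"
  note V' = odd_submoduleD[OF adjoin_submodule(1)[OF W b]] and WV = adjoin_submodule(2)[OF W b]
  have bc: "b \<in> carrier R" using b by blast
  have Vc: "set cs \<subseteq> carrier R" if "set cs \<subseteq> ?V" for cs using that V'(1) odd_carr by blast
  \<comment> \<open>Since \<open>b\<close> squares to zero, multiplying by \<open>b\<close> erases the multiples of \<open>b\<close> from all factors.\<close>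
  have erase: "\<exists>ws. set ws \<subseteq> W \<and> length ws = length cs \<and> b \<otimes> mprod cs = b \<otimes> mprod ws"
    if "set cs \<subseteq> ?V" for cs
    using that
  proof (induction cs)
    case Nil
    then show ?case by simp
  next
    case (Cons c cs)
    then obtain ws where ws: "set ws \<subseteq> W" "length ws = length cs" "b \<otimes> mprod cs = b \<otimes> mprod ws"
      by auto
    obtain w r where c: "w \<in> W" "r \<in> even_part R" "c = w \<oplus> r \<otimes> b"
      using Cons.prems unfolding adjoin_def by auto
    have wsc: "set ws \<subseteq> carrier R" using ws(1) W'(1) odd_carr by blast
    have csc: "set cs \<subseteq> carrier R" using Vc Cons.prems by simp
    have carr: "w \<in> carrier R" "r \<in> carrier R" using c W'(1) by blast+
    note pc = foldr_mult_closed[OF csc] and pw = foldr_mult_closed[OF wsc]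
    have "b \<otimes> (r \<otimes> b) = r \<otimes> (b \<otimes> b)"
      using even_central[OF c(2) bc] bc carr by (metis m_assoc)
    then have brb: "b \<otimes> (r \<otimes> b) = \<zero>" using odd_square[OF b] carr by simp
    have wb: "b \<otimes> w = \<ominus> (w \<otimes> b)" using odd_anticommute[OF b] c(1) W'(1) by blast
    have "b \<otimes> c = b \<otimes> w" unfolding c(3) using carr bc brb by (simp add: r_distr)
    then have "b \<otimes> mprod (c # cs) = (b \<otimes> w) \<otimes> mprod cs"
      using bc carr pc c(3) by (simp add: m_assoc[symmetric])
    also have "\<dots> = \<ominus> (w \<otimes> (b \<otimes> mprod cs))"
      unfolding wb using bc carr pc by (simp add: l_minus m_assoc)
    also have "\<dots> = (b \<otimes> w) \<otimes> mprod ws"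
      unfolding ws(3) wb using bc carr pw by (simp add: l_minus m_assoc)
    also have "\<dots> = b \<otimes> mprod (w # ws)" using bc carr pw by (simp add: m_assoc)
    finally have "b \<otimes> mprod (c # cs) = b \<otimes> mprod (w # ws)" .
    moreover have "set (w # ws) \<subseteq> W" "length (w # ws) = length (c # cs)" using c ws by auto
    ultimately show ?case by blast
  qed
  have b_kills: "b \<otimes> mprod cs = \<zero>" if "set cs \<subseteq> ?V" "k < length cs" for cs
    using erase[OF that(1)] vanish that(2) bc by (metis r_null)
  have "mprod (ws @ cs) = \<zero>"
    if "set ws \<subseteq> W" "set cs \<subseteq> ?V" "Suc k < length ws + length cs" for ws cs
    using that
  proof (induction cs arbitrary: ws)
    case Nil
    then show ?case using vanish by simp
  next
    case (Cons c cs)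
    obtain w r where c: "w \<in> W" "r \<in> even_part R" "c = w \<oplus> r \<otimes> b"
      using Cons.prems unfolding adjoin_def by auto
    have wsV: "set ws \<subseteq> ?V" "set cs \<subseteq> ?V" using Cons.prems WV by auto
    have wso: "set ws \<subseteq> odd_part R" using Cons.prems W'(1) by blast
    note wsc = Vc[OF wsV(1)] and csc = Vc[OF wsV(2)]
    have carr: "w \<in> carrier R" "r \<in> carrier R" using c W'(1) by blast+
    note pc = foldr_mult_closed[OF csc] and pw = foldr_mult_closed[OF wsc]
    have "b \<otimes> mprod (ws @ cs) = \<zero>" using b_kills[of "ws @ cs"] wsV Cons.prems(3) by simp
    then have "b \<otimes> (mprod ws \<otimes> mprod cs) = \<zero>" using mprod_append[OF wsc csc] by simp
    with mprod_odd_swap[OF b wso pc] have "mprod ws \<otimes> (b \<otimes> mprod cs) = \<zero>" by auto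
    moreover have "mprod ws \<otimes> (r \<otimes> (b \<otimes> mprod cs)) = r \<otimes> (mprod ws \<otimes> (b \<otimes> mprod cs))"
      using even_central[OF c(2) pw] pw carr bc pc by (metis m_assoc m_closed)
    ultimately have kill: "mprod ws \<otimes> (r \<otimes> (b \<otimes> mprod cs)) = \<zero>" using carr by simp
    have "mprod ((ws @ [w]) @ cs) = \<zero>"
      by (rule Cons.IH) (use Cons.prems c in auto)
    then have "mprod ws \<otimes> (w \<otimes> mprod cs) = \<zero>"
      using mprod_append[of ws "w # cs"] wsc csc carr by simp
    moreover have "mprod (ws @ c # cs) = mprod ws \<otimes> (w \<otimes> mprod cs) \<oplus> mprod ws \<otimes> (r \<otimes> (b \<otimes> mprod cs))"
      using mprod_append[of ws "c # cs"] wsc csc carr bc pc pw c(3)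
      by (simp add: l_distr r_distr m_assoc)
    ultimately show ?case using kill by simp
  qed
  from this[of "[]" as] show ?thesis using as by simp
qed

lemma mprod_vanishes:
  assumes "finite B" "B \<subseteq> odd_part R" "set as \<subseteq> odd_span B" "card B < length as"
  shows "mprod as = \<zero>"
  using assms
proof (induction B arbitrary: as rule: finite_induct)
  case empty
  have "odd_span {} \<subseteq> {\<zero>}" by (rule odd_span_minimal) (auto intro: odd_submoduleI simp: even_carr)
  then obtain as' where "as = \<zero> # as'" "set as' \<subseteq> {\<zero>}"
    using empty by (cases as) auto
  moreover from this(2) have "set as' \<subseteq> carrier R" by auto
  ultimately show ?case using foldr_mult_closed by simp
next
  case (insert b B)
  have B: "B \<subseteq> odd_part R" and b: "b \<in> odd_part R" using insert.prems by auto
  note span = odd_span_submodule[OF B]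
  note V = adjoin_submodule[OF span b]
  have "odd_span (insert b B) \<subseteq> adjoin (odd_span B) b"
    by (rule odd_span_minimal[OF V(1)]) (use V(2,3) odd_span_base[OF B] in blast)
  then show ?case
    using mprod_add_generator[OF span b insert.IH[OF B], where as = as] insert.prems insert.hyps
    by auto
qed

end

section \<open>The cotangent space\<close>

context superring
begin

text \<open>The properties shared by the even and the odd part that make the two pieces of the cotangent
  space vector spaces.\<close>

definition graded_piece :: "'a set \<Rightarrow> bool"
  where "graded_piece X \<longleftrightarrow> X \<subseteq> carrier R \<and> \<zero> \<in> X \<and> (\<forall>x\<in>X. \<forall>y\<in>X. x \<oplus> y \<in> X) \<and>
    (\<forall>x\<in>X. \<ominus> x \<in> X) \<and> (\<forall>r\<in>even_part R. \<forall>x\<in>X. r \<otimes> x \<in> X)"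

lemma graded_piece_parts: "graded_piece (even_part R)" "graded_piece (odd_part R)"
  by (auto simp: graded_piece_def even_even even_odd)

text \<open>Changing \<open>r\<close> by an element of \<open>m\<close> changes \<open>r \<otimes> x\<close> by an element of \<open>m\<^sup>2\<close>, as \<open>x\<close> is in \<open>m\<close>.\<close>

lemma cotangent_smult:
  assumes m: "ideal m R" and r: "r \<in> carrier R" and x: "x \<in> m"
  shows "rcoset_mult R (ideal_prod R m m) (m +> r) (ideal_prod R m m +> x) =
    ideal_prod R m m +> (r \<otimes> x)"
proof -
  let ?m2 = "ideal_prod R m m"
  have m2: "ideal ?m2 R" by (rule ideal_prod_is_ideal[OF m m])
  note M = ideal_closed[OF m] and M2 = ideal_closed[OF m2]
  have xc: "x \<in> carrier R" using x M(1) by blast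
  have mem: "a \<in> carrier R \<and> a \<ominus> b \<in> I" if I: "ideal I R" "b \<in> carrier R" "a \<in> I +> b" for I a b
  proof -
    obtain i where i: "i \<in> I" "a = i \<oplus> b" using I(3) by (auto simp: a_r_coset_def')
    then have "i \<in> carrier R" using ideal_closed(1)[OF I(1)] by blast
    moreover from this i I(2) have "a \<ominus> b = i" by (simp only: i(2)) algebra
    ultimately show ?thesis using i I(2) by simp
  qed
  have eq: "?m2 +> (a \<otimes> b) = ?m2 +> (r \<otimes> x)" if ab: "a \<in> m +> r" "b \<in> ?m2 +> x" for a b
  proof -
    have a: "a \<in> carrier R" "a \<ominus> r \<in> m" using mem[OF m r ab(1)] by auto
    have b: "b \<in> carrier R" "b \<ominus> x \<in> ?m2" using mem[OF m2 xc ab(2)] by auto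
    have "a \<otimes> b \<ominus> r \<otimes> x = a \<otimes> (b \<ominus> x) \<oplus> (a \<ominus> r) \<otimes> x"
      using a(1) b(1) r xc by algebra
    also have "\<dots> \<in> ?m2"
      using M2(3)[OF M2(5)[OF a(1) b(2)] ideal_prod.prod[OF a(2) x]] .
    finally show ?thesis using coset_eq_iff[OF m2] a(1) b(1) r xc by simp
  qed
  have self: "r \<in> m +> r" "x \<in> ?m2 +> x"
    using M(2) M2(2) r xc by (auto simp: a_r_coset_def' intro!: bexI[of _ \<zero>])
  have "rcoset_mult R ?m2 (m +> r) (?m2 +> x) = (\<Union>a\<in>m +> r. \<Union>b\<in>?m2 +> x. ?m2 +> (r \<otimes> x))"
    unfolding rcoset_mult_def using eq by simp
  also have "\<dots> = ?m2 +> (r \<otimes> x)" using self by blast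
  finally show ?thesis .
qed

lemma super_maximalD:
  assumes "super_maximal m R"
  shows "super_prime m R" "ideal m R" "odd_part R \<subseteq> m"
proof -
  show "super_prime m R" using assms super_maximal_iff by blast
  then show "ideal m R" "odd_part R \<subseteq> m" using super_primeD by blast+
qed

context
  fixes m X
  assumes m: "super_maximal m R" and X: "graded_piece X"
begin

private abbreviation "m2 \<equiv> ideal_prod R m m"
private abbreviation "V \<equiv> cotangent_part R m X"

lemma cotangent_carrier: "carrier V = (\<lambda>x. m2 +> x) ` (m \<inter> X)"
  by (simp add: cotangent_part_def Let_def)

lemma m2_ideal: "ideal m2 R"
  using ideal_prod_is_ideal super_maximalD(2)[OF m] by blast

lemma graded_pieceD:
  "X \<subseteq> carrier R" "\<zero> \<in> X" "\<lbrakk>x \<in> X; y \<in> X\<rbrakk> \<Longrightarrow> x \<oplus> y \<in> X" "x \<in> X \<Longrightarrow> \<ominus> x \<in> X"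
  "\<lbrakk>r \<in> even_part R; x \<in> X\<rbrakk> \<Longrightarrow> r \<otimes> x \<in> X"
  using X by (auto simp: graded_piece_def)

lemma cotangent_ops:
  "\<lbrakk>x \<in> carrier R; y \<in> carrier R\<rbrakk> \<Longrightarrow> (m2 +> x) \<oplus>\<^bsub>V\<^esub> (m2 +> y) = m2 +> (x \<oplus> y)"
  "\<lbrakk>r \<in> carrier R; x \<in> m\<rbrakk> \<Longrightarrow> (m +> r) \<odot>\<^bsub>V\<^esub> (m2 +> x) = m2 +> (r \<otimes> x)"
  "\<zero>\<^bsub>V\<^esub> = m2 +> \<zero>"
proof -
  interpret I: ideal m2 R by (rule m2_ideal)
  show "(m2 +> x) \<oplus>\<^bsub>V\<^esub> (m2 +> y) = m2 +> (x \<oplus> y)" if "x \<in> carrier R" "y \<in> carrier R"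
    using I.a_rcos_sum[OF that] by (simp add: cotangent_part_def Let_def)
  show "(m +> r) \<odot>\<^bsub>V\<^esub> (m2 +> x) = m2 +> (r \<otimes> x)" if "r \<in> carrier R" "x \<in> m"
    using cotangent_smult[OF super_maximalD(2)[OF m] that] by (simp add: cotangent_part_def Let_def)
  show "\<zero>\<^bsub>V\<^esub> = m2 +> \<zero>"
    using coset_zero_iff[OF m2_ideal zero_closed] ideal_closed(2)[OF m2_ideal]
    by (simp add: cotangent_part_def Let_def)
qed

text \<open>Scalars have even representatives because \<open>m\<close> contains the odd part; with these the action
  preserves parity.\<close>

lemma residue_field_carrier: "carrier (R Quot m) = (\<lambda>r. m +> r) ` even_part R"
proof -
  have "carrier (R Quot m) = (\<lambda>r. m +> r) ` carrier R"
    using quotient_ops(1)[OF super_maximalD(2)[OF m]] .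
  moreover
  have "m +> r \<in> (\<lambda>r. m +> r) ` even_part R" if r: "r \<in> carrier R" for r
  proof -
    obtain a b where ab: "a \<in> even_part R" "b \<in> odd_part R" "r = a \<oplus> b"
      using graded_decomposition[OF r] .
    have "a \<in> carrier R" "b \<in> carrier R" using ab by auto
    then have "r \<ominus> a = b" using ab(3) by (simp only:) algebra
    then have "m +> r = m +> a"
      using coset_eq_iff[OF super_maximalD(2)[OF m] r even_carr[OF ab(1)]]
        super_maximalD(3)[OF m] ab(2) by auto
    then show ?thesis using ab(1) by blast
  qed
  then have "(\<lambda>r. m +> r) ` carrier R \<subseteq> (\<lambda>r. m +> r) ` even_part R" by (rule image_subsetI)
  moreover have "(\<lambda>r. m +> r) ` even_part R \<subseteq> (\<lambda>r. m +> r) ` carrier R"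
    by (rule image_mono) (rule subsetI, rule even_carr)
  ultimately show ?thesis by simp
qed

lemma cotangent_vectorspace: "vectorspace (R Quot m) V"
proof -
  note M = ideal_closed[OF super_maximalD(2)[OF m]]
  note ops = quotient_ops(3-5)[OF super_maximalD(2)[OF m]]
  have field: "field (R Quot m)" using m by (simp add: super_maximal_def)
  have K: "\<exists>a\<in>even_part R. a \<in> carrier R \<and> A = m +> a" if "A \<in> carrier (R Quot m)" for A
    using that even_carr unfolding residue_field_carrier by blast
  have Vrep: "\<exists>x. x \<in> m \<and> x \<in> X \<and> x \<in> carrier R \<and> v = m2 +> x" if "v \<in> carrier V" for v
    using that graded_pieceD(1) unfolding cotangent_carrier by blast
  have Vmem: "m2 +> x \<in> carrier V" if "x \<in> m" "x \<in> X" for x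
    using that unfolding cotangent_carrier by blast
  have mult_m: "a \<otimes> x \<in> m" if "a \<in> carrier R" "x \<in> m" for a x using M(5) that .
  have "module (R Quot m) V"
  proof (rule moduleI)
    show "cring (R Quot m)" using field by (simp add: field_def domain_def)
    show "abelian_group V"
    proof (rule abelian_groupI)
      fix u v assume "u \<in> carrier V" "v \<in> carrier V"
      then obtain x y where x: "x \<in> m" "x \<in> X" "x \<in> carrier R" "u = m2 +> x"
        and y: "y \<in> m" "y \<in> X" "y \<in> carrier R" "v = m2 +> y" using Vrep by meson
      then show "u \<oplus>\<^bsub>V\<^esub> v \<in> carrier V" using Vmem M(3) graded_pieceD(3) by (simp add: cotangent_ops)
      show "u \<oplus>\<^bsub>V\<^esub> v = v \<oplus>\<^bsub>V\<^esub> u" using x y by (simp add: cotangent_ops a_comm)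
      fix w assume "w \<in> carrier V"
      then obtain z where "z \<in> carrier R" "w = m2 +> z" using Vrep by meson
      then show "u \<oplus>\<^bsub>V\<^esub> v \<oplus>\<^bsub>V\<^esub> w = u \<oplus>\<^bsub>V\<^esub> (v \<oplus>\<^bsub>V\<^esub> w)"
        using x y by (simp add: cotangent_ops a_assoc)
    next
      show "\<zero>\<^bsub>V\<^esub> \<in> carrier V" using Vmem M(2) graded_pieceD(2) by (simp add: cotangent_ops)
      fix u assume "u \<in> carrier V"
      then obtain x where x: "x \<in> m" "x \<in> X" "x \<in> carrier R" "u = m2 +> x" using Vrep by meson
      then show "\<zero>\<^bsub>V\<^esub> \<oplus>\<^bsub>V\<^esub> u = u" by (simp add: cotangent_ops)
      have "\<ominus> x = \<zero> \<ominus> x" using x by (simp add: a_minus_def)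
      then have "\<ominus> x \<in> m" using M(4)[OF M(2) x(1)] by simp
      then have "m2 +> (\<ominus> x) \<in> carrier V" using Vmem graded_pieceD(4) x by blast
      moreover have "(m2 +> (\<ominus> x)) \<oplus>\<^bsub>V\<^esub> u = \<zero>\<^bsub>V\<^esub>" using x by (simp add: cotangent_ops l_neg)
      ultimately show "\<exists>y\<in>carrier V. y \<oplus>\<^bsub>V\<^esub> u = \<zero>\<^bsub>V\<^esub>" by blast
    qed
  next
    fix A u assume "A \<in> carrier (R Quot m)" "u \<in> carrier V"
    then obtain a x where a: "a \<in> even_part R" "a \<in> carrier R" "A = m +> a"
      and x: "x \<in> m" "x \<in> X" "x \<in> carrier R" "u = m2 +> x" using K Vrep by meson
    then show "A \<odot>\<^bsub>V\<^esub> u \<in> carrier V"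
      using Vmem mult_m graded_pieceD(5) by (simp add: cotangent_ops)
    {
      fix B assume "B \<in> carrier (R Quot m)"
      then obtain b where b: "b \<in> carrier R" "B = m +> b" using K by meson
      show "(A \<oplus>\<^bsub>R Quot m\<^esub> B) \<odot>\<^bsub>V\<^esub> u = A \<odot>\<^bsub>V\<^esub> u \<oplus>\<^bsub>V\<^esub> B \<odot>\<^bsub>V\<^esub> u"
        "(A \<otimes>\<^bsub>R Quot m\<^esub> B) \<odot>\<^bsub>V\<^esub> u = A \<odot>\<^bsub>V\<^esub> (B \<odot>\<^bsub>V\<^esub> u)"
        using a(2,3) b x mult_m
        by (simp_all add: cotangent_ops ops l_distr m_assoc)
    next
      fix v assume "v \<in> carrier V"
      then obtain y where "y \<in> m" "y \<in> carrier R" "v = m2 +> y" using Vrep by meson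
      then show "A \<odot>\<^bsub>V\<^esub> (u \<oplus>\<^bsub>V\<^esub> v) = A \<odot>\<^bsub>V\<^esub> u \<oplus>\<^bsub>V\<^esub> A \<odot>\<^bsub>V\<^esub> v"
        using a x M(3) by (simp add: cotangent_ops r_distr)
    }
  next
    fix u assume "u \<in> carrier V"
    then obtain x where "x \<in> m" "x \<in> carrier R" "u = m2 +> x" using Vrep by meson
    then show "\<one>\<^bsub>R Quot m\<^esub> \<odot>\<^bsub>V\<^esub> u = u" by (simp add: cotangent_ops ops)
  qed
  then show ?thesis using field by (simp add: vectorspace_def)
qed

end

lemma cotangent_dim_zero:
  assumes m: "super_maximal m R" and X: "graded_piece X" and sub: "m \<inter> X \<subseteq> ideal_prod R m m"
  shows "vectorspace.dim (R Quot m) (cotangent_part R m X) = 0"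
proof -
  interpret V: vectorspace "R Quot m" "cotangent_part R m X"
    by (rule cotangent_vectorspace[OF m X])
  note m2 = m2_ideal[OF m X]
  have "carrier (cotangent_part R m X) \<subseteq> {\<zero>\<^bsub>cotangent_part R m X\<^esub>}"
  proof
    fix v assume "v \<in> carrier (cotangent_part R m X)"
    then obtain x where x: "x \<in> m" "x \<in> X" "v = ideal_prod R m m +> x"
      unfolding cotangent_carrier[OF m X] by blast
    then have "x \<in> ideal_prod R m m" "x \<in> carrier R"
      using sub graded_pieceD(1)[OF m X] by blast+
    then have "v = ideal_prod R m m" using x(3) coset_zero_iff[OF m2] by blast
    then show "v \<in> {\<zero>\<^bsub>cotangent_part R m X\<^esub>}" by (simp add: cotangent_part_def Let_def)
  qed
  moreover have "submodule (R Quot m) (V.span {}) (cotangent_part R m X)"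
    by (rule V.span_is_submodule) simp
  then have "\<zero>\<^bsub>cotangent_part R m X\<^esub> \<in> V.span {}" by (rule submodule.zero_closed)
  moreover have "V.span {} \<subseteq> carrier (cotangent_part R m X)" by (rule V.span_is_subset2) simp
  ultimately have "V.gen_set {}" by blast
  then have "V.dim \<le> 0" unfolding V.dim_def by (intro Least_le) (rule exI[of _ "{}"], simp)
  then show ?thesis by simp
qed

text \<open>Up to even terms, a product of two elements of \<open>m\<close> is a sum of products of an even element
  of \<open>m\<close> and an odd element.\<close>

lemma odd_part_of_square:
  assumes m: "ideal m R" "odd_part R \<subseteq> m" and x: "x \<in> ideal_prod R m m" "x \<in> odd_part R"
  shows "x \<in> odd_span {c \<otimes> y |c y. c \<in> m \<inter> even_part R \<and> y \<in> odd_part R}" (is "x \<in> odd_span ?G")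
proof -
  note M = ideal_closed[OF m(1)]
  have G: "?G \<subseteq> odd_part R" using even_odd by blast
  note K = odd_submoduleD[OF odd_span_submodule[OF G]]
  have "\<exists>e\<in>even_part R. \<exists>k\<in>odd_span ?G. z = e \<oplus> k" if "z \<in> ideal_prod R m m" for z
    using that
  proof induction
    case (prod i j)
    have ic: "i \<in> carrier R" and jc: "j \<in> carrier R" using prod M(1) by auto
    obtain a b where i: "a \<in> even_part R" "b \<in> odd_part R" "i = a \<oplus> b"
      using graded_decomposition[OF ic] .
    obtain c d where j: "c \<in> even_part R" "d \<in> odd_part R" "j = c \<oplus> d"
      using graded_decomposition[OF jc] .
    have carr: "a \<in> carrier R" "b \<in> carrier R" "c \<in> carrier R" "d \<in> carrier R" using i j by auto
    have "i \<ominus> b = a" unfolding i(3) using carr by algebra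
    moreover have "j \<ominus> d = c" unfolding j(3) using carr by algebra
    ultimately have "a \<in> m" "c \<in> m" using M(4)[OF prod(1)] M(4)[OF prod(2)] m(2) i(2) j(2) by blast+
    then have "a \<otimes> d \<in> ?G" "c \<otimes> b \<in> ?G" using i j by blast+
    then have "a \<otimes> d \<oplus> c \<otimes> b \<in> odd_span ?G" using K(3) odd_span_base[OF G] by blast
    moreover have "a \<otimes> c \<oplus> b \<otimes> d \<in> even_part R" using i j even_even odd_odd by simp
    moreover have "i \<otimes> j = (a \<otimes> c \<oplus> b \<otimes> d) \<oplus> (a \<otimes> d \<oplus> c \<otimes> b)"
    proof -
      have "i \<otimes> j = (a \<otimes> c \<oplus> b \<otimes> d) \<oplus> (a \<otimes> d \<oplus> b \<otimes> c)"
        unfolding i(3) j(3) using carr by algebra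
      then show ?thesis using even_central[OF j(1) carr(2)] by simp
    qed
    ultimately show ?case by blast
  next
    case (sum s t)
    obtain e k where s: "e \<in> even_part R" "k \<in> odd_span ?G" "s = e \<oplus> k"
      using sum.IH(1) by blast
    obtain f l where t: "f \<in> even_part R" "l \<in> odd_span ?G" "t = f \<oplus> l"
      using sum.IH(2) by blast
    have "k \<in> carrier R" "l \<in> carrier R" using s(2) t(2) K(1) odd_carr by blast+
    then have "s \<oplus> t = (e \<oplus> f) \<oplus> (k \<oplus> l)"
      unfolding s(3) t(3) using even_carr[OF s(1)] even_carr[OF t(1)] by (simp add: a_ac)
    then show ?case using even_closed(2)[OF s(1) t(1)] K(3)[OF s(2) t(2)] by blast
  qed
  then obtain e k where e: "e \<in> even_part R" "k \<in> odd_span ?G" "x = e \<oplus> k" using x(1) by blast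
  have "\<zero> \<oplus> x = e \<oplus> k" using e(3) odd_carr[OF x(2)] by simp
  then have "x = k" using graded_decomposition_unique(2)[of \<zero> e x k] e K(1) x(2) by auto
  then show ?thesis using e(2) by simp
qed

lemma cotangent_odd_span:
  assumes m: "super_maximal m R" and B: "B \<subseteq> odd_part R" "odd_span B = odd_part R"
  shows "LinearCombinations.module.span (R Quot m) (cotangent_part R m (odd_part R))
      ((\<lambda>x. ideal_prod R m m +> x) ` B) = carrier (cotangent_part R m (odd_part R))"
    and "(\<lambda>x. ideal_prod R m m +> x) ` B \<subseteq> carrier (cotangent_part R m (odd_part R))"
proof -
  let ?V = "cotangent_part R m (odd_part R)" and ?p = "\<lambda>x. ideal_prod R m m +> x"
  note X = graded_piece_parts(2)
  interpret V: vectorspace "R Quot m" ?V by (rule cotangent_vectorspace[OF m X])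
  note M = super_maximalD[OF m]
  have carr: "carrier ?V = ?p ` odd_part R"
    unfolding cotangent_carrier[OF m X] using M(3) by (simp add: Int_absorb1)
  have sub: "?p ` B \<subseteq> carrier ?V" unfolding carr using B(1) by blast
  then show "?p ` B \<subseteq> carrier ?V" .
  have span: "submodule (R Quot m) (V.span (?p ` B)) ?V" by (rule V.span_is_submodule[OF sub])
  interpret S: submodule "R Quot m" "V.span (?p ` B)" ?V by (rule span)
  define W where "W = {x \<in> odd_part R. ?p x \<in> V.span (?p ` B)}"
  have "odd_submodule W"
  proof (rule odd_submoduleI)
    show "W \<subseteq> odd_part R" by (auto simp: W_def)
    show "\<zero> \<in> W" using S.zero_closed by (simp add: W_def cotangent_ops(3)[OF m X])
    show "x \<oplus> y \<in> W" if "x \<in> W" "y \<in> W" for x y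
      using that S.m_closed[of "?p x" "?p y"] cotangent_ops(1)[OF m X, of x y]
      by (simp add: W_def odd_carr)
    show "r \<otimes> x \<in> W" if r: "r \<in> even_part R" and x: "x \<in> W" for r x
    proof -
      have xo: "x \<in> odd_part R" "x \<in> m" using x M(3) by (auto simp: W_def)
      have "m +> r \<in> carrier (R Quot m)" using r residue_field_carrier[OF m X] by blast
      then have "?p (r \<otimes> x) \<in> V.span (?p ` B)"
        using S.smult_closed[of "m +> r" "?p x"] x cotangent_ops(2)[OF m X even_carr[OF r] xo(2)]
        by (simp add: W_def)
      then show ?thesis using even_odd[OF r xo(1)] by (simp add: W_def)
    qed
  qed
  moreover have "B \<subseteq> W" using B(1) V.in_own_span[OF sub] by (auto simp: W_def)
  ultimately have "odd_part R \<subseteq> W" using odd_span_minimal B(2) by metis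
  then have "carrier ?V \<subseteq> V.span (?p ` B)" unfolding carr by (auto simp: W_def)
  then show "V.span (?p ` B) = carrier ?V" using V.span_is_subset2[OF sub] by blast
qed

lemma cotangent_odd_dim_le:
  assumes m: "super_maximal m R" and B: "finite B" "B \<subseteq> odd_part R" "odd_span B = odd_part R"
  shows "vectorspace.dim (R Quot m) (cotangent_part R m (odd_part R)) \<le> card B"
proof -
  let ?V = "cotangent_part R m (odd_part R)" and ?p = "\<lambda>x. ideal_prod R m m +> x"
  interpret V: vectorspace "R Quot m" ?V by (rule cotangent_vectorspace[OF m graded_piece_parts(2)])
  have "V.dim \<le> card (?p ` B)" unfolding V.dim_def
    using B(1) cotangent_odd_span[OF m B(2,3)] by (intro Least_le) blast
  also have "\<dots> \<le> card B" by (rule card_image_le[OF B(1)])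
  finally show ?thesis .
qed

text \<open>Lifts of a generating set of the odd cotangent space generate the odd part up to products of even
  elements of \<open>m\<close> with odd elements, hence generate it by Nakayama's lemma.\<close>

lemma cotangent_odd_generators:
  assumes noeth: "noetherian_superring R" and m: "super_maximal m R"
    and unit: "\<And>c. c \<in> m \<inter> even_part R \<Longrightarrow> \<exists>u\<in>even_part R. u \<otimes> (\<one> \<ominus> c) = \<one>"
  obtains B where "finite B" "B \<subseteq> odd_part R" "odd_span B = odd_part R"
    "card B \<le> vectorspace.dim (R Quot m) (cotangent_part R m (odd_part R))"
proof -
  let ?V = "cotangent_part R m (odd_part R)" and ?p = "\<lambda>x. ideal_prod R m m +> x"
  note X = graded_piece_parts(2)
  interpret V: vectorspace "R Quot m" ?V by (rule cotangent_vectorspace[OF m X])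
  note M = super_maximalD[OF m]
  note MI = ideal_closed[OF M(2)]
  have carr: "carrier ?V = ?p ` odd_part R"
    unfolding cotangent_carrier[OF m X] using M(3) by (simp add: Int_absorb1)
  have gen_image: "odd_part R \<subseteq> {x. \<exists>w\<in>odd_span B. ?p x = ?p w}"
    if B: "B \<subseteq> odd_part R" "V.gen_set (?p ` B)" for B
  proof -
    note S = odd_submoduleD[OF odd_span_submodule[OF B(1)]]
    have "submodule (R Quot m) (?p ` odd_span B) ?V"
    proof (rule submodule.intro)
      show "module (R Quot m) ?V" by (rule V.module_axioms)
      show "?p ` odd_span B \<subseteq> carrier ?V" unfolding carr using S(1) by blast
      show "\<zero>\<^bsub>?V\<^esub> \<in> ?p ` odd_span B" using S(2) by (simp add: cotangent_ops(3)[OF m X])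
      fix u assume "u \<in> ?p ` odd_span B"
      then obtain x where x: "x \<in> odd_span B" "u = ?p x" by blast
      have xo: "x \<in> odd_part R" "x \<in> m" using x S(1) M(3) by auto
      {
        fix v assume "v \<in> ?p ` odd_span B"
        then obtain y where y: "y \<in> odd_span B" "v = ?p y" by blast
        then have "y \<in> carrier R" using S(1) odd_carr by blast
        then have "u \<oplus>\<^bsub>?V\<^esub> v = ?p (x \<oplus> y)"
          using x(2) y(2) cotangent_ops(1)[OF m X odd_carr[OF xo(1)]] by simp
        then show "u \<oplus>\<^bsub>?V\<^esub> v \<in> ?p ` odd_span B" using S(3)[OF x(1) y(1)] by simp
      next
        fix c assume "c \<in> carrier (R Quot m)"
        then obtain r where r: "r \<in> even_part R" "c = m +> r"
          unfolding residue_field_carrier[OF m X] by blast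
        then have "c \<odot>\<^bsub>?V\<^esub> u = ?p (r \<otimes> x)"
          using x(2) cotangent_ops(2)[OF m X even_carr[OF r(1)] xo(2)] by simp
        then show "c \<odot>\<^bsub>?V\<^esub> u \<in> ?p ` odd_span B" using S(4)[OF r(1) x(1)] by simp
      }
    qed
    from V.span_is_subset[OF _ this, of "?p ` B"] odd_span_base[OF B(1)]
    have "carrier ?V \<subseteq> ?p ` odd_span B" using B(2) by blast
    then show ?thesis unfolding carr by blast
  qed
  obtain F where F: "finite F" "F \<subseteq> odd_part R" "odd_span F = odd_part R"
    using odd_part_finitely_generated[OF noeth] .
  \<comment> \<open>Finite generation makes the set over which the dimension is a minimum non-empty.\<close>
  have "\<exists>A. finite A \<and> card A = V.dim \<and> A \<subseteq> carrier ?V \<and> V.gen_set A"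
  proof -
    have "\<exists>n A. finite A \<and> card A = n \<and> A \<subseteq> carrier ?V \<and> V.gen_set A"
      using F(1) cotangent_odd_span[OF m F(2,3)] by blast
    then show ?thesis unfolding V.dim_def by (rule LeastI_ex)
  qed
  then obtain A where A: "finite A" "card A = V.dim" "A \<subseteq> carrier ?V" "V.gen_set A" by blast
  then obtain B where B: "B \<subseteq> odd_part R" "finite B" "A = ?p ` B" "card B \<le> card A"
    using finite_subset_image[OF A(1), of ?p "odd_part R"] A(3) unfolding carr
    by (metis card_image order_refl subset_image_inj finite_imageD)
  have "odd_span B = odd_part R"
  proof (rule odd_nakayama[OF noeth odd_span_submodule[OF B(1)], where C = "m \<inter> even_part R"])
    show "m \<inter> even_part R \<subseteq> even_part R" by blast
    show "\<zero> \<in> m \<inter> even_part R" using MI(2) by simp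
    show "c \<oplus> d \<in> m \<inter> even_part R" if "c \<in> m \<inter> even_part R" "d \<in> m \<inter> even_part R" for c d
      using that MI(3) by simp
    show "r \<otimes> c \<in> m \<inter> even_part R" if "r \<in> even_part R" "c \<in> m \<inter> even_part R" for r c
      using that MI(5) even_even even_carr by simp
    show "\<exists>u\<in>even_part R. u \<otimes> (\<one> \<ominus> c) = \<one>" if "c \<in> m \<inter> even_part R" for c using unit that .
    fix x assume x: "x \<in> odd_part R"
    then obtain w where w: "w \<in> odd_span B" "?p x = ?p w"
      using gen_image[OF B(1)] A(4) B(3) by blast
    have wo: "w \<in> odd_part R" using w(1) odd_span_odd[OF B(1)] by blast
    have "x \<ominus> w \<in> ideal_prod R m m"
      using coset_eq_iff[OF m2_ideal[OF m X] odd_carr[OF x] odd_carr[OF wo]] w(2) by simp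
    then have "x \<ominus> w \<in> odd_span {c \<otimes> y |c y. c \<in> m \<inter> even_part R \<and> y \<in> odd_part R}"
      using odd_part_of_square[OF M(2,3)] x wo by blast
    then show "\<exists>w\<in>odd_span B. x \<ominus> w \<in> odd_span {c \<otimes> y |c y. c \<in> m \<inter> even_part R \<and> y \<in> odd_part R}"
      using w(1) by blast
  qed
  then show thesis using that B A(2) by simp
qed

end

section \<open>Odd generators and odd parameters\<close>

context superring
begin

text \<open>More odd elements than generators have product zero, which \<open>\<one>\<close> annihilates.\<close>

lemma odd_parameters_length_le:
  assumes dim: "Kdim (even_ring R) = ereal (real d)"
    and L: "super_prime L R" "\<And>P. super_prime P R \<Longrightarrow> L \<subseteq> P"
    and B: "finite B" "B \<subseteq> odd_part R" "odd_span B = odd_part R"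
    and as: "odd_parameters R as"
  shows "length as \<le> card B"
proof (rule ccontr)
  have params: "set as \<subseteq> odd_part R" "\<And>r. \<lbrakk>r \<in> even_part R; r \<otimes> mprod as = \<zero>\<rbrakk> \<Longrightarrow> r \<in> L"
    using as odd_parameters_iff[OF dim L, of as] by blast+
  assume "\<not> length as \<le> card B"
  then have "mprod as = \<zero>" using mprod_vanishes[OF B(1,2)] params(1) B(3) by simp
  then have "\<one> \<in> L" using params(2)[of \<one>] by simp
  then show False using super_primeD(2)[OF L(1)] by simp
qed

text \<open>The empty list is a system of odd parameters and lengths are bounded, so the greatest length is
  attained; it is at most the number of generators.\<close>

lemma Ksdim_odd_le_cotangent:
  assumes "noetherian_superring R" and "super_maximal m R"
    and "\<And>c. c \<in> m \<inter> even_part R \<Longrightarrow> \<exists>u\<in>even_part R. u \<otimes> (\<one> \<ominus> c) = \<one>"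
    and dim: "Kdim (even_ring R) = ereal (real d)"
    and L: "super_prime L R" "\<And>P. super_prime P R \<Longrightarrow> L \<subseteq> P"
  shows "snd (Ksdim R) \<le> vectorspace.dim (R Quot m) (cotangent_part R m (odd_part R))"
proof -
  obtain B where B: "finite B" "B \<subseteq> odd_part R" "odd_span B = odd_part R"
    "card B \<le> vectorspace.dim (R Quot m) (cotangent_part R m (odd_part R))"
    using cotangent_odd_generators[OF assms(1-3)] .
  let ?P = "\<lambda>n. \<exists>as. length as = n \<and> odd_parameters R as"
  have bound: "n \<le> card B" if "?P n" for n
    using that odd_parameters_length_le[OF dim L B(1-3)] by blast
  have "\<zero> \<in> L" using ideal_closed(2)[OF super_primeD(1)[OF L(1)]] .
  then have "odd_parameters R []" using odd_parameters_iff[OF dim L, of "[]"] even_carr by simp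
  then have "?P 0" by simp
  from GreatestI_nat[of ?P, OF this bound] have "?P (GREATEST n. ?P n)" .
  from bound[OF this] B(4) show ?thesis by (simp add: Ksdim_def)
qed

text \<open>The even elements of the square of \<open>m\<close> together with all odd elements form an ideal, so an
  ideal generated by odd elements has all its even elements in that square.\<close>

lemma even_square_ideal:
  assumes m: "ideal m R" "odd_part R \<subseteq> m"
  shows "ideal {t \<oplus> y |t y. t \<in> ideal_prod R m m \<inter> even_part R \<and> y \<in> odd_part R} R"
proof -
  let ?m2 = "ideal_prod R m m"
  let ?T = "{t \<oplus> y |t y. t \<in> ?m2 \<inter> even_part R \<and> y \<in> odd_part R}"
  note M2 = ideal_closed[OF ideal_prod_is_ideal[OF m(1) m(1)]]
  have TI: "t \<oplus> y \<in> ?T" if "t \<in> ?m2" "t \<in> even_part R" "y \<in> odd_part R" for t y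
    using that by blast
  have odd_prod: "a \<otimes> b \<in> ?m2" if "a \<in> odd_part R" "b \<in> odd_part R" for a b
    using ideal_prod.prod that m(2) by (metis subsetD)
  show ?thesis
  proof (rule ideal_of_graded_closed)
    show "?T \<subseteq> carrier R" using even_carr odd_carr a_closed by auto
    show "\<zero> \<in> ?T" using TI[of \<zero> \<zero>] M2(2) by simp
    fix x assume "x \<in> ?T"
    then obtain t y where x: "t \<in> ?m2" "t \<in> even_part R" "y \<in> odd_part R" "x = t \<oplus> y" by blast
    note c = even_carr[OF x(2)] odd_carr[OF x(3)]
    {
      fix z assume "z \<in> ?T"
      then obtain s w where z: "s \<in> ?m2" "s \<in> even_part R" "w \<in> odd_part R" "z = s \<oplus> w" by blast
      have "x \<oplus> z = (t \<oplus> s) \<oplus> (y \<oplus> w)"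
        unfolding x(4) z(4) using c even_carr[OF z(2)] odd_carr[OF z(3)] by (simp add: a_ac)
      then show "x \<oplus> z \<in> ?T" using TI[of "t \<oplus> s" "y \<oplus> w"] M2(3) x z by simp
    next
      fix r assume r: "r \<in> even_part R"
      have "r \<otimes> x = r \<otimes> t \<oplus> r \<otimes> y" unfolding x(4) using c even_carr[OF r] by (simp add: r_distr)
      then show "r \<otimes> x \<in> ?T"
        using TI[of "r \<otimes> t" "r \<otimes> y"] M2(5)[OF even_carr[OF r] x(1)] even_even[OF r x(2)]
          even_odd[OF r x(3)] by simp
    next
      fix r assume r: "r \<in> odd_part R"
      have "r \<otimes> x = r \<otimes> y \<oplus> r \<otimes> t" "x \<otimes> r = y \<otimes> r \<oplus> t \<otimes> r"
        unfolding x(4) using c odd_carr[OF r] by (simp_all add: r_distr l_distr a_comm)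
      then show "r \<otimes> x \<in> ?T" "x \<otimes> r \<in> ?T"
        using TI[of "r \<otimes> y" "r \<otimes> t"] TI[of "y \<otimes> r" "t \<otimes> r"] odd_prod[OF r x(3)] odd_prod[OF x(3) r]
          odd_odd[OF r x(3)] odd_odd[OF x(3) r] odd_even[OF r x(2)] even_odd[OF x(2) r] by simp_all
    }
  qed
qed

text \<open>An ideal containing the odd part is automatically graded, so the chain condition on superideals
  applies to the ideals that contain the odd part.\<close>

lemma super_maximal_exists:
  assumes noeth: "noetherian_superring R" and A: "super_prime A R"
  obtains Q where "super_maximal Q R"
proof -
  define X where "X = {I. ideal I R \<and> odd_part R \<subseteq> I \<and> \<one> \<notin> I}"
  have graded: "superideal I R" if I: "ideal I R" "odd_part R \<subseteq> I" for I
    unfolding superideal_iff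
  proof (intro conjI ballI impI)
    fix a b assume ab: "a \<in> even_part R" "b \<in> odd_part R" "a \<oplus> b \<in> I"
    have "(a \<oplus> b) \<ominus> b = a" using ab even_carr odd_carr by algebra
    then show "a \<in> I" using ideal_closed(4)[OF I(1) ab(3)] I(2) ab(2) by (metis subsetD)
  qed (fact I(1))
  have "A \<in> X" using super_primeD[OF A] by (simp add: X_def)
  moreover have "\<exists>n. \<forall>k\<ge>n. I k = I n" if I: "\<And>n. I n \<in> X \<and> I n \<subseteq> I (Suc n)" for I :: "nat \<Rightarrow> 'a set"
  proof -
    have "\<forall>n. superideal (I n) R \<and> I n \<subseteq> I (Suc n)" using graded I unfolding X_def by blast
    then show ?thesis using noeth unfolding noetherian_superring_def by blast
  qed
  ultimately obtain M where M: "M \<in> X" "\<And>V. \<lbrakk>V \<in> X; M \<subseteq> V\<rbrakk> \<Longrightarrow> V = M"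
    using maximal_element_of_acc[of X A] by metis
  have Mi: "ideal M R" "odd_part R \<subseteq> M" "\<one> \<notin> M" using M(1) by (simp_all add: X_def)
  note I = ideal_closed[OF Mi(1)]
  \<comment> \<open>By maximality, every even element outside \<open>M\<close> is invertible modulo \<open>M\<close>.\<close>
  have inv: "\<exists>r\<in>carrier R. r \<otimes> a \<ominus> \<one> \<in> M" if a: "a \<in> even_part R" "a \<notin> M" for a
  proof -
    have ac: "a \<in> carrier R" using a by blast
    define V where "V = {i \<oplus> r \<otimes> a |i r. i \<in> M \<and> r \<in> carrier R}"
    have VI: "i \<oplus> r \<otimes> a \<in> V" if "i \<in> M" "r \<in> carrier R" for i r using that unfolding V_def by blast
    have "ideal V R"
    proof (rule ideal_of_closed)
      show "V \<subseteq> carrier R" using I(1) ac unfolding V_def by auto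
      show "\<zero> \<in> V" using VI[of \<zero> \<zero>] I(2) ac by simp
      fix x assume "x \<in> V"
      then obtain i r where x: "i \<in> M" "r \<in> carrier R" "x = i \<oplus> r \<otimes> a" unfolding V_def by blast
      have ic: "i \<in> carrier R" using x(1) I(1) by blast
      {
        fix y assume "y \<in> V"
        then obtain j s where y: "j \<in> M" "s \<in> carrier R" "y = j \<oplus> s \<otimes> a" unfolding V_def by blast
        have jc: "j \<in> carrier R" using y(1) I(1) by blast
        have "x \<oplus> y = (i \<oplus> j) \<oplus> (r \<oplus> s) \<otimes> a"
          unfolding x(3) y(3) using ic jc x(2) y(2) ac by algebra
        then show "x \<oplus> y \<in> V" using VI[of "i \<oplus> j" "r \<oplus> s"] I(3) x y by simp
      next
        fix s assume s: "s \<in> carrier R"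
        have "s \<otimes> x = s \<otimes> i \<oplus> (s \<otimes> r) \<otimes> a"
          unfolding x(3) using ic x(2) ac s by algebra
        then show "s \<otimes> x \<in> V" using VI[of "s \<otimes> i" "s \<otimes> r"] I(5) x s by simp
        have "x \<otimes> s = i \<otimes> s \<oplus> r \<otimes> (a \<otimes> s)"
          unfolding x(3) using ic x(2) ac s by algebra
        also have "a \<otimes> s = s \<otimes> a" by (rule even_central[OF a(1) s])
        finally have "x \<otimes> s = i \<otimes> s \<oplus> (r \<otimes> s) \<otimes> a" using x(2) s ac by (simp add: m_assoc)
        then show "x \<otimes> s \<in> V" using VI[of "i \<otimes> s" "r \<otimes> s"] I(6) x s by simp
      }
    qed
    moreover have MV: "M \<subseteq> V"
    proof
      fix i assume "i \<in> M"
      moreover then have "i \<oplus> \<zero> \<otimes> a = i" using I(1) ac by auto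
      ultimately show "i \<in> V" using VI[of i \<zero>] by simp
    qed
    moreover have "a \<in> V" using VI[of \<zero> \<one>] I(2) ac by simp
    ultimately have "V \<notin> X" using M(2)[of V] a(2) by blast
    then have "\<one> \<in> V" using \<open>ideal V R\<close> MV Mi(2) unfolding X_def by blast
    then obtain i r where ir: "i \<in> M" "r \<in> carrier R" "\<one> = i \<oplus> r \<otimes> a" unfolding V_def by blast
    have ic: "i \<in> carrier R" using ir(1) I(1) by blast
    have "r \<otimes> a \<ominus> \<one> = \<zero> \<ominus> i" unfolding ir(3) using ic ir(2) ac by algebra
    then have "r \<otimes> a \<ominus> \<one> \<in> M" using I(4)[OF I(2) ir(1)] by simp
    then show ?thesis using ir(2) by blast
  qed
  have even_part_of: "\<exists>a b. a \<in> even_part R \<and> a \<notin> M \<and> b \<in> M \<and> b \<in> carrier R \<and> x = a \<oplus> b"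
    if "x \<in> carrier R" "x \<notin> M" for x
  proof -
    obtain a b where ab: "a \<in> even_part R" "b \<in> odd_part R" "x = a \<oplus> b"
      using graded_decomposition \<open>x \<in> carrier R\<close> by blast
    then have "a \<notin> M" using I(3) Mi(2) \<open>x \<notin> M\<close> by blast
    then show ?thesis using ab Mi(2) by blast
  qed
  have "super_maximal M R" unfolding super_maximal_iff super_prime_iff
  proof (intro conjI ballI impI)
    show "ideal M R" "\<one> \<notin> M" by (fact Mi)+
  next
    fix x y assume xy: "x \<in> carrier R" "y \<in> carrier R" "x \<otimes> y \<in> M"
    show "x \<in> M \<or> y \<in> M"
    proof (rule disjCI, rule ccontr)
      assume y: "y \<notin> M" and x: "x \<notin> M"
      obtain a b where ab: "a \<in> even_part R" "a \<notin> M" "b \<in> M" "b \<in> carrier R" "x = a \<oplus> b"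
        using even_part_of[OF xy(1) x] by blast
      obtain r where r: "r \<in> carrier R" "r \<otimes> a \<ominus> \<one> \<in> M" using inv[OF ab(1,2)] by blast
      have ac: "a \<in> carrier R" using ab by blast
      have "y = (r \<otimes> (x \<otimes> y) \<ominus> r \<otimes> (b \<otimes> y)) \<ominus> (r \<otimes> a \<ominus> \<one>) \<otimes> y"
        unfolding ab(5) using ab(4) ac xy(2) r(1) by algebra
      also have "\<dots> \<in> M" using I(4,5,6) r ab(3) xy by simp
      finally show False using y by simp
    qed
  next
    fix x assume "x \<in> carrier R - M"
    then have x: "x \<in> carrier R" "x \<notin> M" by auto
    obtain a b where ab: "a \<in> even_part R" "a \<notin> M" "b \<in> M" "b \<in> carrier R" "x = a \<oplus> b"
      using even_part_of[OF x] by blast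
    obtain r where r: "r \<in> carrier R" "r \<otimes> a \<ominus> \<one> \<in> M" using inv[OF ab(1,2)] by blast
    have ac: "a \<in> carrier R" using ab by blast
    have "x \<otimes> r \<ominus> \<one> = (a \<otimes> r \<ominus> \<one>) \<oplus> b \<otimes> r" unfolding ab(5) using ac ab(4) r(1) by algebra
    also have "a \<otimes> r = r \<otimes> a" by (rule even_central[OF ab(1) r(1)])
    finally have "x \<otimes> r \<ominus> \<one> \<in> M" using I(3)[OF r(2) I(6)[OF r(1) ab(3)]] by simp
    then show "\<exists>y\<in>carrier R. x \<otimes> y \<ominus> \<one> \<in> M" using r(1) by blast
  qed
  then show thesis by (rule that)
qed

end

section \<open>Odd generators of localizations\<close>

context even_multiplicative_set
begin

text \<open>The numerators of a generating set of the odd part of the localization generate the odd part of \<open>R\<close>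
  up to denominators.\<close>

lemma odd_generator_numerators:
  assumes B: "finite B" "B \<subseteq> odd_part L" "superring.odd_span L B = odd_part L"
  obtains N where "finite N" "N \<subseteq> odd_part R" "card N \<le> card B"
    "\<And>x. x \<in> odd_part R \<Longrightarrow> \<exists>u\<in>S. u \<otimes> x \<in> odd_span N"
proof -
  interpret L: superring L by (rule localization_superring)
  have "\<forall>b\<in>B. \<exists>a. a \<in> odd_part R \<and> (\<exists>s\<in>S. b = frac a s)" using B(2) L_odd by blast
  then obtain f where f: "\<And>b. b \<in> B \<Longrightarrow> f b \<in> odd_part R \<and> (\<exists>s\<in>S. b = frac (f b) s)" by metis
  define N where "N = f ` B"
  have N: "N \<subseteq> odd_part R" using f by (auto simp: N_def)
  note span = odd_submoduleD[OF odd_span_submodule[OF N]]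
  have num: "\<exists>r\<in>odd_span N. \<exists>s\<in>S. x = frac r s" if "x \<in> L.odd_span B" for x
    using that
  proof induction
    case zero
    then show ?case using odd_span.zero one_S L_zero by blast
  next
    case (add b q w)
    obtain s where s: "s \<in> S" "b = frac (f b) s" using f[OF add.hyps(1)] by blast
    obtain e t where e: "e \<in> even_part R" "t \<in> S" "q = frac e t" using add.hyps(2) L_even by blast
    obtain r v where r: "r \<in> odd_span N" "v \<in> S" "w = frac r v" using add.IH by blast
    have fb: "f b \<in> odd_part R" "f b \<in> odd_span N"
      using f[OF add.hyps(1)] odd_span_base[OF N] add.hyps(1) by (auto simp: N_def)
    have carr: "f b \<in> carrier R" "e \<in> carrier R" "r \<in> carrier R"
      using fb e r span(1) by blast+
    have "q \<otimes>\<^bsub>L\<^esub> b = frac (e \<otimes> f b) (act t s)"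
      using s(2) e(3) frac_mult[OF carr(2) e(2) carr(1) s(1)] by simp
    then have "q \<otimes>\<^bsub>L\<^esub> b \<oplus>\<^bsub>L\<^esub> w = frac (act v (e \<otimes> f b) \<oplus> act (act t s) r) (act (act t s) v)"
      using r carr s(1) e(2) by (simp add: frac_add)
    moreover have "act v (e \<otimes> f b) \<oplus> act (act t s) r \<in> odd_span N"
      using span(3,4) fb(2) e(1) r(1,2) s(1) e(2) S_evenD act_S unfolding act_def by (simp add: mult_S)
    moreover have "act (act t s) v \<in> S" using s(1) e(2) r(2) by simp
    ultimately show ?case by blast
  qed
  have "\<exists>u\<in>S. u \<otimes> x \<in> odd_span N" if x: "x \<in> odd_part R" for x
  proof -
    have "frac x \<one> \<in> L.odd_span B" using x B(3) one_S L_odd by blast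
    then obtain r s where r: "r \<in> odd_span N" "s \<in> S" "frac x \<one> = frac r s" using num by blast
    have rc: "r \<in> carrier R" using r(1) span(1) by blast
    obtain u where u: "u \<in> S" "act u (act s x) = act u (act \<one> r)"
      using r(3) frac_eq_iff[OF odd_carr[OF x] one_S rc r(2)] by blast
    then have "act u s \<otimes> x = u \<otimes> r" using rc r(2) odd_carr[OF x] by (simp add: act_def m_assoc)
    then have "act u s \<otimes> x \<in> odd_span N" using span(4)[OF S_evenD[OF u(1)] r(1)] by simp
    then show ?thesis using u(1) r(2) act_S by blast
  qed
  moreover have "finite N" "card N \<le> card B" using B(1) card_image_le by (auto simp: N_def)
  ultimately show thesis using that N by blast
qed

lemma odd_generators_of_numerators:
  assumes N: "N \<subseteq> odd_part R"
    and gen: "\<And>x. x \<in> odd_part R \<Longrightarrow> \<exists>u\<in>S. u \<otimes> x \<in> odd_span N"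
  shows "superring.odd_span L ((\<lambda>a. frac a \<one>) ` N) = odd_part L"
    and "(\<lambda>a. frac a \<one>) ` N \<subseteq> odd_part L"
proof -
  interpret L: superring L by (rule localization_superring)
  show sub: "(\<lambda>a. frac a \<one>) ` N \<subseteq> odd_part L"
  proof
    fix z assume "z \<in> (\<lambda>a. frac a \<one>) ` N"
    then show "z \<in> odd_part L" using N one_S L_odd by blast
  qed
  note span = odd_submoduleD[OF odd_span_submodule[OF N]]
  note spanL = L.odd_submoduleD[OF L.odd_span_submodule[OF sub]]
  have img: "frac r \<one> \<in> L.odd_span ((\<lambda>a. frac a \<one>) ` N)" if "r \<in> odd_span N" for r
    using that
  proof induction
    case zero
    then show ?case using L.odd_span.zero L_zero by simp
  next
    case (add b r w)
    have carr: "b \<in> carrier R" "r \<in> carrier R" "w \<in> carrier R"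
      using add.hyps N span(1) by blast+
    then have "frac (r \<otimes> b \<oplus> w) \<one> = frac r \<one> \<otimes>\<^bsub>L\<^esub> frac b \<one> \<oplus>\<^bsub>L\<^esub> frac w \<one>"
      using one_S by (simp add: frac_mult frac_add_same)
    moreover have "frac r \<one> \<in> even_part L" using add.hyps(2) one_S L_even by blast
    ultimately show ?case using L.odd_span.add[OF _ _ add.IH] add.hyps(1) by simp
  qed
  have "x \<in> L.odd_span ((\<lambda>a. frac a \<one>) ` N)" if x: "x \<in> odd_part L" for x
  proof -
    obtain r s where r: "r \<in> odd_part R" "s \<in> S" "x = frac r s" using x L_odd by blast
    obtain u where u: "u \<in> S" "u \<otimes> r \<in> odd_span N" using gen[OF r(1)] by blast
    have rc: "r \<in> carrier R" using r by blast
    have "x = frac (act u r) (act u s)" using r u rc by (simp add: frac_cancel)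
    also have "\<dots> = frac \<one> (act u s) \<otimes>\<^bsub>L\<^esub> frac (act u r) \<one>"
      using r u rc by (intro frac_split(1)) simp_all
    finally have "x = frac \<one> (act u s) \<otimes>\<^bsub>L\<^esub> frac (u \<otimes> r) \<one>" by (simp add: act_def)
    moreover have "act u s \<in> S" using u r by simp
    then have "frac \<one> (act u s) \<in> even_part L" using one_even L_even by blast
    ultimately show ?thesis using spanL(4) img[OF u(2)] by simp
  qed
  then show "L.odd_span ((\<lambda>a. frac a \<one>) ` N) = odd_part L"
    using L.odd_span_odd[OF sub] by blast
qed

end

section \<open>Regularity of the localizations\<close>

context superring
begin

lemma localization_at_unit:
  assumes P: "super_prime P R"
  defines "L \<equiv> localization_at R P"
    and "E \<equiv> even_multiplicative_set.extension R (even_part R - P) P"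
  assumes c: "c \<in> E \<inter> even_part L"
  shows "\<exists>u\<in>even_part L. u \<otimes>\<^bsub>L\<^esub> (\<one>\<^bsub>L\<^esub> \<ominus>\<^bsub>L\<^esub> c) = \<one>\<^bsub>L\<^esub>"
proof -
  interpret F: even_multiplicative_set R "even_part R - P"
    by (rule multiplicative_set_of_prime[OF P])
  interpret L: superring F.L by (rule F.localization_superring)
  have disj: "P \<inter> (even_part R - P) = {}" by blast
  note prime = F.extension_super_prime(1)[OF P disj]
  note E = L.super_primeD[OF prime]
  have cE: "c \<in> F.extension P" and ce: "c \<in> even_part F.L"
    using c by (simp_all add: E_def L_def localization_at_def)
  have "\<one>\<^bsub>F.L\<^esub> = (\<one>\<^bsub>F.L\<^esub> \<ominus>\<^bsub>F.L\<^esub> c) \<oplus>\<^bsub>F.L\<^esub> c" using L.even_carr[OF ce] by algebra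
  then have notin: "\<one>\<^bsub>F.L\<^esub> \<ominus>\<^bsub>F.L\<^esub> c \<notin> F.extension P"
    using L.ideal_closed(3)[OF E(1) _ cE] E(2) by metis
  have "\<one>\<^bsub>F.L\<^esub> \<ominus>\<^bsub>F.L\<^esub> c \<in> even_part F.L" using ce by simp
  then obtain a s where a: "a \<in> even_part R" "s \<in> even_part R - P"
    "\<one>\<^bsub>F.L\<^esub> \<ominus>\<^bsub>F.L\<^esub> c = F.frac a s"
    using F.L_even by blast
  have ac: "a \<in> carrier R" using a by blast
  have "a \<notin> P" using notin F.frac_in_extension_iff[OF P disj ac a(2)] a(3) by simp
  then have aS: "a \<in> even_part R - P" using a by blast
  have "F.frac s a \<otimes>\<^bsub>F.L\<^esub> F.frac a s = \<one>\<^bsub>F.L\<^esub>"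
    using F.frac_mult[OF F.S_carr[OF a(2)] aS ac a(2)] aS a(2) F.mult_to_act(2)[OF aS F.S_carr[OF a(2)]]
      F.frac_self[OF F.act_S[OF aS a(2)]] by simp
  moreover have "F.frac s a \<in> even_part F.L" using aS a(2) F.L_even by blast
  ultimately show ?thesis using a(3) by (auto simp: L_def localization_at_def)
qed

lemma Kdim_localization_at:
  assumes P: "super_prime P R"
  shows "Kdim (even_ring (localization_at R P)) = chain_dim {Q. super_prime Q R \<and> Q \<subseteq> P}"
proof -
  interpret F: even_multiplicative_set R "even_part R - P"
    by (rule multiplicative_set_of_prime[OF P])
  have "{Q. super_prime Q R \<and> Q \<inter> (even_part R - P) = {}} = {Q. super_prime Q R \<and> Q \<subseteq> P}"
    using prime_inside_iff[OF P] by blast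
  then show ?thesis using F.Kdim_localization by (simp add: localization_at_def)
qed

lemma Ksdim_odd_localization_at:
  assumes P: "super_prime P R"
    and J: "super_prime J R" "\<And>Q. super_prime Q R \<Longrightarrow> J \<subseteq> Q"
    and "Kdim (even_ring R) = ereal (real d)"
    and "Kdim (even_ring (localization_at R P)) = ereal (real e)"
  shows "snd (Ksdim (localization_at R P)) = snd (Ksdim R)"
proof -
  interpret F: even_multiplicative_set R "even_part R - P"
    by (rule multiplicative_set_of_prime[OF P])
  have disj: "J \<inter> (even_part R - P) = {}" using J(2)[OF P] by blast
  show ?thesis
    using F.odd_parameters_length_localization[OF J(1) disj J(2) assms(4)] assms(5)
    by (simp add: Ksdim_def localization_at_def)
qed

text \<open>The maximal ideal of the localization at \<open>J\<close> is generated by odd elements, so its even elements are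
  sums of products of two odd ones and lie in its square.\<close>

lemma cotangent_even_zero:
  assumes J: "super_prime J R" and gen: "J = odd_ideal R"
  defines "L \<equiv> localization_at R J"
    and "m \<equiv> even_multiplicative_set.extension R (even_part R - J) J"
  shows "vectorspace.dim (L Quot m) (cotangent_part L m (even_part L)) = 0"
proof -
  interpret F: even_multiplicative_set R "even_part R - J"
    by (rule multiplicative_set_of_prime[OF J])
  interpret L: superring F.L by (rule F.localization_superring)
  have L_eq: "L = F.L" by (simp add: L_def localization_at_def)
  have max: "super_maximal m F.L"
    using localization_at_maximal(1)[OF J] by (simp add: m_def localization_at_def)
  note M = L.super_maximalD[OF max]
  let ?T = "{t \<oplus>\<^bsub>F.L\<^esub> y |t y. t \<in> ideal_prod F.L m m \<inter> even_part F.L \<and> y \<in> odd_part F.L}"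
  have T: "ideal ?T F.L" by (rule L.even_square_ideal[OF M(2,3)])
  have m2_zero: "\<zero>\<^bsub>F.L\<^esub> \<in> ideal_prod F.L m m \<inter> even_part F.L"
    using L.ideal_closed(2)[OF L.ideal_prod_is_ideal[OF M(2) M(2)]] by simp
  have "odd_part R \<subseteq> F.contraction ?T"
  proof
    fix a assume a: "a \<in> odd_part R"
    then have "F.frac a \<one> \<in> odd_part F.L" using F.one_S F.L_odd by blast
    moreover then have "F.frac a \<one> = \<zero>\<^bsub>F.L\<^esub> \<oplus>\<^bsub>F.L\<^esub> F.frac a \<one>" using L.odd_carr by simp
    ultimately have "F.frac a \<one> \<in> ?T" using m2_zero by blast
    then show "a \<in> F.contraction ?T" using a odd_carr by (simp add: F.contraction_def)
  qed
  then have "J \<subseteq> F.contraction ?T"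
    using genideal_minimal[OF F.contraction_ideal[OF T]] by (simp only: gen odd_ideal_def)
  then have "F.extension J \<subseteq> F.extension (F.contraction ?T)" by (rule F.extension_mono)
  then have "m \<subseteq> ?T" by (simp only: F.extension_contraction[OF T] m_def[symmetric])
  have "m \<inter> even_part F.L \<subseteq> ideal_prod F.L m m"
  proof
    fix x assume x: "x \<in> m \<inter> even_part F.L"
    then obtain t y where t: "t \<in> ideal_prod F.L m m" "t \<in> even_part F.L" "y \<in> odd_part F.L"
      "x = t \<oplus>\<^bsub>F.L\<^esub> y" using \<open>m \<subseteq> ?T\<close> by blast
    then have "x \<oplus>\<^bsub>F.L\<^esub> \<zero>\<^bsub>F.L\<^esub> = t \<oplus>\<^bsub>F.L\<^esub> y" using x L.even_carr by simp
    then have "x = t" using L.graded_decomposition_unique(1)[of x t "\<zero>\<^bsub>F.L\<^esub>" y] x t by simp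
    then show "x \<in> ideal_prod F.L m m" using t by simp
  qed
  then show ?thesis unfolding L_eq using L.cotangent_dim_zero[OF max L.graded_piece_parts(1)] by simp
qed

text \<open>Being generated up to denominators by finitely many numerators passes from the complement of \<open>P\<close> to the
  larger complement of \<open>J\<close>.\<close>

lemma odd_generators_smaller_prime:
  assumes P: "super_prime P R" and J: "super_prime J R" "J \<subseteq> P"
    and B: "finite B" "B \<subseteq> odd_part (localization_at R P)"
      "superring.odd_span (localization_at R P) B = odd_part (localization_at R P)"
  obtains C where "finite C" "C \<subseteq> odd_part (localization_at R J)" "card C \<le> card B"
    "superring.odd_span (localization_at R J) C = odd_part (localization_at R J)"
proof -
  interpret F: even_multiplicative_set R "even_part R - P"
    by (rule multiplicative_set_of_prime[OF P])
  interpret G: even_multiplicative_set R "even_part R - J"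
    by (rule multiplicative_set_of_prime[OF J(1)])
  obtain N where N: "finite N" "N \<subseteq> odd_part R" "card N \<le> card B"
    "\<And>x. x \<in> odd_part R \<Longrightarrow> \<exists>u\<in>even_part R - P. u \<otimes> x \<in> odd_span N"
    using F.odd_generator_numerators B unfolding localization_at_def by metis
  have gen: "\<exists>u\<in>even_part R - J. u \<otimes> x \<in> odd_span N" if "x \<in> odd_part R" for x
    using N(4)[OF that] J(2) by blast
  let ?C = "(\<lambda>a. G.frac a \<one>) ` N"
  have "card ?C \<le> card B" using card_image_le[OF N(1)] N(3) le_trans by blast
  then show thesis
    using that[of ?C] N(1) G.odd_generators_of_numerators[OF N(2) gen]
    by (simp add: localization_at_def)
qed

end

lemma regular_local_superringD:
  assumes "regular_local_superring L" "{I. super_maximal I L} = {m}"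
  shows "noetherian_superring L"
    and "Ksdim L = (ereal (real (vectorspace.dim (L Quot m) (cotangent_part L m (even_part L)))),
      vectorspace.dim (L Quot m) (cotangent_part L m (odd_part L)))"
  using assms by (auto simp: regular_local_superring_def)

section \<open>Noetherian superdomains of dimension one\<close>

locale noetherian_superdomain =
  fixes R :: "('a, 'b) superring_scheme" (structure)
  assumes noetherian: "noetherian_superring R" and superdomain: "superdomain R"
begin

sublocale superring R
  using noetherian by (simp add: noetherian_superring_def)

abbreviation J where "J \<equiv> odd_ideal R"
abbreviation loc where "loc \<equiv> localization_at R"

lemmas J_prime = superdomain_least_prime(1)[OF superdomain]
lemmas J_least = superdomain_least_prime(2)[OF superdomain]

lemma Kdim_loc_J: "Kdim (even_ring (loc J)) = ereal (real 0)"
proof -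
  have "{Q. super_prime Q R \<and> Q \<subseteq> J} = {J}" using J_prime J_least by blast
  moreover have "chain_dim {J} = ereal (real 0)"
    unfolding chain_dim_eq_iff has_chain_def by auto
  ultimately show ?thesis using Kdim_localization_at[OF J_prime] by simp
qed

lemma Kdim_loc_one:
  assumes R: "Kdim (even_ring R) = ereal (real 1)" and P: "super_prime P R" "P \<noteq> J"
  shows "Kdim (even_ring (loc P)) = ereal (real 1)"
  unfolding Kdim_localization_at[OF P(1)] chain_dim_eq_iff
proof
  show "has_chain {Q. super_prime Q R \<and> Q \<subseteq> P} 1"
    unfolding has_chain_def
    by (rule exI[of _ "\<lambda>i. if i = 0 then J else P"]) (use J_prime J_least[OF P(1)] P in auto)
  show "\<not> has_chain {Q. super_prime Q R \<and> Q \<subseteq> P} (Suc 1)"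
    using R has_chain_image[of "{Q. super_prime Q R \<and> Q \<subseteq> P}" "Suc 1" "\<lambda>Q. Q" "{Q. super_prime Q R}"]
    unfolding Kdim_even_ring chain_dim_eq_iff by blast
qed

text \<open>A chain of three primes survives in the localization at its largest member, which is not the least
  prime.\<close>

lemma Kdim_one_of_loc:
  assumes P: "super_prime P R"
    and loc: "\<And>P. \<lbrakk>super_prime P R; P \<noteq> J\<rbrakk> \<Longrightarrow> Kdim (even_ring (loc P)) = ereal (real 1)"
    and "P \<noteq> J"
  shows "Kdim (even_ring R) = ereal (real 1)"
  unfolding Kdim_even_ring chain_dim_eq_iff
proof
  have "has_chain {Q. super_prime Q R \<and> Q \<subseteq> P} 1"
    using loc[OF P \<open>P \<noteq> J\<close>] unfolding Kdim_localization_at[OF P] chain_dim_eq_iff by blast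
  then show "has_chain {Q. super_prime Q R} 1"
    by (rule has_chain_image[where f = "\<lambda>Q. Q"]) auto
  show "\<not> has_chain {Q. super_prime Q R} (Suc 1)"
  proof
    assume "has_chain {Q. super_prime Q R} (Suc 1)"
    then obtain p where p: "\<forall>i\<le>2. super_prime (p i) R" "\<forall>i<2. p i \<subset> p (Suc i)"
      unfolding has_chain_def by (auto simp: numeral_2_eq_2)
    have pr: "super_prime (p 0) R" "super_prime (p 1) R" "super_prime (p 2) R" using p(1) by auto
    have sub: "p 0 \<subset> p 1" "p 1 \<subset> p 2" using p(2)[rule_format, of 0] p(2)[rule_format, of 1]
      by (simp_all add: numeral_2_eq_2)
    then have "p 2 \<noteq> J" using J_least[OF pr(2)] by blast
    moreover have "has_chain {Q. super_prime Q R \<and> Q \<subseteq> p 2} (Suc 1)"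
      unfolding has_chain_def
    proof (intro exI[of _ p] conjI allI impI)
      fix i :: nat assume "i \<le> Suc 1"
      then have "i = 0 \<or> i = 1 \<or> i = 2" by auto
      then show "p i \<in> {Q. super_prime Q R \<and> Q \<subseteq> p 2}" using pr sub by auto
    next
      fix i :: nat assume "i < Suc 1"
      then show "p i \<subset> p (Suc i)" using p(2) by (simp add: numeral_2_eq_2)
    qed
    ultimately show False
      using loc[OF pr(3)] unfolding Kdim_localization_at[OF pr(3)] chain_dim_eq_iff by blast
  qed
qed

text \<open>A regular localization at a prime forces the localization at the minimal prime to be regular:
  the odd part of the former, hence that of the latter, has as many generators as there are odd
  parameters, and fewer generators would make every product of so many odd elements vanish.\<close>

lemma regular_at_J:
  assumes P: "super_prime P R" and reg: "regular_local_superring (loc P)"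
    and d: "Kdim (even_ring R) = ereal (real d)"
    and e: "Kdim (even_ring (loc P)) = ereal (real e)"
  shows "regular_local_superring (loc J)"
proof -
  define mP where "mP = even_multiplicative_set.extension R (even_part R - P) P"
  define mJ where "mJ = even_multiplicative_set.extension R (even_part R - J) J"
  interpret F: even_multiplicative_set R "even_part R - P"
    by (rule multiplicative_set_of_prime[OF P])
  interpret G: even_multiplicative_set R "even_part R - J"
    by (rule multiplicative_set_of_prime[OF J_prime])
  interpret LP: superring "loc P" unfolding localization_at_def by (rule F.localization_superring)
  interpret LJ: superring "loc J" unfolding localization_at_def by (rule G.localization_superring)
  have maxP: "super_maximal mP (loc P)" "{I. super_maximal I (loc P)} = {mP}"
    using localization_at_maximal[OF P] by (simp_all add: mP_def)
  have maxJ: "super_maximal mJ (loc J)" "{I. super_maximal I (loc J)} = {mJ}"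
    using localization_at_maximal[OF J_prime] by (simp_all add: mJ_def)
  have noethJ: "noetherian_superring (loc J)"
    unfolding localization_at_def by (rule G.localization_noetherian[OF noetherian])
  note regP = regular_local_superringD[OF reg maxP(2)]
  let ?N = "snd (Ksdim (loc J))"
  let ?dim = "vectorspace.dim (loc J Quot mJ) (cotangent_part (loc J) mJ (odd_part (loc J)))"
  have sndP: "snd (Ksdim (loc P)) = ?N"
    using Ksdim_odd_localization_at[OF P J_prime J_least d e]
      Ksdim_odd_localization_at[OF J_prime J_prime J_least d Kdim_loc_J] by simp
  obtain B where B: "finite B" "B \<subseteq> odd_part (loc P)" "LP.odd_span B = odd_part (loc P)"
    "card B \<le> vectorspace.dim (loc P Quot mP) (cotangent_part (loc P) mP (odd_part (loc P)))"
    using LP.cotangent_odd_generators[OF regP(1) maxP(1)]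
      localization_at_unit[OF P, folded mP_def] by blast
  obtain C where C: "finite C" "C \<subseteq> odd_part (loc J)" "card C \<le> card B"
    "LJ.odd_span C = odd_part (loc J)"
    using odd_generators_smaller_prime[OF P J_prime J_least[OF P] B(1-3)] .
  have "?dim \<le> card C" by (rule LJ.cotangent_odd_dim_le[OF maxJ(1) C(1,2,4)])
  also have "\<dots> \<le> ?N" using C(3) B(4) regP(2) sndP by simp
  finally have "?dim \<le> ?N" .
  moreover have "?N \<le> ?dim"
  proof (rule LJ.Ksdim_odd_le_cotangent[OF noethJ maxJ(1) _ Kdim_loc_J])
    have disj: "J \<inter> (even_part R - J) = {}" by blast
    show "super_prime mJ (loc J)" using maxJ(1) LJ.super_maximal_iff by blast
    show "mJ \<subseteq> Q" if "super_prime Q (loc J)" for Q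
      using G.extension_least_prime[OF J_prime disj J_least] that
      unfolding mJ_def localization_at_def by blast
  qed (use localization_at_unit[OF J_prime, folded mJ_def] in blast)
  ultimately have "?N = ?dim" by simp
  moreover have "fst (Ksdim (loc J)) = 0" using Kdim_loc_J by (simp add: Ksdim_def)
  moreover have "vectorspace.dim (loc J Quot mJ) (cotangent_part (loc J) mJ (even_part (loc J))) = 0"
    using cotangent_even_zero[OF J_prime refl] by (simp add: mJ_def)
  ultimately have "Ksdim (loc J) =
      (ereal (real (vectorspace.dim (loc J Quot mJ) (cotangent_part (loc J) mJ (even_part (loc J))))), ?dim)"
    by (simp add: prod_eq_iff)
  then show ?thesis
    unfolding regular_local_superring_def using noethJ maxJ(2) by blast
qed

lemma J_not_maximal:
  assumes "Kdim (even_ring R) = ereal (real 1)"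
  shows "\<not> super_maximal J R"
proof
  assume max: "super_maximal J R"
  have "has_chain {P. super_prime P R} 1" using assms unfolding Kdim_even_ring chain_dim_eq_iff by blast
  then obtain p where p: "super_prime (p 0) R" "super_prime (p 1) R" "p 0 \<subset> p (1::nat)"
    unfolding has_chain_def by auto
  then obtain x where x: "x \<in> p 1" "x \<notin> J" using J_least by blast
  note p1 = super_primeD[OF p(2)]
  note I = ideal_closed[OF p1(1)]
  have xc: "x \<in> carrier R" using x(1) I(1) by blast
  then obtain y where y: "y \<in> carrier R" "x \<otimes> y \<ominus> \<one> \<in> J" using max x super_maximal_iff by blast
  have "\<one> = x \<otimes> y \<ominus> (x \<otimes> y \<ominus> \<one>)" using xc y(1) by algebra
  also have "\<dots> \<in> p 1" using I(4)[OF I(6)[OF y(1) x(1)]] y(2) J_least[OF p(2)] by blast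
  finally show False using p1(2) by simp
qed

lemma localizations_of_regular:
  assumes reg: "regular_superring R" and K: "Ksdim R = (1, N)"
    and P: "super_prime P R" "P = J \<longrightarrow> super_maximal P R"
  shows "discrete_valuation_superring (loc P) \<and> snd (Ksdim (loc P)) = N"
proof -
  have one: "Kdim (even_ring R) = ereal (real 1)" using K by (simp add: Ksdim_def one_ereal_def)
  have "P \<noteq> J" using J_not_maximal[OF one] P(2) by blast
  note dim = Kdim_loc_one[OF one P(1) this]
  have "snd (Ksdim (loc P)) = N"
    using Ksdim_odd_localization_at[OF P(1) J_prime J_least one dim] K by simp
  moreover from this dim have "Ksdim (loc P) = (1, N)"
    by (simp add: prod_eq_iff) (simp add: Ksdim_def one_ereal_def)
  moreover have "regular_local_superring (loc P)" using reg P(1) by (simp add: regular_superring_def)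
  ultimately show ?thesis unfolding discrete_valuation_superring_def by blast
qed

lemma regular_of_localizations:
  assumes dv: "\<And>P. \<lbrakk>super_prime P R; P = J \<longrightarrow> super_maximal P R\<rbrakk> \<Longrightarrow>
    discrete_valuation_superring (loc P)"
  obtains P where "super_prime P R" "P = J \<longrightarrow> super_maximal P R"
    "regular_superring R" "Ksdim R = (1, snd (Ksdim (loc P)))"
proof -
  have dim: "Kdim (even_ring (loc P)) = ereal (real 1)"
    if "super_prime P R" "P = J \<longrightarrow> super_maximal P R" for P
    using dv[OF that] by (auto simp: discrete_valuation_superring_def Ksdim_def one_ereal_def)
  obtain Q where Q: "super_maximal Q R" using super_maximal_exists[OF noetherian J_prime] .
  then have Qp: "super_prime Q R" using super_maximal_iff by blast
  have QJ: "Q \<noteq> J"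
  proof
    assume "Q = J"
    with dim[OF Qp] Q Kdim_loc_J show False by simp
  qed
  have one: "Kdim (even_ring R) = ereal (real 1)"
    by (rule Kdim_one_of_loc[OF Qp _ QJ]) (use dim in blast)
  have reg: "regular_local_superring (loc P)" if "super_prime P R" "P \<noteq> J" for P
    using dv that by (simp add: discrete_valuation_superring_def)
  have "regular_local_superring (loc J)"
    by (rule regular_at_J[OF Qp reg[OF Qp QJ] one dim[OF Qp]]) (use QJ in blast)
  then have "regular_superring R"
    unfolding regular_superring_def using noetherian reg by blast
  moreover have "Ksdim R = (1, snd (Ksdim (loc Q)))"
    using one Ksdim_odd_localization_at[OF Qp J_prime J_least one dim[OF Qp]] QJ
    by (simp add: prod_eq_iff) (simp add: Ksdim_def one_ereal_def)
  ultimately show thesis using that[OF Qp] QJ by blast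
qed

end

(* At the prime odd_ideal R the localization has even dimension 0, so clause (ii) has to leave
   this prime out, as one leaves out the zero ideal for a Dedekind domain. When odd_ideal R is
   maximal it is the only prime, and it is kept.
   First conjunct: N fixed on both sides; second conjunct: N existential on both sides. *)
theorem proposition5p14:
  fixes R :: "('a, 'b) superring_scheme"
  assumes "noetherian_superring R" and "superdomain R"
  shows
    "(\<forall>N. regular_superring R \<and> Ksdim R = (1, N) \<longleftrightarrow>
        (\<forall>P. super_prime P R \<and> (P = odd_ideal R \<longrightarrow> super_maximal P R) \<longrightarrow>
          discrete_valuation_superring (localization_at R P) \<and>
          snd (Ksdim (localization_at R P)) = N)) \<and>
     ((\<exists>N. regular_superring R \<and> Ksdim R = (1, N)) \<longleftrightarrow>
        (\<forall>P. super_prime P R \<and> (P = odd_ideal R \<longrightarrow> super_maximal P R) \<longrightarrow>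
          discrete_valuation_superring (localization_at R P)))"
proof -
  interpret noetherian_superdomain R
    by (rule noetherian_superdomain.intro[OF assms])
  have backward: "\<exists>P. super_prime P R \<and> (P = odd_ideal R \<longrightarrow> super_maximal P R) \<and>
      regular_superring R \<and> Ksdim R = (1, snd (Ksdim (localization_at R P)))"
    if "\<forall>P. super_prime P R \<and> (P = odd_ideal R \<longrightarrow> super_maximal P R) \<longrightarrow>
      discrete_valuation_superring (localization_at R P)"
    using regular_of_localizations that by (metis (no_types, lifting))
  show ?thesis
  proof (intro conjI allI iffI impI)
    fix N
    assume "\<forall>P. super_prime P R \<and> (P = odd_ideal R \<longrightarrow> super_maximal P R) \<longrightarrow>
      discrete_valuation_superring (localization_at R P) \<and> snd (Ksdim (localization_at R P)) = N"
    then show "regular_superring R" "Ksdim R = (1, N)" using backward by auto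
  qed (use localizations_of_regular backward in blast)+
qed

end
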